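(* Let $(\mathfrak l_i,\theta_{\mathfrak l_i})$, $i=1,2$, be admissible Lie algebras with involution. Let $\mathfrak a_i$, $i=1,2$, be orthogonal $(\mathfrak l_i,\theta_{\mathfrak l_i})$-modules and suppose $(\alpha_i,\gamma_i)\in\mathcal Z^2_Q(\mathfrak l_i,\mathfrak a_i)_+$ are such that $[\alpha_i,\gamma_i]\in\mathcal H^2_Q(\mathfrak l_i,\theta_{\mathfrak l_i},\mathfrak a_i)_\sharp$. Then $\mathfrak d_{\alpha_1,\gamma_1}(\mathfrak l_1,\theta_{\mathfrak l_1},\mathfrak a_1)$ and $\mathfrak d_{\alpha_2,\gamma_2}(\mathfrak l_2,\theta_{\mathfrak l_2},\mathfrak a_2)$ are isomorphic as symmetric triples if and only if there is an isomorphism of triples $(S,U):(\mathfrak l_1,\theta_{\mathfrak l_1},\mathfrak a_1)\to(\mathfrak l_2,\theta_{\mathfrak l_2},\mathfrak a_2)$ such that $(S,U)^*[\alpha_2,\gamma_2]=[\alpha_1,\gamma_1]\in\mathcal H^2_Q(\mathfrak l_1,\theta_{\mathfrak l_1},\mathfrak a_1)_\sharp$.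
   Context: All Lie algebras and vector spaces are finite-dimensional over $\mathbb R$; a scalar product is a non-degenerate symmetric bilinear form, possibly indefinite. A Lie algebra with involution is a pair $(\mathfrak l,\theta_{\mathfrak l})$, $\theta_{\mathfrak l}\in\mathrm{Aut}(\mathfrak l)$, $\theta_{\mathfrak l}^2=\mathrm{Id}$; homomorphisms commute with the involutions. Subscripts $\pm$ denote $\pm1$-eigenspaces of an involution. A symmetric triple $(\mathfrak g,\theta,\langle\cdot,\cdot\rangle)$ is a Lie algebra with ad-invariant scalar product and isometric involutive automorphism with $[\mathfrak g_-,\mathfrak g_-]=\mathfrak g_+$; isomorphisms are isometric Lie algebra isomorphisms commuting with the involutions. **Modules and quadratic cohomology.** An orthogonal $(\mathfrak l,\theta_{\mathfrak l})$-module is $(\rho,\mathfrak a,\langle\cdot,\cdot\rangle_{\mathfrak a},\theta_{\mathfrak a})$ with $\rho$ a representation of $\mathfrak l$ on $\mathfrak a$ by skew-adjoint maps and $\theta_{\mathfrak a}$ an involutive isometry with $\theta_{\mathfrak a}\circ\rho(\theta_{\mathfrak l}(L))=\rho(L)\circ\theta_{\mathfrak a}$ for all $L\in\mathfrak l$. $C^p(\mathfrak l,\mathfrak a)=\mathrm{Hom}(\bigwedge^p\mathfrak l,\mathfrak a)$ and $C^p(\mathfrak l)=\mathrm{Hom}(\bigwedge^p\mathfrak l,\mathbb R)$ carry the Chevalley–Eilenberg differentials $d$; $\langle\alpha\wedge\tau\rangle\in C^{p+q}(\mathfrak l)$ is the (shuffle) wedge product of $\alpha\in C^p(\mathfrak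 l,\mathfrak a)$, $\tau\in C^q(\mathfrak l,\mathfrak a)$ composed with $\langle\cdot,\cdot\rangle_{\mathfrak a}$. The involution $\Theta$ is $(\Theta\alpha)(L_1,\dots)=\theta_{\mathfrak a}(\alpha(\theta_{\mathfrak l}L_1,\dots))$ on $C^p(\mathfrak l,\mathfrak a)$ and $(\Theta\gamma)(L_1,\dots)=\gamma(\theta_{\mathfrak l}L_1,\dots)$ on $C^p(\mathfrak l)$. Put $\mathcal Z^2_Q(\mathfrak l,\mathfrak a)_+=\{(\alpha,\gamma)\in C^2(\mathfrak l,\mathfrak a)_+\oplus C^3(\mathfrak l)_+\mid d\alpha=0,\ d\gamma=\frac12\langle\alpha\wedge\alpha\rangle\}$. The group $\mathcal C^1_Q(\mathfrak l,\mathfrak a)_+=C^1(\mathfrak l,\mathfrak a)_+\oplus C^2(\mathfrak l)_+$ with product $(\tau_1,\sigma_1)*(\tau_2,\sigma_2)=(\tau_1+\tau_2,\sigma_1+\sigma_2+\frac12\langle\tau_1\wedge\tau_2\rangle)$ acts on it by $(\alpha,\gamma)(\tau,\sigma)=(\alpha+d\tau,\ \gamma+d\sigma+\langle(\alpha+\frac12d\tau)\wedge\tau\rangle)$, and $\mathcal H^2_Q(\mathfrak l,\theta_{\mathfrak l},\mathfrak a)$ is the set of orbits $[\alpha,\gamma]$. **Morphisms of triples.** A morphism $(S,U):(\mathfrak l_1,\theta_{\mathfrak l_1},\mathfrak a_1)\to(\mathfrak l_2,\theta_{\mathfrak l_2},\mathfrak a_2)$ consists of a homomorphism of Lie algebras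 with involution $S:\mathfrak l_1\to\mathfrak l_2$ and an isometric embedding $U:\mathfrak a_2\to\mathfrak a_1$ commuting with the involutions with $U\circ\rho_2(S(L))=\rho_1(L)\circ U$. It is an isomorphism if $S,U$ are bijective. It induces $(S,U)^*[\alpha,\gamma]=[U\circ S^*\alpha,S^*\gamma]$ from $\mathcal H^2_Q(\mathfrak l_2,\theta_{\mathfrak l_2},\mathfrak a_2)$ to $\mathcal H^2_Q(\mathfrak l_1,\theta_{\mathfrak l_1},\mathfrak a_1)$. **Standard model.** For $(\alpha,\gamma)\in\mathcal Z^2_Q(\mathfrak l,\mathfrak a)_+$, $\mathfrak d_{\alpha,\gamma}(\mathfrak l,\theta_{\mathfrak l},\mathfrak a)$ is $\mathfrak l^*\oplus\mathfrak a\oplus\mathfrak l$ with $\langle Z_1+A_1+L_1,Z_2+A_2+L_2\rangle=\langle A_1,A_2\rangle_{\mathfrak a}+Z_1(L_2)+Z_2(L_1)$, $\theta=\theta_{\mathfrak l}^*\oplus\theta_{\mathfrak a}\oplus\theta_{\mathfrak l}$ and antisymmetric bracket $[\mathfrak l^*,\mathfrak l^*\oplus\mathfrak a]=0$, $[L_1,L_2]=\gamma(L_1,L_2,\cdot)+\alpha(L_1,L_2)+[L_1,L_2]_{\mathfrak l}$, $[L,A]=\rho(L)A-\langle A,\alpha(L,\cdot)\rangle_{\mathfrak a}$, $[L,Z]=-Z([L,\cdot]_{\mathfrak l})$, $[A_1,A_2]=\langle\rho(\cdot)A_1,A_2\rangle_{\mathfrak a}$. (For admissible $[\alpha,\gamma]$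 as below it is a symmetric triple.) **Admissibility.** For a Lie algebra $\mathfrak l$: $S_1(\mathfrak l)$ is the largest ideal that is a semi-simple $\mathfrak l$-module; $R_0(\mathfrak l)=\mathfrak l$ and $R_k(\mathfrak l)$ is the smallest ideal contained in $R_{k-1}(\mathfrak l)$ such that the $\mathfrak l$-module $R_{k-1}(\mathfrak l)/R_k(\mathfrak l)$ is semi-simple. Let $(\mathfrak l,\theta_{\mathfrak l})$ satisfy $(T_1)$: $[\mathfrak l_-,\mathfrak l_-]=\mathfrak l_+$, let $(\rho,\mathfrak a)$ be a semi-simple orthogonal $(\mathfrak l,\theta_{\mathfrak l})$-module and $(\alpha,\gamma)\in\mathcal Z^2_Q(\mathfrak l,\mathfrak a)_+$. Let $\alpha=\alpha_0+\alpha_1$ according to $\mathfrak a=\mathfrak a^{\mathfrak l}\oplus\rho(\mathfrak l)\mathfrak a$. Regard $[\cdot,\cdot]_{\mathfrak l}$ and $\alpha_0$ as linear maps on $\bigwedge^2\mathfrak l$, and let $[\cdot,\cdot]_{\mathfrak l_-}$ be the restriction of the bracket to $\bigwedge^2\mathfrak l_-$. Conditions: - $(A_0)$: if $L_0\in\mathfrak z(\mathfrak l)\cap\ker\rho$ is such that there exist $A_0\in\mathfrak a$, $Z_0\in\mathfrak l^*$ with $\alpha(L,L_0)=\rho(L)A_0$ and $\gamma(L,L_0,\cdot)=-\langle A_0,\alpha(L,\cdot)\rangle_{\mathfrak a}+Z_0([L,\cdot])$ in $\mathfrak l^*$ for all $L\in\mathfrak l$, then $L_0=0$. - $(B_0)$: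 the subspace $\alpha_0(\ker[\cdot,\cdot]_{\mathfrak l})\subset\mathfrak a^{\mathfrak l}$ is non-degenerate. - $(T_2)$: $\mathfrak a^{\mathfrak l}_+=\alpha_0(\ker[\cdot,\cdot]_{\mathfrak l_-})$. - $(A_k)$, $k\ge1$: if $\mathfrak k\subset S_1(\mathfrak l)\cap R_k(\mathfrak l)$ is an ideal of $\mathfrak l$ such that there exist $\Phi_1\in\mathrm{Hom}(\mathfrak k,\mathfrak a)$, $\Phi_2\in\mathrm{Hom}(\mathfrak k,R_k(\mathfrak l)^* )$ with $\alpha(L,K)=\rho(L)\Phi_1(K)-\Phi_1([L,K])$ and $\gamma(L,K,\cdot)=-\langle\Phi_1(K),\alpha(L,\cdot)\rangle_{\mathfrak a}+\Phi_2(K)([L,\cdot])+\Phi_2([L,K])(\cdot)$ in $R_k(\mathfrak l)^*$ for all $L\in\mathfrak l,K\in\mathfrak k$, then $\mathfrak k=0$. - $(B_k)$, $k\ge1$: let $\mathfrak b_k\subset\mathfrak a$ be the maximal $\mathfrak l$-submodule such that for some $\Phi\in\mathrm{Hom}(R_k(\mathfrak l),\mathfrak a)$ one has $\langle\alpha(L,K),B\rangle_{\mathfrak a}=\langle\rho(L)\Phi(K)-\Phi([L,K]),B\rangle_{\mathfrak a}$ for all $L\in\mathfrak l,K\in R_k(\mathfrak l),B\in\mathfrak b_k$; then $\mathfrak b_k$ is non-degenerate. $\mathcal H^2_Q(\mathfrak l,\theta_{\mathfrak l},\mathfrak a)_\sharp$ (defined for semi-simple $\mathfrak a$) is the set of classes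 $[\alpha,\gamma]$ for which $(T_2)$, $(A_k)$, $(B_k)$, $0\le k\le m$, hold, where $R_{m+1}(\mathfrak l)=0$ (this depends only on the class). $(\mathfrak l,\theta_{\mathfrak l})$ is admissible if it satisfies $(T_1)$ and $\mathcal H^2_Q(\mathfrak l,\theta_{\mathfrak l},\mathfrak a)_\sharp\ne\emptyset$ for some semi-simple orthogonal module $\mathfrak a$. *)

theory Defs
  imports "HOL-Analysis.Linear_Algebra" "HOL-Analysis.Product_Vector"
begin

section \<open>Finite-dimensional real vector spaces\<close>

text \<open>
  A vector space is a type of the following class. In contrast to \<^class>\<open>euclidean_space\<close> there is no
  preferred inner product and dimension 0 is allowed (instance \<^typ>\<open>unit\<close> below); the cases
  \<open>\<a> = 0\<close> and \<open>\<l> = 0\<close> do occur.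
\<close>

class findim_real_vector = real_vector +
  assumes finite_spanning: "\<exists>B. finite B \<and> (\<forall>x. \<exists>c. x = (\<Sum>b\<in>B. c b *\<^sub>R b))"

instantiation unit :: findim_real_vector
begin

definition "(0::unit) = ()"
definition "(x::unit) + y = ()"
definition "(r::real) *\<^sub>R (x::unit) = ()"

instance
  by standard auto

end

lemma findim_span_UNIV:
  "\<exists>B::'a::findim_real_vector set. finite B \<and> span B = UNIV"
proof -
  obtain B :: "'a set" where B: "finite B" "\<forall>x. \<exists>c. x = (\<Sum>b\<in>B. c b *\<^sub>R b)"
    using finite_spanning by blast
  have "x \<in> span B" for x
  proof -
    obtain c where "x = (\<Sum>b\<in>B. c b *\<^sub>R b)" using B(2) by blast
    then show ?thesis by (auto intro: span_sum span_scale span_base)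
  qed
  with B(1) show ?thesis by blast
qed

lemma findimI_span:
  fixes B :: "'a::real_vector set"
  assumes "finite B" "span B = UNIV"
  shows "\<exists>B::'a set. finite B \<and> (\<forall>x. \<exists>c. x = (\<Sum>b\<in>B. c b *\<^sub>R b))"
proof (intro exI[of _ B] conjI allI)
  fix x :: 'a
  have "x \<in> range (\<lambda>u. \<Sum>v\<in>B. u v *\<^sub>R v)"
    using assms span_finite[OF assms(1)] by auto
  then show "\<exists>c. x = (\<Sum>b\<in>B. c b *\<^sub>R b)" by auto
qed (rule assms)

instance prod :: (findim_real_vector, findim_real_vector) findim_real_vector
proof
  obtain B :: "'a set" where B: "finite B" "span B = UNIV" using findim_span_UNIV by blast
  obtain C :: "'b set" where C: "finite C" "span C = UNIV" using findim_span_UNIV by blast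
  let ?D = "(\<lambda>x. (x, 0)) ` B \<union> (\<lambda>y. (0, y)) ` C :: ('a \<times> 'b) set"
  have lin: "linear (\<lambda>x. (x, 0) :: 'a \<times> 'b)" "linear (\<lambda>y. (0, y) :: 'a \<times> 'b)"
    by (auto intro!: linearI)
  have "(x, y) \<in> span ?D" for x :: 'a and y :: 'b
  proof -
    have "(x, 0) \<in> span ((\<lambda>x. (x, 0) :: 'a \<times> 'b) ` B)"
      using B(2) by (simp add: linear_span_image[OF lin(1)])
    moreover have "(0, y) \<in> span ((\<lambda>y. (0, y) :: 'a \<times> 'b) ` C)"
      using C(2) by (simp add: linear_span_image[OF lin(2)])
    ultimately have "(x, 0) + (0, y) \<in> span ?D"
      by (meson span_add span_mono subsetD sup_ge1 sup_ge2)
    then show ?thesis by simp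
  qed
  then have "span ?D = UNIV" by auto
  with B(1) C(1) show "\<exists>B::('a \<times> 'b) set. finite B \<and> (\<forall>x. \<exists>c. x = (\<Sum>b\<in>B. c b *\<^sub>R b))"
    by (intro findimI_span[of ?D]) auto
qed

text \<open>The dual space of a vector space type.\<close>

typedef (overloaded) 'l dual = "{f :: 'l::real_vector \<Rightarrow> real. linear f}"
  morphisms dual_apply Dual
  by (rule exI[of _ "\<lambda>_. 0"]) (auto intro: linearI)

setup_lifting type_definition_dual

instantiation dual :: (real_vector) real_vector
begin

lift_definition zero_dual :: "'a dual" is "\<lambda>_. 0" by (auto intro: linearI)
lift_definition plus_dual :: "'a dual \<Rightarrow> 'a dual \<Rightarrow> 'a dual" is "\<lambda>f g x. f x + g x"
  by (rule linear_compose_add)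
lift_definition minus_dual :: "'a dual \<Rightarrow> 'a dual \<Rightarrow> 'a dual" is "\<lambda>f g x. f x - g x"
  by (rule linear_compose_sub)
lift_definition uminus_dual :: "'a dual \<Rightarrow> 'a dual" is "\<lambda>f x. - f x"
  by (rule linear_compose_neg)
lift_definition scaleR_dual :: "real \<Rightarrow> 'a dual \<Rightarrow> 'a dual" is "\<lambda>c f x. c *\<^sub>R f x"
  by (rule linear_compose_scale_right)

instance
  by standard (transfer; simp add: algebra_simps)+

end

lemma linear_dual_apply: "linear (dual_apply Z)"
  using dual_apply by blast

lemma dual_apply_Dual: "linear f \<Longrightarrow> dual_apply (Dual f) = f"
  by (simp add: Dual_inverse)

lemma dual_eqI: "(\<And>x. dual_apply Z x = dual_apply W x) \<Longrightarrow> Z = W"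
  by (metis dual_apply_inject ext)

lemma dual_apply_sum: "dual_apply (\<Sum>i\<in>I. F i) x = (\<Sum>i\<in>I. dual_apply (F i) x)"
  by (induction I rule: infinite_finite_induct)
     (simp_all add: zero_dual.rep_eq plus_dual.rep_eq)

instance dual :: (findim_real_vector) findim_real_vector
proof
  obtain B0 :: "'a set" where B0: "finite B0" "span B0 = UNIV" using findim_span_UNIV by blast
  obtain B where B: "B \<subseteq> B0" "independent B" "B0 \<subseteq> span B"
    using maximal_independent_subset by blast
  have spanB: "span B = UNIV"
    using span_minimal[OF B(3) subspace_span] B0(2) by auto
  have fin: "finite B" using B(1) B0(1) finite_subset by blast
  define e where "e b = Dual (\<lambda>x. representation B x b)" for b
  have lin: "linear (\<lambda>x. representation B x b)" for b
    using B(2) spanB by (intro linearI) (simp_all add: representation_add representation_scale)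
  have "Z = (\<Sum>b\<in>B. dual_apply Z b *\<^sub>R e b)" for Z :: "'a dual"
  proof (rule dual_eqI)
    fix x
    have "x = (\<Sum>b\<in>B. representation B x b *\<^sub>R b)"
      using sum_representation_eq[OF B(2) _ fin order_refl, of x] spanB by simp
    then have "dual_apply Z x = dual_apply Z (\<Sum>b\<in>B. representation B x b *\<^sub>R b)" by simp
    also have "\<dots> = (\<Sum>b\<in>B. representation B x b * dual_apply Z b)"
      by (simp add: linear_sum[OF linear_dual_apply] linear_cmul[OF linear_dual_apply])
    also have "\<dots> = dual_apply (\<Sum>b\<in>B. dual_apply Z b *\<^sub>R e b) x"
      by (simp add: dual_apply_sum scaleR_dual.rep_eq e_def dual_apply_Dual[OF lin] mult.commute)
    finally show "dual_apply Z x = dual_apply (\<Sum>b\<in>B. dual_apply Z b *\<^sub>R e b) x" .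
  qed
  moreover have "(\<Sum>b\<in>B. dual_apply Z b *\<^sub>R e b) \<in> span (e ` B)" for Z
    by (intro span_sum span_scale span_base imageI)
  ultimately have "Z \<in> span (e ` B)" for Z
    by simp
  then show "\<exists>B::'a dual set. finite B \<and> (\<forall>x. \<exists>c. x = (\<Sum>b\<in>B. c b *\<^sub>R b))"
    using fin by (intro findimI_span[of "e ` B"]) auto
qed


section \<open>Scalar products, involutions, symmetric triples\<close>

definition nondegenerate_on :: "('v \<Rightarrow> 'v \<Rightarrow> real) \<Rightarrow> 'v::real_vector set \<Rightarrow> bool" where
  "nondegenerate_on f W \<longleftrightarrow> (\<forall>x\<in>W. (\<forall>y\<in>W. f x y = 0) \<longrightarrow> x = 0)"

definition scalar_product :: "('v::real_vector \<Rightarrow> 'v \<Rightarrow> real) \<Rightarrow> bool" where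
  "scalar_product f \<longleftrightarrow> bilinear f \<and> (\<forall>x y. f x y = f y x) \<and> nondegenerate_on f UNIV"

definition plus_space :: "('v \<Rightarrow> 'v) \<Rightarrow> 'v::real_vector set" where
  "plus_space t = {x. t x = x}"

definition minus_space :: "('v \<Rightarrow> 'v) \<Rightarrow> 'v::real_vector set" where
  "minus_space t = {x. t x = - x}"

record 'l inv_lie =
  brac :: "'l \<Rightarrow> 'l \<Rightarrow> 'l"
  theta :: "'l \<Rightarrow> 'l"

definition lie_algebra_with_involution :: "('l::findim_real_vector, 'z) inv_lie_scheme \<Rightarrow> bool" where
  "lie_algebra_with_involution L \<longleftrightarrow>
     bilinear (brac L) \<and>
     (\<forall>X. brac L X X = 0) \<and>
     (\<forall>X Y Z. brac L X (brac L Y Z) + brac L Y (brac L Z X) + brac L Z (brac L X Y) = 0) \<and>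
     linear (theta L) \<and>
     (\<forall>X. theta L (theta L X) = X) \<and>
     (\<forall>X Y. theta L (brac L X Y) = brac L (theta L X) (theta L Y))"

text \<open>\<open>[\<l>\<^sub>-, \<l>\<^sub>-] = \<l>\<^sub>+\<close>, the left-hand side being the linear span of the brackets.\<close>

definition T1 :: "('l::findim_real_vector, 'z) inv_lie_scheme \<Rightarrow> bool" where
  "T1 L \<longleftrightarrow>
     span {brac L X Y | X Y. X \<in> minus_space (theta L) \<and> Y \<in> minus_space (theta L)}
       = plus_space (theta L)"

record 'g inv_metric_lie = "'g inv_lie" +
  form :: "'g \<Rightarrow> 'g \<Rightarrow> real"

definition symmetric_triple :: "'g::findim_real_vector inv_metric_lie \<Rightarrow> bool" where
  "symmetric_triple G \<longleftrightarrow>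
     lie_algebra_with_involution G \<and>
     scalar_product (form G) \<and>
     (\<forall>X Y Z. form G (brac G X Y) Z = - form G Y (brac G X Z)) \<and>
     (\<forall>X Y. form G (theta G X) (theta G Y) = form G X Y) \<and>
     T1 G"

definition symmetric_triple_isomorphic ::
  "'g::findim_real_vector inv_metric_lie \<Rightarrow> 'h::findim_real_vector inv_metric_lie \<Rightarrow> bool" where
  "symmetric_triple_isomorphic G H \<longleftrightarrow>
     symmetric_triple G \<and> symmetric_triple H \<and>
     (\<exists>F. linear F \<and> bij F \<and>
        (\<forall>X Y. F (brac G X Y) = brac H (F X) (F Y)) \<and>
        (\<forall>X Y. form H (F X) (F Y) = form G X Y) \<and>
        (\<forall>X. F (theta G X) = theta H (F X)))"


section \<open>Modules\<close>

text \<open>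
  For an action \<open>act\<close> of \<open>'l\<close> on \<open>'v\<close> (a representation, or the adjoint action \<^term>\<open>brac L\<close>, whose
  submodules are the ideals). The submodules of a quotient \<open>V/W\<close> are the \<open>U/W\<close> with \<open>U\<close> a submodule
  between \<open>W\<close> and \<open>V\<close>; in these terms \<open>semisimple_quotient act V W\<close> says that every submodule of
  \<open>V/W\<close> has a complementary submodule.
\<close>

definition submodule :: "('l \<Rightarrow> 'v \<Rightarrow> 'v) \<Rightarrow> 'v::real_vector set \<Rightarrow> bool" where
  "submodule act W \<longleftrightarrow> subspace W \<and> (\<forall>X. \<forall>w\<in>W. act X w \<in> W)"

definition semisimple_quotient ::
  "('l \<Rightarrow> 'v \<Rightarrow> 'v) \<Rightarrow> 'v::real_vector set \<Rightarrow> 'v set \<Rightarrow> bool" where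
  "semisimple_quotient act V W \<longleftrightarrow>
     (\<forall>U. submodule act U \<and> W \<subseteq> U \<and> U \<subseteq> V \<longrightarrow>
        (\<exists>U'. submodule act U' \<and> W \<subseteq> U' \<and> U' \<subseteq> V \<and>
              U \<inter> U' = W \<and> {x + y | x y. x \<in> U \<and> y \<in> U'} = V))"

definition semisimple :: "('l \<Rightarrow> 'v \<Rightarrow> 'v) \<Rightarrow> 'v::real_vector set \<Rightarrow> bool" where
  "semisimple act V \<longleftrightarrow> semisimple_quotient act V {0}"

record ('l, 'a) orth_mod =
  rho :: "'l \<Rightarrow> 'a \<Rightarrow> 'a"
  pairing :: "'a \<Rightarrow> 'a \<Rightarrow> real"
  mtheta :: "'a \<Rightarrow> 'a"

definition orthogonal_module ::
  "'l::findim_real_vector inv_lie \<Rightarrow> ('l, 'a::findim_real_vector) orth_mod \<Rightarrow> bool" where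
  "orthogonal_module L M \<longleftrightarrow>
     bilinear (rho M) \<and>
     (\<forall>X Y A. rho M (brac L X Y) A = rho M X (rho M Y A) - rho M Y (rho M X A)) \<and>
     scalar_product (pairing M) \<and>
     (\<forall>X A B. pairing M (rho M X A) B = - pairing M A (rho M X B)) \<and>
     linear (mtheta M) \<and>
     (\<forall>A. mtheta M (mtheta M A) = A) \<and>
     (\<forall>A B. pairing M (mtheta M A) (mtheta M B) = pairing M A B) \<and>
     (\<forall>X A. mtheta M (rho M (theta L X) A) = rho M X (mtheta M A))"


section \<open>Cochains and quadratic cohomology\<close>

text \<open>
  A cochain is a curried alternating multilinear map. Only degrees at most 4 occur, and the
  Chevalley--Eilenberg differential
  \<open>d\<alpha>(L\<^sub>0,\<dots>,L\<^sub>p) = \<Sum>\<^sub>i (-1)^i \<rho>(L\<^sub>i) \<alpha>(\<dots>,L\<^sub>i omitted,\<dots>)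
     + \<Sum>\<^sub>i\<^sub><\<^sub>j (-1)^(i+j) \<alpha>([L\<^sub>i,L\<^sub>j],\<dots>,L\<^sub>i,L\<^sub>j omitted,\<dots>)\<close>
  and the shuffle wedge products are written out in each degree. Real coefficients
  correspond to the trivial action \<^term>\<open>\<lambda>_ _. 0\<close>.
\<close>

definition cochain1 :: "('l::real_vector \<Rightarrow> 'v::real_vector) set" where
  "cochain1 = {f. linear f}"

definition cochain2 :: "('l::real_vector \<Rightarrow> 'l \<Rightarrow> 'v::real_vector) set" where
  "cochain2 = {f. bilinear f \<and> (\<forall>X. f X X = 0)}"

definition cochain3 :: "('l::real_vector \<Rightarrow> 'l \<Rightarrow> 'l \<Rightarrow> 'v::real_vector) set" where
  "cochain3 = {f. (\<forall>X Y. linear (\<lambda>Z. f X Y Z)) \<and> (\<forall>X Z. linear (\<lambda>Y. f X Y Z)) \<and>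
                  (\<forall>Y Z. linear (\<lambda>X. f X Y Z)) \<and>
                  (\<forall>X Y. f X X Y = 0 \<and> f X Y X = 0 \<and> f Y X X = 0)}"

definition d1 :: "('l \<Rightarrow> 'l \<Rightarrow> 'l) \<Rightarrow> ('l \<Rightarrow> 'v \<Rightarrow> 'v) \<Rightarrow> ('l \<Rightarrow> 'v::real_vector) \<Rightarrow> 'l \<Rightarrow> 'l \<Rightarrow> 'v" where
  "d1 br act f = (\<lambda>X Y. act X (f Y) - act Y (f X) - f (br X Y))"

definition d2 ::
  "('l \<Rightarrow> 'l \<Rightarrow> 'l) \<Rightarrow> ('l \<Rightarrow> 'v \<Rightarrow> 'v) \<Rightarrow> ('l \<Rightarrow> 'l \<Rightarrow> 'v::real_vector) \<Rightarrow> 'l \<Rightarrow> 'l \<Rightarrow> 'l \<Rightarrow> 'v" where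
  "d2 br act f = (\<lambda>X Y Z.
     act X (f Y Z) - act Y (f X Z) + act Z (f X Y)
     - f (br X Y) Z + f (br X Z) Y - f (br Y Z) X)"

definition d3 ::
  "('l \<Rightarrow> 'l \<Rightarrow> 'l) \<Rightarrow> ('l \<Rightarrow> 'v \<Rightarrow> 'v) \<Rightarrow> ('l \<Rightarrow> 'l \<Rightarrow> 'l \<Rightarrow> 'v::real_vector)
     \<Rightarrow> 'l \<Rightarrow> 'l \<Rightarrow> 'l \<Rightarrow> 'l \<Rightarrow> 'v" where
  "d3 br act f = (\<lambda>X Y Z W.
     act X (f Y Z W) - act Y (f X Z W) + act Z (f X Y W) - act W (f X Y Z)
     - f (br X Y) Z W + f (br X Z) Y W - f (br X W) Y Z
     - f (br Y Z) X W + f (br Y W) X Z - f (br Z W) X Y)"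

definition wedge21 ::
  "('a \<Rightarrow> 'a \<Rightarrow> real) \<Rightarrow> ('l \<Rightarrow> 'l \<Rightarrow> 'a) \<Rightarrow> ('l \<Rightarrow> 'a) \<Rightarrow> 'l \<Rightarrow> 'l \<Rightarrow> 'l \<Rightarrow> real" where
  "wedge21 p f t = (\<lambda>X Y Z. p (f X Y) (t Z) - p (f X Z) (t Y) + p (f Y Z) (t X))"

definition wedge22 ::
  "('a \<Rightarrow> 'a \<Rightarrow> real) \<Rightarrow> ('l \<Rightarrow> 'l \<Rightarrow> 'a) \<Rightarrow> ('l \<Rightarrow> 'l \<Rightarrow> 'a) \<Rightarrow> 'l \<Rightarrow> 'l \<Rightarrow> 'l \<Rightarrow> 'l \<Rightarrow> real" where
  "wedge22 p f g = (\<lambda>X Y Z W.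
     p (f X Y) (g Z W) - p (f X Z) (g Y W) + p (f X W) (g Y Z)
     + p (f Y Z) (g X W) - p (f Y W) (g X Z) + p (f Z W) (g X Y))"

text \<open>The \<open>\<Theta>\<close>-invariant cochains; \<open>\<theta>v\<close> is the involution of the coefficients
  (\<^term>\<open>mtheta M\<close>, or \<^term>\<open>id\<close> for real coefficients).\<close>

definition cochain1_plus :: "('l \<Rightarrow> 'l) \<Rightarrow> ('v \<Rightarrow> 'v) \<Rightarrow> ('l::real_vector \<Rightarrow> 'v::real_vector) set" where
  "cochain1_plus \<theta>l \<theta>v = {f \<in> cochain1. \<forall>X. \<theta>v (f (\<theta>l X)) = f X}"

definition cochain2_plus :: "('l \<Rightarrow> 'l) \<Rightarrow> ('v \<Rightarrow> 'v) \<Rightarrow> ('l::real_vector \<Rightarrow> 'l \<Rightarrow> 'v::real_vector) set" where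
  "cochain2_plus \<theta>l \<theta>v = {f \<in> cochain2. \<forall>X Y. \<theta>v (f (\<theta>l X) (\<theta>l Y)) = f X Y}"

definition cochain3_plus ::
  "('l \<Rightarrow> 'l) \<Rightarrow> ('v \<Rightarrow> 'v) \<Rightarrow> ('l::real_vector \<Rightarrow> 'l \<Rightarrow> 'l \<Rightarrow> 'v::real_vector) set" where
  "cochain3_plus \<theta>l \<theta>v = {f \<in> cochain3. \<forall>X Y Z. \<theta>v (f (\<theta>l X) (\<theta>l Y) (\<theta>l Z)) = f X Y Z}"

type_synonym ('l, 'a) quad_pair = "('l \<Rightarrow> 'l \<Rightarrow> 'a) \<times> ('l \<Rightarrow> 'l \<Rightarrow> 'l \<Rightarrow> real)"

definition ZQ2_plus ::
  "'l::findim_real_vector inv_lie \<Rightarrow> ('l, 'a::findim_real_vector) orth_mod \<Rightarrow> ('l, 'a) quad_pair set" where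
  "ZQ2_plus L M = {(\<alpha>, \<gamma>).
     \<alpha> \<in> cochain2_plus (theta L) (mtheta M) \<and> \<gamma> \<in> cochain3_plus (theta L) id \<and>
     d2 (brac L) (rho M) \<alpha> = (\<lambda>X Y Z. 0) \<and>
     d3 (brac L) (\<lambda>_ _. 0) \<gamma> = (\<lambda>X Y Z W. 1/2 * wedge22 (pairing M) \<alpha> \<alpha> X Y Z W)}"

definition quad_act ::
  "'l::findim_real_vector inv_lie \<Rightarrow> ('l, 'a::findim_real_vector) orth_mod \<Rightarrow>
   ('l, 'a) quad_pair \<Rightarrow> ('l \<Rightarrow> 'a) \<Rightarrow> ('l \<Rightarrow> 'l \<Rightarrow> real) \<Rightarrow> ('l, 'a) quad_pair" where
  "quad_act L M c \<tau> \<sigma> = (case c of (\<alpha>, \<gamma>) \<Rightarrow>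
     ((\<lambda>X Y. \<alpha> X Y + d1 (brac L) (rho M) \<tau> X Y),
      (\<lambda>X Y Z. \<gamma> X Y Z + d2 (brac L) (\<lambda>_ _. 0) \<sigma> X Y Z
         + wedge21 (pairing M) (\<lambda>V W. \<alpha> V W + (1/2) *\<^sub>R d1 (brac L) (rho M) \<tau> V W) \<tau> X Y Z)))"

text \<open>The class \<open>[\<alpha>,\<gamma>]\<close>, as an orbit.\<close>

definition quad_class ::
  "'l::findim_real_vector inv_lie \<Rightarrow> ('l, 'a::findim_real_vector) orth_mod \<Rightarrow>
   ('l, 'a) quad_pair \<Rightarrow> ('l, 'a) quad_pair set" where
  "quad_class L M c = {quad_act L M c \<tau> \<sigma> | \<tau> \<sigma>.
     \<tau> \<in> cochain1_plus (theta L) (mtheta M) \<and> \<sigma> \<in> cochain2_plus (theta L) id}"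


section \<open>Admissibility\<close>

definition invariants :: "('l, 'a::real_vector) orth_mod \<Rightarrow> 'a set" where
  "invariants M = {A. \<forall>X. rho M X A = 0}"

definition action_image :: "('l, 'a::real_vector) orth_mod \<Rightarrow> 'a set" where
  "action_image M = span {rho M X A | X A. True}"

text \<open>\<open>\<alpha>\<^sub>0\<close>: the component of \<open>\<alpha>\<close> in \<open>\<a>\<^sup>\<l>\<close> with respect to \<open>\<a> = \<a>\<^sup>\<l> \<oplus> \<rho>(\<l>)\<a>\<close>
  (a direct sum decomposition for semi-simple modules).\<close>

definition inv_component :: "('l, 'a::real_vector) orth_mod \<Rightarrow> ('l \<Rightarrow> 'l \<Rightarrow> 'a) \<Rightarrow> 'l \<Rightarrow> 'l \<Rightarrow> 'a" where
  "inv_component M \<alpha> X Y = (THE A. A \<in> invariants M \<and> \<alpha> X Y - A \<in> action_image M)"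

text \<open>
  \<open>image_of_kernel V b f\<close> is \<open>f(ker b)\<close> for \<open>b\<close>, \<open>f\<close> viewed as linear maps on \<open>\<Lambda>\<^sup>2V\<close>. An element
  of \<open>\<Lambda>\<^sup>2V\<close> is a finite sum \<open>\<Sum>\<^sub>i X\<^sub>i \<and> Y\<^sub>i\<close>, represented by the list of the pairs \<open>(X\<^sub>i, Y\<^sub>i)\<close>; it
  is mapped to \<open>\<Sum>\<^sub>i b X\<^sub>i Y\<^sub>i\<close> and \<open>\<Sum>\<^sub>i f X\<^sub>i Y\<^sub>i\<close>, respectively.
\<close>

definition image_of_kernel ::
  "'l set \<Rightarrow> ('l \<Rightarrow> 'l \<Rightarrow> 'l::real_vector) \<Rightarrow> ('l \<Rightarrow> 'l \<Rightarrow> 'a::real_vector) \<Rightarrow> 'a set" where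
  "image_of_kernel V b f =
     {(\<Sum>(X, Y)\<leftarrow>ps. f X Y) | ps. set ps \<subseteq> V \<times> V \<and> (\<Sum>(X, Y)\<leftarrow>ps. b X Y) = 0}"

definition center :: "('l::real_vector, 'z) inv_lie_scheme \<Rightarrow> 'l set" where
  "center L = {X. \<forall>Y. brac L X Y = 0}"

definition S1 :: "('l::real_vector, 'z) inv_lie_scheme \<Rightarrow> 'l set" where
  "S1 L = (GREATEST I. submodule (brac L) I \<and> semisimple (brac L) I)"

primrec R :: "('l::real_vector, 'z) inv_lie_scheme \<Rightarrow> nat \<Rightarrow> 'l set" where
  "R L 0 = UNIV"
| "R L (Suc k) =
     (LEAST I. submodule (brac L) I \<and> I \<subseteq> R L k \<and> semisimple_quotient (brac L) (R L k) I)"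

definition cond_T2 ::
  "'l::findim_real_vector inv_lie \<Rightarrow> ('l, 'a::findim_real_vector) orth_mod \<Rightarrow> ('l, 'a) quad_pair \<Rightarrow> bool" where
  "cond_T2 L M = (\<lambda>(\<alpha>, \<gamma>).
     invariants M \<inter> plus_space (mtheta M)
       = image_of_kernel (minus_space (theta L)) (brac L) (inv_component M \<alpha>))"

definition cond_A0 ::
  "'l::findim_real_vector inv_lie \<Rightarrow> ('l, 'a::findim_real_vector) orth_mod \<Rightarrow> ('l, 'a) quad_pair \<Rightarrow> bool" where
  "cond_A0 L M = (\<lambda>(\<alpha>, \<gamma>).
     \<forall>L0. L0 \<in> center L \<and> (\<forall>A. rho M L0 A = 0) \<and>
       (\<exists>A0 (Z0 :: 'l dual).
          (\<forall>X. \<alpha> X L0 = rho M X A0) \<and>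
          (\<forall>X Y. \<gamma> X L0 Y = - pairing M A0 (\<alpha> X Y) + dual_apply Z0 (brac L X Y)))
       \<longrightarrow> L0 = 0)"

definition cond_B0 ::
  "'l::findim_real_vector inv_lie \<Rightarrow> ('l, 'a::findim_real_vector) orth_mod \<Rightarrow> ('l, 'a) quad_pair \<Rightarrow> bool" where
  "cond_B0 L M = (\<lambda>(\<alpha>, \<gamma>).
     nondegenerate_on (pairing M) (image_of_kernel UNIV (brac L) (inv_component M \<alpha>)))"

text \<open>
  In the conditions \<open>(A\<^sub>k)\<close> and \<open>(B\<^sub>k)\<close>, elements of \<open>Hom(\<k>, \<a>)\<close>, \<open>Hom(R\<^sub>k, \<a>)\<close> and
  \<open>Hom(\<k>, R\<^sub>k\<^sup>*)\<close> are given by linear extensions to all of \<open>\<l>\<close> (respectively, by a bilinear map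
  on \<open>\<l> \<times> \<l>\<close>), which always exist; they are only evaluated on \<open>\<k>\<close>, \<open>R\<^sub>k\<close> and \<open>\<k> \<times> R\<^sub>k\<close>.
\<close>

definition cond_A ::
  "nat \<Rightarrow> 'l::findim_real_vector inv_lie \<Rightarrow> ('l, 'a::findim_real_vector) orth_mod \<Rightarrow> ('l, 'a) quad_pair \<Rightarrow> bool" where
  "cond_A k L M = (\<lambda>(\<alpha>, \<gamma>).
     \<forall>K. submodule (brac L) K \<and> K \<subseteq> S1 L \<inter> R L k \<and>
       (\<exists>\<Phi>1 \<Phi>2. linear \<Phi>1 \<and> bilinear \<Phi>2 \<and>
          (\<forall>X. \<forall>Y\<in>K. \<alpha> X Y = rho M X (\<Phi>1 Y) - \<Phi>1 (brac L X Y)) \<and>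
          (\<forall>X. \<forall>Y\<in>K. \<forall>W\<in>R L k.
             \<gamma> X Y W = - pairing M (\<Phi>1 Y) (\<alpha> X W) + \<Phi>2 Y (brac L X W) + \<Phi>2 (brac L X Y) W))
       \<longrightarrow> K = {0})"

definition cond_B ::
  "nat \<Rightarrow> 'l::findim_real_vector inv_lie \<Rightarrow> ('l, 'a::findim_real_vector) orth_mod \<Rightarrow> ('l, 'a) quad_pair \<Rightarrow> bool" where
  "cond_B k L M = (\<lambda>(\<alpha>, \<gamma>).
     nondegenerate_on (pairing M)
       (GREATEST b. submodule (rho M) b \<and>
          (\<exists>\<Phi>. linear \<Phi> \<and>
             (\<forall>X. \<forall>Y\<in>R L k. \<forall>B\<in>b.
                pairing M (\<alpha> X Y) B = pairing M (rho M X (\<Phi> Y) - \<Phi> (brac L X Y)) B))))"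

definition admissible_cocycle ::
  "'l::findim_real_vector inv_lie \<Rightarrow> ('l, 'a::findim_real_vector) orth_mod \<Rightarrow> ('l, 'a) quad_pair \<Rightarrow> bool" where
  "admissible_cocycle L M c \<longleftrightarrow>
     cond_T2 L M c \<and> cond_A0 L M c \<and> cond_B0 L M c \<and>
     (\<exists>m. R L (Suc m) = {0} \<and> (\<forall>k\<in>{1..m}. cond_A k L M c \<and> cond_B k L M c))"

definition HQ2_sharp ::
  "'l::findim_real_vector inv_lie \<Rightarrow> ('l, 'a::findim_real_vector) orth_mod \<Rightarrow> ('l, 'a) quad_pair set set" where
  "HQ2_sharp L M = {quad_class L M c | c. c \<in> ZQ2_plus L M \<and> admissible_cocycle L M c}"

text \<open>
  Admissibility asks for some semi-simple orthogonal module with non-empty \<open>HQ2_sharp\<close>. The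
  vector space underlying that module is a type, over which a definition cannot quantify; so it is
  a type argument. A hypothesis \<open>admissible TYPE('b) L\<close> of a theorem with \<open>'b\<close> a type
  variable not occurring elsewhere in the theorem says that there is such a module on some
  finite-dimensional vector space, because the theorem is universally quantified over \<open>'b\<close>.
\<close>

definition admissible :: "'b::findim_real_vector itself \<Rightarrow> 'l::findim_real_vector inv_lie \<Rightarrow> bool" where
  "admissible _ L \<longleftrightarrow> T1 L \<and>
     (\<exists>M :: ('l, 'b) orth_mod. orthogonal_module L M \<and> semisimple (rho M) UNIV \<and> HQ2_sharp L M \<noteq> {})"


section \<open>The standard model\<close>

definition standard_model ::
  "'l::findim_real_vector inv_lie \<Rightarrow> ('l, 'a::findim_real_vector) orth_mod \<Rightarrow> ('l, 'a) quad_pair \<Rightarrow>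
   ('l dual \<times> 'a \<times> 'l) inv_metric_lie" where
  "standard_model L M = (\<lambda>(\<alpha>, \<gamma>).
     \<lparr> brac = (\<lambda>(Z1, A1, L1) (Z2, A2, L2).
         (Dual (\<lambda>X. \<gamma> L1 L2 X
                  - pairing M A2 (\<alpha> L1 X) + pairing M A1 (\<alpha> L2 X)
                  - dual_apply Z2 (brac L L1 X) + dual_apply Z1 (brac L L2 X)
                  + pairing M (rho M X A1) A2),
          \<alpha> L1 L2 + rho M L1 A2 - rho M L2 A1,
          brac L L1 L2)),
       theta = (\<lambda>(Z, A, X). (Dual (\<lambda>Y. dual_apply Z (theta L Y)), mtheta M A, theta L X)),
       form = (\<lambda>(Z1, A1, L1) (Z2, A2, L2).
         pairing M A1 A2 + dual_apply Z1 L2 + dual_apply Z2 L1) \<rparr>)"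


section \<open>Morphisms of triples\<close>

text \<open>Note that \<open>U\<close> goes in the direction opposite to \<open>S\<close>.\<close>

definition triple_morphism ::
  "'l1::findim_real_vector inv_lie \<Rightarrow> ('l1, 'a1::findim_real_vector) orth_mod \<Rightarrow>
   'l2::findim_real_vector inv_lie \<Rightarrow> ('l2, 'a2::findim_real_vector) orth_mod \<Rightarrow>
   ('l1 \<Rightarrow> 'l2) \<Rightarrow> ('a2 \<Rightarrow> 'a1) \<Rightarrow> bool" where
  "triple_morphism L1 M1 L2 M2 S U \<longleftrightarrow>
     linear S \<and>
     (\<forall>X Y. S (brac L1 X Y) = brac L2 (S X) (S Y)) \<and>
     (\<forall>X. S (theta L1 X) = theta L2 (S X)) \<and>
     linear U \<and> inj U \<and>
     (\<forall>A B. pairing M1 (U A) (U B) = pairing M2 A B) \<and>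
     (\<forall>A. U (mtheta M2 A) = mtheta M1 (U A)) \<and>
     (\<forall>X A. U (rho M2 (S X) A) = rho M1 X (U A))"

definition triple_isomorphism ::
  "'l1::findim_real_vector inv_lie \<Rightarrow> ('l1, 'a1::findim_real_vector) orth_mod \<Rightarrow>
   'l2::findim_real_vector inv_lie \<Rightarrow> ('l2, 'a2::findim_real_vector) orth_mod \<Rightarrow>
   ('l1 \<Rightarrow> 'l2) \<Rightarrow> ('a2 \<Rightarrow> 'a1) \<Rightarrow> bool" where
  "triple_isomorphism L1 M1 L2 M2 S U \<longleftrightarrow>
     triple_morphism L1 M1 L2 M2 S U \<and> bij S \<and> bij U"

text \<open>\<open>(U \<circ> S\<^sup>*\<alpha>, S\<^sup>*\<gamma>)\<close>, the representative of \<open>(S, U)\<^sup>*[\<alpha>, \<gamma>]\<close>.\<close>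

definition quad_pullback ::
  "('l1 \<Rightarrow> 'l2) \<Rightarrow> ('a2 \<Rightarrow> 'a1) \<Rightarrow> ('l2, 'a2) quad_pair \<Rightarrow> ('l1, 'a1) quad_pair" where
  "quad_pullback S U = (\<lambda>(\<alpha>, \<gamma>).
     ((\<lambda>X Y. U (\<alpha> (S X) (S Y))), (\<lambda>X Y Z. \<gamma> (S X) (S Y) (S Z))))"

end

theory Submission
  imports "Jordan_Normal_Form.Jordan_Normal_Form_Existence" Defs
begin

hide_const (open) VectorSpace.subspace
hide_fact (open) VectorSpace.subspace_def
unbundle no m_inv_syntax

text \<open>
  Write \<open>L\<close> for the Lie algebra, \<open>M\<close> for the module, and \<open>D = L* \<oplus> M \<oplus> L\<close> for the standard model.

  One direction is formal. An isomorphism of triples pulls a cocycle back and induces an isomorphism of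
  standard models (\<open>triple_map_iso\<close>), and equivalent cocycles have isomorphic
  standard models (\<open>quad_class_member\<close>), the isomorphism being an explicit unipotent isometry, a
  shear.

  For the converse, an isomorphism \<open>F\<close> has to be compatible with the filtration
  \<open>L* \<subseteq> L* \<oplus> M \<subseteq> D\<close>. The reason is that admissibility allows the ideal \<open>L* \<oplus> M\<close> to be
  recovered from the metric Lie algebra \<open>D\<close> alone: with the radical series
  \<open>D = R 0 \<supseteq> R 1 \<supseteq> \<dots>\<close> of the adjoint module, it is the canonical ideal
  \<open>\<Inter>k. R k + (R k)\<^sup>\<bottom>\<close> (\<open>canonical_coisotropic_lower\<close>), and \<open>L*\<close> is its orthogonal complement. Once
  \<open>F\<close> preserves the filtration, it induces maps on the graded pieces \<open>L\<close> and \<open>M\<close>, which form an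
  isomorphism of triples. Up to the map induced by that isomorphism, \<open>F\<close> is the identity on the graded pieces,
  hence a shear, and shears are the same thing as equivalences of cocycles
  (\<open>filtered_iso_is_shear\<close>, \<open>filtered_isomorphism_descends\<close>).

  The conditions defining admissibility enter one at a time in the computation of the canonical ideal. The orthogonal
  complements of the \<open>R k\<close> form the socle series of \<open>D\<close>. A part of the socle series that is
  not contained in \<open>L* \<oplus> M\<close> can be split off by semi-simplicity, and the splitting yields exactly the
  cochains that \<open>cond_A0\<close> and \<open>cond_A\<close> forbid (\<open>SD_1_lower\<close>, \<open>SD_step\<close>). The subspaces of \<open>M\<close> that
  must be nondegenerate in \<open>cond_B0\<close> and \<open>cond_B\<close> are essentially the images in \<open>M\<close> of the socle
  series (\<open>bk_0\<close>, \<open>bk_lift\<close>, \<open>bk_greatest\<close>). The identification in positive degree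
  rests on a fact from the structure theory of Lie algebras: a semi-simple representation is trivial on
  the first radical \<open>R 1\<close> of the adjoint module (\<open>semisimple_trivial_on_radical\<close>). It is proved with
  the trace form, Cartan's criterion (\<open>cartan_nilpotent\<close>, by Jordan normal form) and Engel's
  theorem.

  Finally, isomorphism of symmetric triples includes that both standard models are symmetric triples.
  This follows from \<open>T1\<close>, \<open>cond_A0\<close> and \<open>cond_T2\<close> (\<open>standard_model_symmetric_triple\<close>).
\<close>

section \<open>Linear algebra on finite-dimensional real vector spaces\<close>

definition findim_basis :: "'v::findim_real_vector set" where
  "findim_basis = (SOME B. finite B \<and> independent B \<and> span B = UNIV)"

lemma findim_basis: "finite (findim_basis :: 'v::findim_real_vector set)"
    "independent (findim_basis :: 'v set)" "span (findim_basis :: 'v set) = UNIV"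
proof -
  obtain B0 :: "'v set" where B0: "finite B0" "span B0 = UNIV"
    using findim_span_UNIV by blast
  obtain B where B: "B \<subseteq> B0" "independent B" "B0 \<subseteq> span B"
    using maximal_independent_subset by blast
  have "span B = UNIV"
    using span_minimal[OF B(3) subspace_span] B0(2) by auto
  then have "finite B \<and> independent B \<and> span B = (UNIV :: 'v set)"
    using B(2) finite_subset[OF B(1) B0(1)] by simp
  then have "finite (findim_basis :: 'v set) \<and> independent (findim_basis :: 'v set) \<and>
      span (findim_basis :: 'v set) = UNIV"
    unfolding findim_basis_def by (rule someI)
  then show "finite (findim_basis :: 'v set)" "independent (findim_basis :: 'v set)"
    "span (findim_basis :: 'v set) = UNIV" by simp_all
qed

text \<open>Every finite-dimensional real space gets its chosen basis as the fixed basis of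
  the library locale, so that the dimension theory of that locale becomes available.\<close>

interpretation findim: finite_dimensional_vector_space
    "scaleR :: real \<Rightarrow> 'v \<Rightarrow> 'v::findim_real_vector" findim_basis
  rewrites "Modules.module.dependent (*\<^sub>R) = dependent"
    and "Modules.module.representation (*\<^sub>R) = representation"
    and "Modules.module.subspace (*\<^sub>R) = subspace"
    and "Modules.module.span (*\<^sub>R) = span"
    and "vector_space.extend_basis (*\<^sub>R) = extend_basis"
    and "vector_space.dim (*\<^sub>R) = dim"
    and "Vector_Spaces.linear (*\<^sub>R) (*\<^sub>R) = linear"
    and "Vector_Spaces.linear (*) (*\<^sub>R) = linear"
proof -
  show "finite_dimensional_vector_space ((*\<^sub>R) :: real \<Rightarrow> 'v \<Rightarrow> 'v) findim_basis"
    using findim_basis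
    by unfold_locales (auto simp: dependent_raw_def span_raw_def)
qed (auto simp add: dependent_raw_def representation_raw_def
      subspace_raw_def span_raw_def extend_basis_raw_def dim_raw_def linear_def
      real_scaleR_def[abs_def])

text \<open>Extend a basis of \<open>W\<close> by \<open>x\<close> and let the functional be the dual vector of \<open>x\<close>.\<close>

lemma separating_functional:
  fixes W :: "'v::real_vector set"
  assumes "subspace W" "x \<notin> W"
  shows "\<exists>f. linear (f :: 'v \<Rightarrow> real) \<and> f x = 1 \<and> (\<forall>w\<in>W. f w = 0)"
proof -
  obtain B where B: "B \<subseteq> W" "independent B" "W \<subseteq> span B"
    using maximal_independent_subset by blast
  have spB: "span B = W" using B assms(1) by (simp add: span_subspace)
  have "independent (insert x B)"
    using B(2) spB assms(2) by (simp add: independent_insertI)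
  then obtain f where f: "linear f" "\<forall>y\<in>insert x B. f y = (if y = x then 1 else (0::real))"
    using linear_independent_extend[of "insert x B" "\<lambda>y. if y = x then 1 else (0::real)"] by blast
  have "f w = 0" if "w \<in> W" for w
  proof -
    have "\<forall>b\<in>B. f b = 0" using f(2) B(1) assms(2) by auto
    moreover have "w \<in> span B" using that spB by simp
    ultimately show ?thesis using linear_eq_0_on_span[OF f(1)] by blast
  qed
  then show ?thesis using f by auto
qed

lemma linear_projection:
  fixes U :: "'v::real_vector set"
  assumes "subspace U"
  obtains s where "linear s" "\<And>y. y \<in> U \<Longrightarrow> s y = y" "range s \<subseteq> U"
proof -
  obtain B where B: "B \<subseteq> U" "independent B" "U \<subseteq> span B"
    using maximal_independent_subset by blast
  obtain g where g: "\<forall>x\<in>B. g x = x" "linear g" "range g \<subseteq> span B"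
    using linear_independent_extend_subspace[OF B(2), of "\<lambda>x. x"] by auto
  have "g y = y" if "y \<in> U" for y
    using linear_eq_on_span[OF g(2) linear_id, of B y] g(1) B(3) that by (auto simp: id_def)
  moreover have "range g \<subseteq> U" using g(3) span_minimal[OF B(1) assms] by (rule order_trans)
  ultimately show ?thesis by (rule that[OF g(2)])
qed

text \<open>On a subspace where \<open>B\<close> is nondegenerate, \<open>y \<mapsto> B y\<close> is injective into the dual space, hence
  surjective by dimension. Instead of the dual space the proof uses the coefficient vectors of
  functionals with respect to a basis of \<open>W\<close>, so that the map becomes an endomorphism.\<close>

lemma form_represents_on:
  fixes B :: "'v::findim_real_vector \<Rightarrow> 'v \<Rightarrow> real"
  assumes bil: "bilinear B" and W: "subspace W" "nondegenerate_on B W" and f: "linear f"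
  shows "\<exists>y\<in>W. \<forall>x\<in>W. B y x = f x"
proof -
  obtain E where E: "E \<subseteq> W" "independent E" "W \<subseteq> span E"
    using maximal_independent_subset by blast
  have finE: "finite E" by (rule findim.finiteI_independent[OF E(2)])
  obtain p where p: "linear p" "\<And>y. y \<in> W \<Longrightarrow> p y = y" "range p \<subseteq> W"
    using linear_projection[OF W(1)] by metis
  have pW: "p x \<in> W" for x using p(3) by blast
  define T where "T y = (\<Sum>b\<in>E. B y b *\<^sub>R b)" for y
  have T_add: "T (x + y) = T x + T y" and T_scale: "T (c *\<^sub>R x) = c *\<^sub>R T x" for x y c
    by (simp_all add: T_def bilinear_ladd[OF bil] bilinear_lmul[OF bil] scaleR_left.add sum.distrib
        scaleR_sum_right)
  have TW: "T y \<in> W" for y unfolding T_def using E(1) W(1)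
    by (intro subspace_sum subspace_scale) auto
  have lB: "linear (B y)" for y using bil by (simp add: bilinear_def)
  have coef: "u b = v b" if "(\<Sum>b\<in>E. u b *\<^sub>R b) = (\<Sum>b\<in>E. v b *\<^sub>R b)" "b \<in> E" for u v and b :: 'v
  proof -
    have "(\<Sum>b\<in>E. (u b - v b) *\<^sub>R b) = 0" using that(1)
      by (simp add: scaleR_left_diff_distrib sum_subtractf)
    then have "u b - v b = 0"
      using independentD[OF E(2) finE order_refl, of "\<lambda>b. u b - v b"] that(2) by simp
    then show ?thesis by simp
  qed
  have eq: "g x = h x" if "linear g" "linear h" "\<And>b. b \<in> E \<Longrightarrow> g b = h b" "x \<in> W" for g h :: "'v \<Rightarrow> real" and x
    by (rule linear_eq_on_span[OF that(1,2), of E]) (use that(3,4) E(3) in auto)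
  have T0: "y = 0" if y: "y \<in> W" "T y = 0" for y
  proof -
    have "B y b = 0" if "b \<in> E" for b
      using coef[of "B y" "\<lambda>_. 0" b] that y(2) by (simp add: T_def)
    then have "B y x = 0" if "x \<in> W" for x
      using eq[OF lB linear_zero _ that] by simp
    then show ?thesis using W(2) y(1) by (auto simp: nondegenerate_on_def)
  qed
  \<comment> \<open>The endomorphism \<open>T\<close> of \<open>W\<close>, extended by the identity along the projection \<open>p\<close>.\<close>
  define T' where "T' x = T (p x) + (x - p x)" for x
  have linT': "linear T'"
    unfolding T'_def by (rule linearI)
      (simp_all add: linear_add[OF p(1)] linear_cmul[OF p(1)] T_add T_scale algebra_simps)
  have pT': "p (T' x) = T (p x)" for x
    by (simp add: T'_def linear_add[OF p(1)] linear_diff[OF p(1)] p(2)[OF TW] p(2)[OF pW])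
  have "inj T'"
  proof -
    have "x = 0" if "T' x = 0" for x
    proof -
      have Tp: "T (p x) = 0" using pT'[of x] that linear_0[OF p(1)] by simp
      then have "p x = 0" by (rule T0[OF pW])
      then show ?thesis using that Tp unfolding T'_def by simp
    qed
    then show ?thesis using linear_injective_0[OF linT'] by blast
  qed
  then have "surj T'" using findim.linear_inj_imp_surj[OF linT'] by blast
  then obtain x where x: "T' x = (\<Sum>b\<in>E. f b *\<^sub>R b)" by (metis surjE)
  have "(\<Sum>b\<in>E. f b *\<^sub>R b) \<in> W" using E(1) W(1) by (intro subspace_sum subspace_scale) auto
  then have "T (p x) = (\<Sum>b\<in>E. f b *\<^sub>R b)" using pT'[of x] p(2) x by simp
  then have "B (p x) b = f b" if "b \<in> E" for b
    using coef[of "B (p x)" f b] that unfolding T_def by blast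
  then have "B (p x) z = f z" if "z \<in> W" for z using eq[OF lB f _ that] by blast
  then show ?thesis using pW by blast
qed

lemma form_represents:
  fixes B :: "'v::findim_real_vector \<Rightarrow> 'v \<Rightarrow> real"
  assumes "bilinear B" "nondegenerate_on B UNIV" "linear f"
  shows "\<exists>y. \<forall>x. B y x = f x"
  using form_represents_on[OF assms(1) subspace_UNIV assms(2,3)] by blast

definition perp :: "('v \<Rightarrow> 'v \<Rightarrow> real) \<Rightarrow> 'v::real_vector set \<Rightarrow> 'v set" where
  "perp B W = {x. \<forall>w\<in>W. B w x = 0}"

definition ssum :: "'v::real_vector set \<Rightarrow> 'v set \<Rightarrow> 'v set" where
  "ssum A B = {x + y | x y. x \<in> A \<and> y \<in> B}"

lemma ssumI: "x \<in> A \<Longrightarrow> y \<in> B \<Longrightarrow> x + y \<in> ssum A B"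
  by (auto simp: ssum_def)

lemma ssumE:
  assumes "z \<in> ssum A B"
  obtains x y where "z = x + y" "x \<in> A" "y \<in> B"
  using assms by (auto simp: ssum_def)

lemma ssum_mono: "A \<subseteq> A' \<Longrightarrow> B \<subseteq> B' \<Longrightarrow> ssum A B \<subseteq> ssum A' B'"
  by (auto simp: ssum_def)

lemma subspace_ssum: "subspace A \<Longrightarrow> subspace B \<Longrightarrow> subspace (ssum A B)"
  unfolding ssum_def by (rule subspace_sums)

lemma ssum_upper1:
  assumes "subspace B" shows "A \<subseteq> ssum A B"
proof
  fix x assume "x \<in> A"
  then have "x + 0 \<in> ssum A B" using assms by (intro ssumI subspace_0)
  then show "x \<in> ssum A B" by simp
qed

lemma ssum_commute: "ssum A B = ssum B A"
proof -
  have "x + y \<in> ssum B A" if "x \<in> A" "y \<in> B" for x y :: 'a and A B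
    using ssumI[OF that(2,1)] by (simp add: add.commute)
  then show ?thesis by (auto elim!: ssumE)
qed

lemma ssum_upper2: "subspace A \<Longrightarrow> B \<subseteq> ssum A B"
  by (simp add: ssum_commute[of A B] ssum_upper1)

lemma ssum_least: "subspace C \<Longrightarrow> A \<subseteq> C \<Longrightarrow> B \<subseteq> C \<Longrightarrow> ssum A B \<subseteq> C"
  by (auto simp: ssum_def intro: subspace_add)

lemma subspace_perp: "bilinear B \<Longrightarrow> subspace (perp B W)"
  by (auto simp: subspace_def perp_def bilinear_rzero bilinear_radd bilinear_rmul)

lemma perp_antimono: "V \<subseteq> W \<Longrightarrow> perp B W \<subseteq> perp B V"
  by (auto simp: perp_def)

text \<open>A vector outside \<open>W\<close> is separated from \<open>W\<close> by a functional, and the functional is represented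
  by a vector of the complement.\<close>

lemma perp_perp:
  fixes B :: "'v::findim_real_vector \<Rightarrow> 'v \<Rightarrow> real"
  assumes B: "scalar_product B" and W: "subspace W"
  shows "perp B (perp B W) = W"
proof
  have bil: "bilinear B" and sym: "\<And>x y. B x y = B y x" and nd: "nondegenerate_on B UNIV"
    using B by (auto simp: scalar_product_def)
  show "W \<subseteq> perp B (perp B W)" by (auto simp: perp_def sym)
  show "perp B (perp B W) \<subseteq> W"
  proof
    fix x assume x: "x \<in> perp B (perp B W)"
    show "x \<in> W"
    proof (rule ccontr)
      assume "x \<notin> W"
      then obtain f where f: "linear (f :: 'v \<Rightarrow> real)" "f x = 1" "\<forall>w\<in>W. f w = 0"
        using separating_functional[OF W] by blast
      obtain y where y: "\<forall>x. B y x = f x" using form_represents[OF bil nd f(1)] by blast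
      have "y \<in> perp B W" using y f(3) by (auto simp: perp_def sym[of _ y])
      then have "B y x = 0" using x by (auto simp: perp_def)
      then show False using y f(2) by simp
    qed
  qed
qed

lemma perp_ssum: "bilinear B \<Longrightarrow> subspace V \<Longrightarrow> subspace W \<Longrightarrow>
    perp B (ssum V W) = perp B V \<inter> perp B W"
  using ssum_upper1[of W V] ssum_upper2[of V W]
  by (auto simp: perp_def bilinear_ladd elim!: ssumE)

lemma perp_Int:
  fixes B :: "'v::findim_real_vector \<Rightarrow> 'v \<Rightarrow> real"
  assumes B: "scalar_product B" and "subspace V" "subspace W"
  shows "perp B (V \<inter> W) = ssum (perp B V) (perp B W)"
proof -
  have bil: "bilinear B" using B by (auto simp: scalar_product_def)
  have "perp B (ssum (perp B V) (perp B W)) = V \<inter> W"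
    using assms by (simp add: perp_ssum[OF bil] subspace_perp[OF bil] perp_perp)
  then show ?thesis
    by (metis perp_perp[OF B] subspace_ssum subspace_perp[OF bil])
qed

lemma linear_section:
  fixes f :: "'v::real_vector \<Rightarrow> 'w::real_vector"
  assumes "linear f" "subspace E"
  obtains s where "linear s" "\<And>y. y \<in> f ` E \<Longrightarrow> s y \<in> E \<and> f (s y) = y"
proof -
  obtain s where "range s \<subseteq> E" "linear s" "\<forall>v\<in>f ` E. f (s v) = v"
    using linear_exists_right_inverse_on[OF assms] by (elim exE conjE) (rule that)
  then show ?thesis by (intro that) auto
qed

text \<open>A functional on a subspace, given by its graph, extends to the whole space: separate \<open>(0, 1)\<close>
  from the graph. This yields functionals with prescribed values on brackets, where
  only consistency of the values has to be checked.\<close>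

lemma functional_from_graph:
  fixes G :: "('v::real_vector \<times> real) set"
  assumes "subspace G" "\<And>r. (0, r) \<in> G \<Longrightarrow> r = 0"
  obtains f where "linear (f :: 'v \<Rightarrow> real)" "\<And>v r. (v, r) \<in> G \<Longrightarrow> f v = r"
proof -
  have "(0, 1) \<notin> G" using assms(2)[of 1] by auto
  then obtain \<phi> where \<phi>: "linear (\<phi> :: 'v \<times> real \<Rightarrow> real)" "\<phi> (0, 1) = 1" "\<forall>w\<in>G. \<phi> w = 0"
    using separating_functional[OF assms(1)] by blast
  have *: "\<phi> (v, r) = \<phi> (v, 0) + r" for v r
  proof -
    have "\<phi> (v, r) = \<phi> ((v, 0) + r *\<^sub>R (0, 1))" by simp
    also have "\<dots> = \<phi> (v, 0) + r * \<phi> (0, 1)"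
      unfolding linear_add[OF \<phi>(1)] linear_cmul[OF \<phi>(1)] by simp
    finally show ?thesis using \<phi>(2) by simp
  qed
  \<comment> \<open>Since \<open>\<phi> (v, r) = \<phi> (v, 0) + r\<close> vanishes on the graph, \<open>r\<close> is forced to be \<open>- \<phi> (v, 0)\<close>.\<close>
  have "linear (\<lambda>v. - \<phi> (v, 0))"
  proof (rule linearI)
    fix x y :: 'v and c
    show "- \<phi> (x + y, 0) = - \<phi> (x, 0) + - \<phi> (y, 0)"
      using linear_add[OF \<phi>(1), of "(x, 0)" "(y, 0)"] by simp
    show "- \<phi> (c *\<^sub>R x, 0) = c *\<^sub>R - \<phi> (x, 0)"
      using linear_cmul[OF \<phi>(1), of c "(x, 0)"] by simp
  qed
  moreover have "- \<phi> (v, 0) = r" if "(v, r) \<in> G" for v r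
    using bspec[OF \<phi>(3) that] *[of v r] by simp
  ultimately show ?thesis using that by blast
qed

lemma nondegenerate_complement:
  fixes B :: "'v::findim_real_vector \<Rightarrow> 'v \<Rightarrow> real"
  assumes B: "scalar_product B" and W: "subspace W" "nondegenerate_on B W"
  shows "ssum W (perp B W) = UNIV"
proof -
  have bil: "bilinear B" and sym: "\<And>x y. B x y = B y x"
    using B by (auto simp: scalar_product_def)
  have "W \<inter> perp B W = {0}"
    using W by (auto simp: perp_def nondegenerate_on_def sym subspace_0 bilinear_rzero[OF bil])
  moreover have "perp B {0} = UNIV" by (auto simp: perp_def bilinear_lzero[OF bil])
  ultimately have "UNIV = ssum (perp B W) (perp B (perp B W))"
    using perp_Int[OF B W(1) subspace_perp[OF bil], of W] by simp
  then show ?thesis by (simp add: perp_perp[OF B W(1)] ssum_commute)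
qed

section \<open>Semi-simple subquotients\<close>

text \<open>Semi-simplicity of a quotient \<open>V / W\<close> is a property of the lattice of submodules between
  \<open>W\<close> and \<open>V\<close>. The standard facts on semi-simple modules are therefore proved for pairs
  \<open>W \<subseteq> V\<close> by modular-law computations, and no quotient spaces appear.\<close>

lemma semisimple_quotient_iff:
  "semisimple_quotient act V W \<longleftrightarrow>
     (\<forall>U. submodule act U \<and> W \<subseteq> U \<and> U \<subseteq> V \<longrightarrow>
        (\<exists>U'. submodule act U' \<and> W \<subseteq> U' \<and> U' \<subseteq> V \<and> U \<inter> U' = W \<and> ssum U U' = V))"
  by (simp add: semisimple_quotient_def ssum_def)

lemma complement_submodule:
  assumes "semisimple_quotient act V W" "submodule act U" "W \<subseteq> U" "U \<subseteq> V"
  obtains U' where "submodule act U'" "W \<subseteq> U'" "U' \<subseteq> V" "U \<inter> U' = W" "ssum U U' = V"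
  using assms unfolding semisimple_quotient_iff by metis

lemma submodule_subspace: "submodule act U \<Longrightarrow> subspace U"
  by (simp add: submodule_def)

lemma submodule_act: "submodule act U \<Longrightarrow> u \<in> U \<Longrightarrow> act X u \<in> U"
  by (simp add: submodule_def)

lemma submodule_Int: "submodule act U \<Longrightarrow> submodule act V \<Longrightarrow> submodule act (U \<inter> V)"
  by (auto simp: submodule_def intro: subspace_inter)

lemma submodule_ssum:
  assumes "\<forall>X. linear (act X)" "submodule act U" "submodule act V"
  shows "submodule act (ssum U V)"
  using assms by (auto simp: submodule_def linear_add intro!: subspace_ssum ssumI elim!: ssumE)

lemma submodule_UNIV: "submodule act UNIV"
  by (auto simp: submodule_def)

lemma semisimple_quotient_sub:
  assumes ss: "semisimple_quotient act V W" and V': "submodule act V'" "W \<subseteq> V'" "V' \<subseteq> V"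
  shows "semisimple_quotient act V' W"
  unfolding semisimple_quotient_iff
proof (intro allI impI, elim conjE)
  fix U assume U: "submodule act U" "W \<subseteq> U" "U \<subseteq> V'"
  obtain U' where U': "submodule act U'" "W \<subseteq> U'" "U' \<subseteq> V" "U \<inter> U' = W" "ssum U U' = V"
    using complement_submodule[OF ss U(1,2)] U(3) V'(3) by blast
  have "V' \<subseteq> ssum U (U' \<inter> V')"
  proof
    fix v assume v: "v \<in> V'"
    then obtain u u' where uu: "v = u + u'" "u \<in> U" "u' \<in> U'"
      using U'(5) V'(3) by (blast elim: ssumE)
    have "v - u \<in> V'" using v uu(2) U(3) V'(1) by (meson subspace_diff submodule_subspace subsetD)
    then have "u' \<in> V'" using uu(1) by simp
    then show "v \<in> ssum U (U' \<inter> V')" using uu by (auto intro: ssumI)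
  qed
  moreover have "ssum U (U' \<inter> V') \<subseteq> V'"
    using U(3) V'(1) by (intro ssum_least) (auto simp: submodule_def)
  moreover have "submodule act (U' \<inter> V')" using submodule_Int[OF U'(1) V'(1)] .
  ultimately show "\<exists>U'. submodule act U' \<and> W \<subseteq> U' \<and> U' \<subseteq> V' \<and> U \<inter> U' = W \<and> ssum U U' = V'"
    using U' U V' by (intro exI[of _ "U' \<inter> V'"]) blast
qed

lemma semisimple_quotient_quot:
  assumes lin: "\<forall>X. linear (act X)"
    and ss: "semisimple_quotient act V W" and W': "submodule act W'" "W \<subseteq> W'" "W' \<subseteq> V"
    and V: "subspace V"
  shows "semisimple_quotient act V W'"
  unfolding semisimple_quotient_iff
proof (intro allI impI, elim conjE)
  fix U assume U: "submodule act U" "W' \<subseteq> U" "U \<subseteq> V"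
  obtain U' where U': "submodule act U'" "W \<subseteq> U'" "U' \<subseteq> V" "U \<inter> U' = W" "ssum U U' = V"
    using complement_submodule[OF ss U(1)] U(2,3) W'(2) by blast
  have sub: "subspace U" "subspace U'" "subspace W'"
    using U(1) U'(1) W'(1) by (auto simp: submodule_def)
  have "U \<inter> ssum U' W' \<subseteq> W'"
  proof
    fix x assume x: "x \<in> U \<inter> ssum U' W'"
    then obtain u w where uw: "x = u + w" "u \<in> U'" "w \<in> W'" by (blast elim: ssumE)
    have "x - w \<in> U" using x uw(3) U(2) sub(1) by (blast intro: subspace_diff)
    then have "u \<in> W" using uw U'(4) by auto
    then show "x \<in> W'" using uw W'(2) sub(3) by (blast intro: subspace_add)
  qed
  moreover have "ssum U' W' \<subseteq> V" using U'(3) W'(3) V by (intro ssum_least)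
  moreover have "W' \<subseteq> ssum U' W'" "U' \<subseteq> ssum U' W'"
    using sub by (auto intro: ssum_upper1[THEN subsetD] ssum_upper2[THEN subsetD])
  moreover have "V \<subseteq> ssum U (ssum U' W')"
    using U'(5) ssum_mono[OF order_refl \<open>U' \<subseteq> ssum U' W'\<close>, of U] by simp
  moreover have "ssum U (ssum U' W') \<subseteq> V" by (rule ssum_least[OF V U(3) \<open>ssum U' W' \<subseteq> V\<close>])
  moreover have "submodule act (ssum U' W')" using submodule_ssum[OF lin U'(1) W'(1)] .
  ultimately show "\<exists>U'. submodule act U' \<and> W' \<subseteq> U' \<and> U' \<subseteq> V \<and> U \<inter> U' = W' \<and> ssum U U' = V"
    using U(2) by (intro exI[of _ "ssum U' W'"]) blast
qed

text \<open>The isomorphism \<open>A / (A \<inter> B) \<cong> (A + B) / B\<close> matches \<open>U\<close> with \<open>U + B\<close> and \<open>U\<close> with \<open>U \<inter> A\<close>;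
  complements are carried along these maps.\<close>

lemma semisimple_quotient_second_iso:
  assumes lin: "\<forall>X. linear (act X)" and A: "submodule act A" and B: "submodule act B"
  shows "semisimple_quotient act (ssum A B) B \<longleftrightarrow> semisimple_quotient act A (A \<inter> B)"
proof
  have sub: "subspace A" "subspace B" using A B by (auto simp: submodule_def)
  show "semisimple_quotient act A (A \<inter> B)" if ss: "semisimple_quotient act (ssum A B) B"
    unfolding semisimple_quotient_iff
  proof (intro allI impI, elim conjE)
    fix U assume U: "submodule act U" "A \<inter> B \<subseteq> U" "U \<subseteq> A"
    have subU: "subspace U" using U(1) by (auto simp: submodule_def)
    have "ssum U B \<subseteq> ssum A B" using U(3) by (auto simp: ssum_def)
    then obtain U' where U': "submodule act U'" "B \<subseteq> U'" "U' \<subseteq> ssum A B"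
      "ssum U B \<inter> U' = B" "ssum (ssum U B) U' = ssum A B"
      using complement_submodule[OF ss submodule_ssum[OF lin U(1) B] ssum_upper2[OF subU]] by blast
    have subU': "subspace U'" using U'(1) by (auto simp: submodule_def)
    have "A \<subseteq> ssum U (U' \<inter> A)"
    proof
      fix a assume a: "a \<in> A"
      then have "a \<in> ssum (ssum U B) U'" using U'(5) ssum_upper1[OF sub(2)] by blast
      then obtain u b u' where *: "a = u + b + u'" "u \<in> U" "b \<in> B" "u' \<in> U'" by (blast elim!: ssumE)
      have "a - u \<in> A" using a *(2) U(3) sub(1) by (blast intro: subspace_diff)
      moreover have "a - u = b + u'" using * by simp
      moreover have "b + u' \<in> U'" using * U'(2) subU' by (blast intro: subspace_add)
      ultimately have "u + (a - u) \<in> ssum U (U' \<inter> A)" using *(2) by (intro ssumI) auto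
      then show "a \<in> ssum U (U' \<inter> A)" by simp
    qed
    moreover have "ssum U (U' \<inter> A) \<subseteq> A" using U(3) sub(1) by (intro ssum_least) auto
    moreover have "U \<inter> (U' \<inter> A) = A \<inter> B"
      using U'(2,4) U(2,3) ssum_upper1[OF sub(2), of U] by blast
    ultimately show "\<exists>U'. submodule act U' \<and> A \<inter> B \<subseteq> U' \<and> U' \<subseteq> A \<and> U \<inter> U' = A \<inter> B \<and> ssum U U' = A"
      using U'(2) submodule_Int[OF U'(1) A] by (intro exI[of _ "U' \<inter> A"]) blast
  qed
  show "semisimple_quotient act (ssum A B) B" if ss: "semisimple_quotient act A (A \<inter> B)"
    unfolding semisimple_quotient_iff
  proof (intro allI impI, elim conjE)
    fix U assume U: "submodule act U" "B \<subseteq> U" "U \<subseteq> ssum A B"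
    have subU: "subspace U" using U(1) by (auto simp: submodule_def)
    have "A \<inter> B \<subseteq> U \<inter> A" "U \<inter> A \<subseteq> A" using U(2) by auto
    then obtain U' where U': "submodule act U'" "A \<inter> B \<subseteq> U'" "U' \<subseteq> A"
      "U \<inter> A \<inter> U' = A \<inter> B" "ssum (U \<inter> A) U' = A"
      using complement_submodule[OF ss submodule_Int[OF U(1) A]] by blast
    have subU': "subspace U'" using U'(1) by (auto simp: submodule_def)
    have "U \<inter> ssum U' B \<subseteq> B"
    proof
      fix x assume x: "x \<in> U \<inter> ssum U' B"
      then obtain u b where *: "x = u + b" "u \<in> U'" "b \<in> B" by (blast elim: ssumE)
      have "x - b \<in> U" using x *(3) U(2) subU by (blast intro: subspace_diff)
      then have "u \<in> U \<inter> A \<inter> U'" using * U'(3) by auto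
      then have "u \<in> B" using U'(4) by blast
      then show "x \<in> B" using * sub(2) by (blast intro: subspace_add)
    qed
    moreover have "B \<subseteq> ssum U' B" by (rule ssum_upper2[OF subU'])
    moreover have "ssum U' B \<subseteq> ssum A B" using U'(3) by (auto simp: ssum_def)
    moreover have "ssum A B \<subseteq> ssum U (ssum U' B)"
    proof
      fix x assume "x \<in> ssum A B"
      then obtain a b where "x = a + b" "a \<in> A" "b \<in> B" by (rule ssumE)
      moreover obtain u u' where "a = u + u'" "u \<in> U" "u' \<in> U'"
        using \<open>a \<in> A\<close> U'(5) by (blast elim: ssumE)
      ultimately have "x = u + (u' + b)" "u \<in> U" "u' + b \<in> ssum U' B" by (auto intro: ssumI)
      then show "x \<in> ssum U (ssum U' B)" using ssumI by blast
    qed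
    moreover have "ssum U (ssum U' B) \<subseteq> ssum A B"
      by (rule ssum_least[OF subspace_ssum[OF sub] U(3) \<open>ssum U' B \<subseteq> ssum A B\<close>])
    moreover have "submodule act (ssum U' B)" using submodule_ssum[OF lin U'(1) B] .
    ultimately show "\<exists>U'. submodule act U' \<and> B \<subseteq> U' \<and> U' \<subseteq> ssum A B \<and> U \<inter> U' = B \<and> ssum U U' = ssum A B"
      using U(2) by (intro exI[of _ "ssum U' B"]) blast
  qed
qed

text \<open>A sum of two semi-simple modules is semi-simple.\<close>

lemma semisimple_quotient_ssum:
  assumes lin: "\<forall>X. linear (act X)" and X: "submodule act X" and Y: "submodule act Y"
    and W: "W \<subseteq> X" "W \<subseteq> Y"
    and ssX: "semisimple_quotient act X W" and ssY: "semisimple_quotient act Y W"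
  shows "semisimple_quotient act (ssum X Y) W"
proof -
  have "W \<subseteq> X \<inter> Y" "X \<inter> Y \<subseteq> Y" using W by auto
  then obtain Y' where Y': "submodule act Y'" "W \<subseteq> Y'" "Y' \<subseteq> Y" "X \<inter> Y \<inter> Y' = W" "ssum (X \<inter> Y) Y' = Y"
    using complement_submodule[OF ssY submodule_Int[OF X Y]] by blast
  have sub: "subspace X" "subspace Y" "subspace Y'" using X Y Y' by (auto simp: submodule_def)
  have subW: "subspace W" using Y'(4) sub by (metis subspace_inter)
  have XY': "X \<inter> Y' = W" using Y'(3,4) by blast
  have ssY': "semisimple_quotient act Y' W" using semisimple_quotient_sub[OF ssY Y'(1-3)] .
  have sum_eq: "ssum X Y = ssum X Y'"
  proof
    show "ssum X Y' \<subseteq> ssum X Y" using Y'(3) by (auto simp: ssum_def)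
    have "Y \<subseteq> ssum X Y'" using Y'(5) ssum_mono[of "X \<inter> Y" X Y' Y'] by simp
    then show "ssum X Y \<subseteq> ssum X Y'"
      using ssum_upper1[OF sub(3)] subspace_ssum[OF sub(1,3)] by (intro ssum_least)
  qed
  show ?thesis unfolding sum_eq semisimple_quotient_iff
  proof (intro allI impI, elim conjE)
    fix U assume U: "submodule act U" "W \<subseteq> U" "U \<subseteq> ssum X Y'"
    have subU: "subspace U" using U(1) by (auto simp: submodule_def)
    have "W \<subseteq> U \<inter> X" using U(2) W by auto
    then obtain D where D: "submodule act D" "W \<subseteq> D" "D \<subseteq> X" "U \<inter> X \<inter> D = W" "ssum (U \<inter> X) D = X"
      using complement_submodule[OF ssX submodule_Int[OF U(1) X]] by blast
    have "W \<subseteq> ssum U X \<inter> Y'" using U(2) Y'(2) ssum_upper1[OF sub(1), of U] by blast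
    then obtain E where E: "submodule act E" "W \<subseteq> E" "E \<subseteq> Y'" "ssum U X \<inter> Y' \<inter> E = W"
      "ssum (ssum U X \<inter> Y') E = Y'"
      using complement_submodule[OF ssY' submodule_Int[OF submodule_ssum[OF lin U(1) X] Y'(1)]] by blast
    have subDE: "subspace D" "subspace E" using D E by (auto simp: submodule_def)
    have "U \<inter> ssum D E \<subseteq> W"
    proof
      fix u assume u: "u \<in> U \<inter> ssum D E"
      then obtain d e where de: "u = d + e" "d \<in> D" "e \<in> E" by (blast elim: ssumE)
      have "u + - d \<in> ssum U X" using u de(2) D(3) sub(1) by (intro ssumI) (auto intro: subspace_neg)
      then have "e \<in> W" using de E(3,4) by auto
      then have "e \<in> U" using U(2) by blast
      then have "u - e \<in> U" using u subU by (blast intro: subspace_diff)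
      then have "d \<in> W" using de D(3,4) by auto
      then show "u \<in> W" using \<open>e \<in> W\<close> de(1) subW by (auto intro: subspace_add)
    qed
    moreover have "W \<subseteq> ssum D E" using D(2) ssum_upper1[OF subDE(2)] by blast
    moreover have DE: "ssum D E \<subseteq> ssum X Y'" using D(3) E(3) by (auto simp: ssum_def)
    moreover have "ssum X Y' \<subseteq> ssum U (ssum D E)"
    proof (rule ssum_least)
      show sp: "subspace (ssum U (ssum D E))" by (intro subspace_ssum subU subDE)
      have ups: "U \<subseteq> ssum U (ssum D E)" "D \<subseteq> ssum U (ssum D E)" "E \<subseteq> ssum U (ssum D E)"
        using ssum_upper1[OF subspace_ssum[OF subDE], of U] ssum_upper2[OF subU, of "ssum D E"]
          ssum_upper1[OF subDE(2), of D] ssum_upper2[OF subDE(1), of E] by auto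
      show Xs: "X \<subseteq> ssum U (ssum D E)"
        using ups sp ssum_least[of "ssum U (ssum D E)" "U \<inter> X" D] D(5) by blast
      have "ssum U X \<subseteq> ssum U (ssum D E)" using ups Xs sp by (intro ssum_least)
      then show "Y' \<subseteq> ssum U (ssum D E)"
        using ups sp ssum_least[of "ssum U (ssum D E)" "ssum U X \<inter> Y'" E] E(5) by blast
    qed
    moreover have "ssum U (ssum D E) \<subseteq> ssum X Y'"
      by (rule ssum_least[OF subspace_ssum[OF sub(1,3)] U(3) DE])
    moreover have "submodule act (ssum D E)" using submodule_ssum[OF lin D(1) E(1)] .
    ultimately show "\<exists>U'. submodule act U' \<and> W \<subseteq> U' \<and> U' \<subseteq> ssum X Y' \<and> U \<inter> U' = W \<and> ssum U U' = ssum X Y'"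
      using U(2) by (intro exI[of _ "ssum D E"]) blast
  qed
qed

text \<open>\<open>V / (W1 \<inter> W2)\<close> embeds into \<open>V / W1 \<oplus> V / W2\<close>. In the lattice: with a complement \<open>C\<close> of
  \<open>W1 + W2\<close> over \<open>W1\<close>, the module \<open>V\<close> is the sum of \<open>C\<close> and \<open>W2\<close>, and both are semi-simple over
  \<open>W1 \<inter> W2\<close> by the second isomorphism theorem. This is what makes a smallest ideal with
  semi-simple quotient exist.\<close>

lemma semisimple_quotient_Int:
  assumes lin: "\<forall>X. linear (act X)" and V: "submodule act V"
    and W1: "submodule act W1" "W1 \<subseteq> V" and W2: "submodule act W2" "W2 \<subseteq> V"
    and ss1: "semisimple_quotient act V W1" and ss2: "semisimple_quotient act V W2"
  shows "semisimple_quotient act V (W1 \<inter> W2)"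
proof -
  have sub: "subspace V" "subspace W1" "subspace W2" using V W1 W2 by (auto simp: submodule_def)
  have s12: "ssum W1 W2 \<subseteq> V" using W1 W2 sub by (intro ssum_least)
  obtain C where C: "submodule act C" "W1 \<subseteq> C" "C \<subseteq> V" "ssum W1 W2 \<inter> C = W1" "ssum (ssum W1 W2) C = V"
    using complement_submodule[OF ss1 submodule_ssum[OF lin W1(1) W2(1)] ssum_upper1[OF sub(3)] s12] by blast
  have subC: "subspace C" using C by (auto simp: submodule_def)
  have CW2: "C \<inter> W2 = W1 \<inter> W2" using C(2,4) ssum_upper2[OF sub(2), of W2] by blast
  have "ssum C W2 = V"
  proof
    show "ssum C W2 \<subseteq> V" using C W2 sub by (intro ssum_least)
    have "ssum W1 W2 \<subseteq> ssum C W2" using C(2) by (auto simp: ssum_def)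
    then show "V \<subseteq> ssum C W2"
      using C(5) ssum_least[OF subspace_ssum[OF subC sub(3)] \<open>ssum W1 W2 \<subseteq> ssum C W2\<close>
        ssum_upper1[OF sub(3), of C]] by blast
  qed
  moreover have "semisimple_quotient act C (C \<inter> W2)"
    using semisimple_quotient_second_iso[OF lin C(1) W2(1)] ss2 \<open>ssum C W2 = V\<close> by simp
  moreover have "semisimple_quotient act W2 (W2 \<inter> W1)"
    using semisimple_quotient_second_iso[OF lin W2(1) W1(1)]
      semisimple_quotient_sub[OF ss1 submodule_ssum[OF lin W1(1) W2(1)] ssum_upper1[OF sub(3)] s12]
    by (simp add: ssum_commute)
  ultimately show ?thesis
    using semisimple_quotient_ssum[OF lin C(1) W2(1), of "W1 \<inter> W2"] CW2 C(2) by (auto simp: Int_commute)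
qed

lemma subspace_complement:
  fixes U :: "'v::real_vector set"
  assumes "subspace U" "subspace V" "U \<subseteq> V"
  obtains C where "subspace C" "C \<subseteq> V" "U \<inter> C = {0}" "ssum U C = V"
proof -
  obtain s where s: "linear s" "\<And>y. y \<in> U \<Longrightarrow> s y = y" "range s \<subseteq> U"
    using linear_projection[OF assms(1)] by metis
  let ?C = "{v \<in> V. s v = 0}"
  have "subspace ?C" using assms(2) s(1)
    by (auto simp: subspace_def linear_0 linear_add linear_cmul)
  moreover have "U \<inter> ?C = {0}"
    using s(2) assms by (auto simp: subspace_0) 
  moreover have "ssum U ?C = V"
  proof
    show "ssum U ?C \<subseteq> V" using assms by (intro ssum_least) auto
    show "V \<subseteq> ssum U ?C"
    proof
      fix v assume v: "v \<in> V"
      have "s v \<in> U" using s(3) by blast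
      then have "v - s v \<in> ?C" using v assms s(2)[of "s v"] linear_diff[OF s(1)]
        by (auto intro: subspace_diff)
      then have "s v + (v - s v) \<in> ssum U ?C" using \<open>s v \<in> U\<close> by (intro ssumI)
      then show "v \<in> ssum U ?C" by simp
    qed
  qed
  ultimately show ?thesis using that[of ?C] by blast
qed

lemma semisimple_quotient_trivial:
  assumes V: "subspace V" and W: "subspace W" "W \<subseteq> V" and triv: "\<And>X v. v \<in> V \<Longrightarrow> act X v \<in> W"
  shows "semisimple_quotient act V W"
  unfolding semisimple_quotient_iff
proof (intro allI impI, elim conjE)
  fix U assume U: "submodule act U" "W \<subseteq> U" "U \<subseteq> V"
  have subU: "subspace U" using U by (auto simp: submodule_def)
  obtain C where C: "subspace C" "C \<subseteq> V" "U \<inter> C = {0}" "ssum U C = V"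
    using subspace_complement[OF subU V U(3)] by blast
  have CV: "ssum C W \<subseteq> V" using C W V by (intro ssum_least)
  have W': "W \<subseteq> ssum C W" and C': "C \<subseteq> ssum C W"
    using ssum_upper1[OF W(1), of C] ssum_upper2[OF C(1), of W] by auto
  have "submodule act (ssum C W)"
    using CV W' triv subspace_ssum[OF C(1) W(1)] by (auto simp: submodule_def)
  moreover have "U \<inter> ssum C W \<subseteq> W"
  proof
    fix x assume x: "x \<in> U \<inter> ssum C W"
    then obtain c w where cw: "x = c + w" "c \<in> C" "w \<in> W" by (blast elim: ssumE)
    have "x - w \<in> U" using x cw U(2) subU by (blast intro: subspace_diff)
    then have "c = 0" using cw C(3) by auto
    then show "x \<in> W" using cw by simp
  qed
  moreover have "V \<subseteq> ssum U (ssum C W)" using C(4) ssum_mono[OF order_refl C', of U] by simp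
  moreover have "ssum U (ssum C W) \<subseteq> V" by (rule ssum_least[OF V U(3) CV])
  ultimately show "\<exists>U'. submodule act U' \<and> W \<subseteq> U' \<and> U' \<subseteq> V \<and> U \<inter> U' = W \<and> ssum U U' = V"
    using W' U(2) CV by (intro exI[of _ "ssum C W"]) blast
qed

text \<open>The kernel of \<open>f\<close> lies in the denominator, so \<open>f\<close> induces a bijection of submodule lattices. The
  two modules may have different acting sets, related by a surjection \<open>\<phi>\<close>; this covers isomorphisms
  of Lie algebras as well as the projections of the standard model onto \<open>L\<close> and \<open>M\<close>.\<close>

lemma semisimple_quotient_image:
  fixes f :: "'v::real_vector \<Rightarrow> 'w::real_vector"
  assumes f: "linear f" and V: "submodule act V" and W: "submodule act W" "W \<subseteq> V"
    and ker: "\<And>v. v \<in> V \<Longrightarrow> f v = 0 \<Longrightarrow> v \<in> W"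
    and eqv: "\<And>X v. v \<in> V \<Longrightarrow> f (act X v) = act' (\<phi> X) (f v)" and surj: "surj \<phi>"
  shows "semisimple_quotient act' (f ` V) (f ` W) \<longleftrightarrow> semisimple_quotient act V W"
proof
  have sub: "subspace V" "subspace W" using V W by (auto simp: submodule_def)
  have imsub: "submodule act' (f ` U)" if U: "submodule act U" "U \<subseteq> V" for U
    unfolding submodule_def
  proof (intro conjI allI ballI)
    show "subspace (f ` U)" using U f by (auto simp: submodule_def intro: linear_subspace_image)
    fix Y y assume "y \<in> f ` U"
    then obtain u where u: "u \<in> U" "y = f u" by blast
    obtain X where X: "Y = \<phi> X" using surj by (metis surjE)
    have "act' Y y = f (act X u)" using u U eqv X by auto
    then show "act' Y y \<in> f ` U" using u U(1) by (auto simp: submodule_def)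
  qed
  have presub: "submodule act (V \<inter> f -` U)" if U: "submodule act' U" for U
    unfolding submodule_def using V U eqv f
    by (auto simp: submodule_def intro!: subspace_inter linear_subspace_vimage)
  have inj: "v \<in> U" if "v \<in> V" "f v \<in> f ` U" "W \<subseteq> U" "U \<subseteq> V" "subspace U" for v U
  proof -
    from that(2) obtain u where u: "u \<in> U" "f v = f u" by blast
    have "f (v - u) = 0" using u linear_diff[OF f] by simp
    then have "v - u \<in> W" using ker[of "v - u"] that u sub by (blast intro: subspace_diff)
    then have "v - u + u \<in> U" using that u by (blast intro: subspace_add)
    then show ?thesis by simp
  qed
  have imsum: "f ` ssum A B = ssum (f ` A) (f ` B)" for A B
    by (auto simp: ssum_def linear_add[OF f] image_iff) (metis linear_add[OF f])+
  show "semisimple_quotient act V W" if ss: "semisimple_quotient act' (f ` V) (f ` W)"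
    unfolding semisimple_quotient_iff
  proof (intro allI impI, elim conjE)
    fix U assume U: "submodule act U" "W \<subseteq> U" "U \<subseteq> V"
    have subU: "subspace U" using U by (auto simp: submodule_def)
    have "f ` W \<subseteq> f ` U" "f ` U \<subseteq> f ` V" using U by auto
    then obtain T where T: "submodule act' T" "f ` W \<subseteq> T" "T \<subseteq> f ` V" "f ` U \<inter> T = f ` W" "ssum (f ` U) T = f ` V"
      by (rule complement_submodule[OF ss imsub[OF U(1,3)]])
    let ?U' = "V \<inter> f -` T"
    have WU': "W \<subseteq> ?U'" using W(2) T(2) by auto
    have sU': "subspace ?U'" using presub[OF T(1)] by (auto simp: submodule_def)
    have "U \<inter> ?U' = W"
    proof
      show "U \<inter> ?U' \<subseteq> W"
      proof
        fix x assume x: "x \<in> U \<inter> ?U'"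
        then have "f x \<in> f ` W" using T(4) by blast
        then show "x \<in> W" using inj[of x W] x W sub by blast
      qed
    qed (use U WU' in blast)
    moreover have "ssum U ?U' = V"
    proof
      show "ssum U ?U' \<subseteq> V" using U sub by (intro ssum_least) auto
      have fU': "f ` ?U' = T" using T(3) by auto
      show "V \<subseteq> ssum U ?U'"
      proof
        fix v assume v: "v \<in> V"
        then have "f v \<in> f ` ssum U ?U'" using T(5) imsum fU' by auto
        moreover have "W \<subseteq> ssum U ?U'" using U(2) ssum_upper1[OF sU', of U] by blast
        ultimately show "v \<in> ssum U ?U'"
          using inj v \<open>ssum U ?U' \<subseteq> V\<close> subspace_ssum[OF subU sU'] by blast
      qed
    qed
    ultimately show "\<exists>U'. submodule act U' \<and> W \<subseteq> U' \<and> U' \<subseteq> V \<and> U \<inter> U' = W \<and> ssum U U' = V"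
      using WU' presub[OF T(1)] by (intro exI[of _ ?U']) blast
  qed
  show "semisimple_quotient act' (f ` V) (f ` W)" if ss: "semisimple_quotient act V W"
    unfolding semisimple_quotient_iff
  proof (intro allI impI, elim conjE)
    fix T assume T: "submodule act' T" "f ` W \<subseteq> T" "T \<subseteq> f ` V"
    let ?U = "V \<inter> f -` T"
    have fU: "f ` ?U = T" using T(3) by auto
    have "W \<subseteq> ?U" using W(2) T(2) by auto
    then obtain U' where U': "submodule act U'" "W \<subseteq> U'" "U' \<subseteq> V" "?U \<inter> U' = W" "ssum ?U U' = V"
      using complement_submodule[OF ss presub[OF T(1)]] by blast
    have "T \<inter> f ` U' = f ` W"
    proof
      show "f ` W \<subseteq> T \<inter> f ` U'" using T(2) U'(2) by blast
      show "T \<inter> f ` U' \<subseteq> f ` W" using U'(3,4) by blast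
    qed
    moreover have "ssum T (f ` U') = f ` V" using imsum[of ?U U'] fU U'(5) by simp
    ultimately show "\<exists>U'. submodule act' U' \<and> f ` W \<subseteq> U' \<and> U' \<subseteq> f ` V \<and> T \<inter> U' = f ` W \<and> ssum T U' = f ` V"
      using image_mono[OF U'(2), of f] image_mono[OF U'(3), of f] imsub[OF U'(1,3)]
      by (intro exI[of _ "f ` U'"] conjI)
  qed
qed

lemma submodule_perp:
  assumes "bilinear B" "\<forall>X u v. B (act X u) v = - B u (act X v)" "submodule act U"
  shows "submodule act (perp B U)"
  unfolding submodule_def
proof (intro conjI allI ballI)
  fix X w assume w: "w \<in> perp B U"
  have "B u (act X w) = 0" if "u \<in> U" for u
  proof -
    have "B (act X u) w = 0" using w that assms(3) by (auto simp: perp_def submodule_def)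
    then show ?thesis using assms(2) by simp
  qed
  then show "act X w \<in> perp B U" by (auto simp: perp_def)
qed (rule subspace_perp[OF assms(1)])

text \<open>For an invariant scalar product, \<open>perp\<close> is an inclusion-reversing involution of the lattice of
  submodules.\<close>

lemma semisimple_quotient_perp:
  fixes B :: "'v::findim_real_vector \<Rightarrow> 'v \<Rightarrow> real"
  assumes B: "scalar_product B" and inv: "\<forall>X u v. B (act X u) v = - B u (act X v)"
    and V: "submodule act V" and W: "submodule act W" "W \<subseteq> V" and ss: "semisimple_quotient act V W"
  shows "semisimple_quotient act (perp B W) (perp B V)"
  unfolding semisimple_quotient_iff
proof (intro allI impI, elim conjE)
  have bil: "bilinear B" using B by (auto simp: scalar_product_def)
  note sp = submodule_perp[OF bil inv] and pp = perp_perp[OF B submodule_subspace]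
  fix U assume U: "submodule act U" "perp B V \<subseteq> U" "U \<subseteq> perp B W"
  have "W \<subseteq> perp B U" using perp_antimono[OF U(3), of B] pp[OF W(1)] by simp
  moreover have "perp B U \<subseteq> V" using perp_antimono[OF U(2), of B] pp[OF V] by simp
  ultimately obtain U' where U': "submodule act U'" "W \<subseteq> U'" "U' \<subseteq> V"
    "perp B U \<inter> U' = W" "ssum (perp B U) U' = V"
    using complement_submodule[OF ss sp[OF U(1)]] by blast
  have "U \<inter> perp B U' = perp B V"
    using perp_ssum[OF bil, of "perp B U" U'] U'(1,5) sp[OF U(1)] pp[OF U(1)]
    by (simp add: submodule_def)
  moreover have "ssum U (perp B U') = perp B W"
    using perp_Int[OF B, of "perp B U" U'] U'(1,4) sp[OF U(1)] pp[OF U(1)]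
    by (simp add: submodule_def)
  ultimately show "\<exists>U'. submodule act U' \<and> perp B V \<subseteq> U' \<and> U' \<subseteq> perp B W \<and>
      U \<inter> U' = perp B V \<and> ssum U U' = perp B W"
    using sp[OF U'(1)] perp_antimono[OF U'(2), of B] perp_antimono[OF U'(3), of B]
    by (intro exI[of _ "perp B U'"]) blast
qed

section \<open>The radical series and the socle\<close>

lemma dim_less_of_psubset:
  fixes U :: "'v::findim_real_vector set"
  shows "subspace U \<Longrightarrow> subspace V \<Longrightarrow> U \<subset> V \<Longrightarrow> dim U < dim V"
  using findim.dim_psubset[of U V] span_eq_iff[of U] span_eq_iff[of V] by metis

text \<open>An ideal of least dimension among the candidates is the smallest one, because candidates are
  closed under intersection.\<close>

lemma R_Suc_least:
  fixes L :: "('l::findim_real_vector, 'z) inv_lie_scheme"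
  assumes lin: "\<forall>X. linear (brac L X)" and Rk: "submodule (brac L) (R L k)"
  shows "submodule (brac L) (R L (Suc k)) \<and> R L (Suc k) \<subseteq> R L k \<and>
      semisimple_quotient (brac L) (R L k) (R L (Suc k)) \<and>
      (\<forall>I. submodule (brac L) I \<and> I \<subseteq> R L k \<and> semisimple_quotient (brac L) (R L k) I \<longrightarrow> R L (Suc k) \<subseteq> I)"
proof -
  let ?P = "\<lambda>I. submodule (brac L) I \<and> I \<subseteq> R L k \<and> semisimple_quotient (brac L) (R L k) I"
  have "semisimple_quotient (brac L) (R L k) (R L k)"
    using Rk by (intro semisimple_quotient_trivial) (auto simp: submodule_def)
  then have "?P (R L k)" using Rk by simp
  then obtain I0 where I0: "?P I0" "\<And>I. ?P I \<Longrightarrow> dim I0 \<le> dim I"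
    using ex_has_least_nat[of ?P "R L k" dim] by blast
  have least: "I0 \<subseteq> I" if I: "?P I" for I
  proof (rule ccontr)
    assume "\<not> I0 \<subseteq> I"
    then have "I0 \<inter> I \<subset> I0" by blast
    moreover have P: "?P (I0 \<inter> I)"
      using I I0(1) semisimple_quotient_Int[OF lin Rk] submodule_Int by blast
    ultimately have "dim (I0 \<inter> I) < dim I0"
      using I0(1) by (intro dim_less_of_psubset) (auto simp: submodule_def)
    then show False using I0(2)[OF P] by simp
  qed
  have "R L (Suc k) = I0"
    using I0(1) least by (auto intro!: Least_equality)
  then show ?thesis using I0(1) least by blast
qed

lemma submodule_R:
  fixes L :: "('l::findim_real_vector, 'z) inv_lie_scheme"
  assumes lin: "\<forall>X. linear (brac L X)"
  shows "submodule (brac L) (R L k)"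
proof (induction k)
  case 0 then show ?case by (simp add: submodule_UNIV)
next
  case (Suc k) then show ?case using R_Suc_least[OF lin] by blast
qed

lemma
  fixes L :: "('l::findim_real_vector, 'z) inv_lie_scheme"
  assumes lin: "\<forall>X. linear (brac L X)"
  shows R_Suc_subset: "R L (Suc k) \<subseteq> R L k"
    and R_Suc_semisimple: "semisimple_quotient (brac L) (R L k) (R L (Suc k))"
    and R_Suc_minimal: "submodule (brac L) I \<Longrightarrow> I \<subseteq> R L k \<Longrightarrow>
          semisimple_quotient (brac L) (R L k) I \<Longrightarrow> R L (Suc k) \<subseteq> I"
  using R_Suc_least[OF lin submodule_R[OF lin]] by blast+

lemma R_antimono:
  fixes L :: "('l::findim_real_vector, 'z) inv_lie_scheme"
  assumes lin: "\<forall>X. linear (brac L X)"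
  shows "k \<le> m \<Longrightarrow> R L m \<subseteq> R L k"
  using lift_Suc_antimono_le[of "R L", OF R_Suc_subset[OF lin]] by blast

text \<open>The greatest semi-simple ideal exists because sums of semi-simple ideals are semi-simple.\<close>

lemma semisimple_subset_S1:
  fixes L :: "('l::findim_real_vector, 'z) inv_lie_scheme"
  assumes lin: "\<forall>X. linear (brac L X)" and K: "submodule (brac L) K" "semisimple (brac L) K"
  shows "K \<subseteq> S1 L"
proof -
  let ?P = "\<lambda>I. submodule (brac L) I \<and> semisimple (brac L) I"
  have "\<forall>y. ?P y \<longrightarrow> dim y < Suc (dim (UNIV :: 'l set))"
    by (metis findim.dim_subset less_Suc_eq_le subset_UNIV)
  then obtain I0 where I0: "?P I0" "\<And>I. ?P I \<Longrightarrow> dim I \<le> dim I0"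
    using ex_has_greatest_nat[of ?P K dim] K by blast
  have greatest: "I \<subseteq> I0" if I: "?P I" for I
  proof (rule ccontr)
    have sub: "subspace I" "subspace I0" using I I0 by (auto simp: submodule_def)
    assume "\<not> I \<subseteq> I0"
    then have "I0 \<subset> ssum I0 I" using ssum_upper1[OF sub(1), of I0] ssum_upper2[OF sub(2), of I] by blast
    moreover have P: "?P (ssum I0 I)"
      using I I0(1) semisimple_quotient_ssum[OF lin, of I0 I "{0}"] submodule_ssum[OF lin] sub
      by (auto simp: semisimple_def subspace_0)
    ultimately have "dim I0 < dim (ssum I0 I)"
      using sub by (intro dim_less_of_psubset subspace_ssum)
    then show False using I0(2)[OF P] by simp
  qed
  have "S1 L = I0" unfolding S1_def
    using I0(1) greatest by (auto intro!: Greatest_equality)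
  then show ?thesis using greatest K by blast
qed

section \<open>Nilpotency from the trace form: Cartan's criterion\<close>

text \<open>Let \<open>\<rho> X0\<close> have the eigenvalues \<open>ev i\<close> in a complex Jordan basis, and let \<open>H\<close> be the diagonal
  matrix with the complex conjugate entries. The operator \<open>ad H\<close> has the eigenvalues
  \<open>cnj (ev i - ev j)\<close> on the generalised eigenspaces of \<open>ad X0\<close>, so it preserves every
  \<open>ad X0\<close>-stable space of matrices and maps to every space into which \<open>ad X0\<close> maps. If
  \<open>X0\<close> is a combination of brackets \<open>[U, W]\<close>, then \<open>\<Sum>i. \<bar>ev i\<bar>\<^sup>2 = tr (H X0)\<close> is a combination of
  the traces \<open>tr (H [U, W]) = - tr (U [H, W])\<close>, which vanish by orthogonality. Hence \<open>X0\<close> is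
  nilpotent.\<close>

context vector_space
begin

text \<open>Modulo \<open>N\<close> the vector \<open>u\<close> is an eigenvector for \<open>\<nu>\<close>, so \<open>(X - \<mu>)\<close> acts on it as the nonzero
  scalar \<open>\<nu> - \<mu>\<close>; but a power of \<open>X - \<mu>\<close> kills it.\<close>

lemma eigen_shift:
  fixes X :: "'b \<Rightarrow> 'b"
  assumes add: "\<And>u v. X (u + v) = X u + X v" and scl: "\<And>c u. X (scale c u) = scale c (X u)"
    and N: "Modules.module.subspace scale N" "\<And>u. u \<in> N \<Longrightarrow> X u \<in> N"
    and ne: "\<mu> \<noteq> \<nu>" and nil: "((\<lambda>v. X v - scale \<mu> v) ^^ m) u = 0" and u: "X u - scale \<nu> u \<in> N"
  shows "u \<in> N"
proof -
  let ?Y = "\<lambda>v. X v - scale \<mu> v"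
  have Y_add: "?Y (v + w) = ?Y v + ?Y w" for v w by (simp add: add scale_right_distrib)
  have Y_scl: "?Y (scale c v) = scale c (?Y v)" for c v
    by (simp add: scl scale_right_diff_distrib scale_left_commute)
  have Y_N: "?Y v \<in> N" if "v \<in> N" for v
    using that N subspace_diff[OF N(1)] subspace_scale[OF N(1)] by blast
  have "(?Y ^^ k) u - scale ((\<nu> - \<mu>) ^ k) u \<in> N" for k
  proof (induction k)
    case 0 then show ?case using subspace_0[OF N(1)] by simp
  next
    case (Suc k)
    let ?n = "(?Y ^^ k) u - scale ((\<nu> - \<mu>) ^ k) u"
    have "?Y ((?Y ^^ k) u) = ?Y (scale ((\<nu> - \<mu>) ^ k) u + ?n)" by simp
    also have "\<dots> = scale ((\<nu> - \<mu>) ^ k) (?Y u) + ?Y ?n" by (simp only: Y_add Y_scl)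
    also have "?Y u = scale (\<nu> - \<mu>) u + (X u - scale \<nu> u)" by (simp add: scale_left_diff_distrib)
    finally have eq: "(?Y ^^ Suc k) u - scale ((\<nu> - \<mu>) ^ Suc k) u
        = scale ((\<nu> - \<mu>) ^ k) (X u - scale \<nu> u) + ?Y ?n"
      by (simp add: scale_right_distrib mult.commute)
    show ?case
      unfolding eq by (rule subspace_add[OF N(1) subspace_scale[OF N(1) u] Y_N[OF Suc]])
  qed
  from this[of m] have "0 - scale ((\<nu> - \<mu>) ^ m) u \<in> N" by (simp only: nil)
  then have "scale (- inverse ((\<nu> - \<mu>) ^ m)) (0 - scale ((\<nu> - \<mu>) ^ m) u) \<in> N"
    by (rule subspace_scale[OF N(1)])
  then show ?thesis using ne by simp
qed

text \<open>A stable subspace contains the generalised eigencomponents of its elements: a power of \<open>X - \<nu>\<close>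
  removes the component for \<open>\<nu>\<close>, the induction hypothesis puts the images of the others into \<open>N\<close>,
  and \<open>eigen_shift\<close> undoes the factors \<open>X - \<nu>\<close> one at a time.\<close>

lemma eigen_components:
  fixes X :: "'b \<Rightarrow> 'b"
  assumes add: "\<And>u v. X (u + v) = X u + X v" and scl: "\<And>c u. X (scale c u) = scale c (X u)"
    and N: "Modules.module.subspace scale N" "\<And>u. u \<in> N \<Longrightarrow> X u \<in> N" and G: "finite G"
  shows "(\<And>\<mu>. \<mu> \<in> G \<Longrightarrow> ((\<lambda>v. X v - scale \<mu> v) ^^ m) (c \<mu>) = 0) \<Longrightarrow> (\<Sum>\<mu>\<in>G. c \<mu>) \<in> N \<Longrightarrow>
     \<mu> \<in> G \<Longrightarrow> c \<mu> \<in> N"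
  using G
proof (induction G arbitrary: c \<mu> rule: finite_induct)
  case (insert \<nu> G)
  let ?Y = "\<lambda>\<mu> v. X v - scale \<mu> v"
  have Y_add: "?Y \<mu> (v + w) = ?Y \<mu> v + ?Y \<mu> w" for v w \<mu> by (simp add: add scale_right_distrib)
  have X0: "X 0 = 0" using add[of 0 0] by simp
  have X_diff: "X (v - w) = X v - X w" for v w
    using add[of v "scale (- 1) w"] scl[of "-1" w] by simp
  have comm: "?Y \<mu> (?Y \<nu> v) = ?Y \<nu> (?Y \<mu> v)" for \<mu> \<nu> v
    by (simp add: X_diff scl scale_right_diff_distrib scale_left_commute)
  have comm1: "(?Y \<mu> ^^ k) (?Y \<nu> v) = ?Y \<nu> ((?Y \<mu> ^^ k) v)" for \<mu> \<nu> v k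
    by (induction k) (simp_all add: comm)
  have comm2: "(?Y \<mu> ^^ k) ((?Y \<nu> ^^ l) v) = (?Y \<nu> ^^ l) ((?Y \<mu> ^^ k) v)" for \<mu> \<nu> v k l
    by (induction l) (simp_all add: comm1)
  have pow0: "(?Y \<mu> ^^ k) 0 = 0" for \<mu> k by (induction k) (simp_all add: X0)
  have pow_add: "(?Y \<mu> ^^ k) (v + w) = (?Y \<mu> ^^ k) v + (?Y \<mu> ^^ k) w" for \<mu> k v w
    by (induction k) (simp_all add: Y_add[simplified])
  have pow_sum: "(?Y \<mu> ^^ k) (\<Sum>i\<in>H. f i) = (\<Sum>i\<in>H. (?Y \<mu> ^^ k) (f i))" for \<mu> k and f :: "'a \<Rightarrow> 'b" and H
    by (induction H rule: infinite_finite_induct) (simp_all add: pow0 pow_add)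
  have pow_N: "(?Y \<mu> ^^ k) v \<in> N" if "v \<in> N" for \<mu> k v
    using that N subspace_diff[OF N(1)] subspace_scale[OF N(1)] by (induction k) auto
  have "(?Y \<nu> ^^ m) (\<Sum>\<mu>\<in>insert \<nu> G. c \<mu>) \<in> N" by (rule pow_N[OF insert.prems(2)])
  moreover have "(?Y \<nu> ^^ m) (\<Sum>\<mu>\<in>insert \<nu> G. c \<mu>) = (\<Sum>\<mu>\<in>G. (?Y \<nu> ^^ m) (c \<mu>))"
    using insert.hyps insert.prems(1)[of \<nu>] by (simp add: pow_add pow_sum)
  ultimately have sumN: "(\<Sum>\<mu>\<in>G. (?Y \<nu> ^^ m) (c \<mu>)) \<in> N" by simp
  have nilG: "(?Y \<mu> ^^ m) ((?Y \<nu> ^^ k) (c \<mu>)) = 0" if "\<mu> \<in> G" for \<mu> k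
    using insert.prems(1)[of \<mu>] that by (simp add: comm2 pow0)
  have cG: "c \<mu> \<in> N" if \<mu>: "\<mu> \<in> G" for \<mu>
  proof -
    have "(?Y \<nu> ^^ m) (c \<mu>) \<in> N" by (rule insert.IH[OF nilG sumN \<mu>])
    moreover have "(?Y \<nu> ^^ k) (c \<mu>) \<in> N \<Longrightarrow> c \<mu> \<in> N" for k
    proof (induction k)
      case (Suc k)
      have ne: "\<mu> \<noteq> \<nu>" using \<mu> insert.hyps by auto
      have "(?Y \<nu> ^^ k) (c \<mu>) \<in> N"
      proof (rule eigen_shift[where X = X and N = N and \<mu> = \<mu> and \<nu> = \<nu> and m = m])
        show "X ((?Y \<nu> ^^ k) (c \<mu>)) - scale \<nu> ((?Y \<nu> ^^ k) (c \<mu>)) \<in> N" using Suc.prems by simp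
      qed (fact add scl N ne nilG[OF \<mu>])+
      then show ?case by (rule Suc.IH)
    qed simp
    ultimately show ?thesis by blast
  qed
  show ?case
  proof (cases "\<mu> = \<nu>")
    case True
    have "(\<Sum>\<mu>\<in>insert \<nu> G. c \<mu>) - (\<Sum>\<mu>\<in>G. c \<mu>) \<in> N"
      by (rule subspace_diff[OF N(1) insert.prems(2) subspace_sum[OF N(1) cG]])
    then show ?thesis using insert.hyps True by simp
  next
    case False then show ?thesis using cG insert.prems(3) by simp
  qed
qed simp

end

text \<open>The size of a matrix is a number here and not a type, so matrices are indexed by all pairs of
  natural numbers and their support is restricted where it matters. A type of its own makes them
  a vector space, to which the two lemmas above apply.\<close>

typedef cmatrix = "UNIV :: (nat \<Rightarrow> nat \<Rightarrow> complex) set"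
  morphisms entry Cmatrix by simp

setup_lifting type_definition_cmatrix

instantiation cmatrix :: ab_group_add
begin
lift_definition zero_cmatrix :: cmatrix is "\<lambda>_ _. 0" .
lift_definition plus_cmatrix :: "cmatrix \<Rightarrow> cmatrix \<Rightarrow> cmatrix" is "\<lambda>f g i j. f i j + g i j" .
lift_definition minus_cmatrix :: "cmatrix \<Rightarrow> cmatrix \<Rightarrow> cmatrix" is "\<lambda>f g i j. f i j - g i j" .
lift_definition uminus_cmatrix :: "cmatrix \<Rightarrow> cmatrix" is "\<lambda>f i j. - f i j" .
instance by standard (transfer; simp add: algebra_simps)+
end

lift_definition cscale :: "complex \<Rightarrow> cmatrix \<Rightarrow> cmatrix" is "\<lambda>c f i j. c * f i j" .

interpretation cm: vector_space cscale
  by standard (transfer; simp add: algebra_simps)+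

lemmas entry_simps = zero_cmatrix.rep_eq plus_cmatrix.rep_eq minus_cmatrix.rep_eq uminus_cmatrix.rep_eq
  cscale.rep_eq

lemma entry_Cmatrix [simp]: "entry (Cmatrix f) = f"
  by (simp add: Cmatrix_inverse)

lemma cmatrix_eqI: "(\<And>i j. entry A i j = entry B i j) \<Longrightarrow> A = B"
  by (metis entry_inject ext)

lemma entry_sum: "entry (\<Sum>x\<in>H. f x) i j = (\<Sum>x\<in>H. entry (f x) i j)"
  by (induction H rule: infinite_finite_induct) (simp_all add: entry_simps)

text \<open>\<open>B \<mapsto> J B - B J\<close>, for matrices of size \<open>n\<close>.\<close>

definition adJ :: "nat \<Rightarrow> (nat \<Rightarrow> nat \<Rightarrow> complex) \<Rightarrow> cmatrix \<Rightarrow> cmatrix" where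
  "adJ n J B = Cmatrix (\<lambda>i j. \<Sum>k<n. J i k * entry B k j - entry B i k * J k j)"

context
  fixes n :: nat and J :: "nat \<Rightarrow> nat \<Rightarrow> complex" and ev :: "nat \<Rightarrow> complex"
  assumes J: "\<And>i j. J i j \<noteq> 0 \<Longrightarrow> i \<le> j \<and> j < n \<and> ev i = ev j" and diag: "\<And>i. i < n \<Longrightarrow> J i i = ev i"
begin

text \<open>The strictly upper triangular part of \<open>J\<close> moves an entry away from the diagonal, and it links only
  indices with equal \<open>ev\<close>. So on matrices supported where \<open>ev i - ev j = \<mu>\<close> the operator
  \<open>ad J - \<mu>\<close> raises the lowest occupied diagonal by one.\<close>

lemma adJ_shift:
  assumes B: "\<And>i j. entry B i j \<noteq> 0 \<Longrightarrow> i < n \<and> j < n \<and> ev i - ev j = \<mu> \<and> int j - int i \<ge> d"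
    and nz: "entry (adJ n J B - cscale \<mu> B) i j \<noteq> 0"
  shows "i < n \<and> j < n \<and> ev i - ev j = \<mu> \<and> int j - int i \<ge> d + 1"
proof -
  let ?N = "\<lambda>i j. if i = j then 0 else J i j"
  have N: "i < j \<and> j < n \<and> ev i = ev j" if "?N i j \<noteq> 0" for i j using J[of i j] that by (auto split: if_splits)
  have "entry (adJ n J B) i j - \<mu> * entry B i j = (\<Sum>k<n. ?N i k * entry B k j - entry B i k * ?N k j)"
  proof -
    have "(\<Sum>k<n. J i k * entry B k j) = (if i < n then ev i * entry B i j else 0) + (\<Sum>k<n. ?N i k * entry B k j)"
    proof -
      have "(\<Sum>k<n. J i k * entry B k j) = (\<Sum>k<n. (if i = k then ev i * entry B i j else 0) + ?N i k * entry B k j)"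
        by (rule sum.cong) (auto simp: diag)
      then show ?thesis by (simp add: sum.distrib)
    qed
    moreover have "(\<Sum>k<n. entry B i k * J k j) = (if j < n then entry B i j * ev j else 0) + (\<Sum>k<n. entry B i k * ?N k j)"
    proof -
      have "(\<Sum>k<n. entry B i k * J k j) = (\<Sum>k<n. (if j = k then entry B i j * ev j else 0) + entry B i k * ?N k j)"
        by (rule sum.cong) (auto simp: diag)
      then show ?thesis by (simp add: sum.distrib)
    qed
    moreover have "(if i < n then ev i * entry B i j else 0) - (if j < n then entry B i j * ev j else 0) = \<mu> * entry B i j"
      using B[of i j] by (cases "entry B i j = 0") (auto simp: algebra_simps)
    moreover have "entry (adJ n J B) i j = (\<Sum>k<n. J i k * entry B k j) - (\<Sum>k<n. entry B i k * J k j)"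
      by (simp add: adJ_def sum_subtractf)
    moreover have "A = a + s \<Longrightarrow> B' = b + t \<Longrightarrow> a - b = m \<Longrightarrow> E = A - B' \<Longrightarrow> E - m = s - t"
      for A B' E a b s t m :: complex by (simp add: algebra_simps)
    ultimately show ?thesis unfolding sum_subtractf by blast
  qed
  then have "(\<Sum>k<n. ?N i k * entry B k j - entry B i k * ?N k j) \<noteq> 0" using nz by (simp add: entry_simps)
  then obtain k where "k < n" "?N i k * entry B k j - entry B i k * ?N k j \<noteq> 0"
    by (meson lessThan_iff sum.not_neutral_contains_not_neutral)
  then consider "?N i k \<noteq> 0" "entry B k j \<noteq> 0" | "entry B i k \<noteq> 0" "?N k j \<noteq> 0" by fastforce
  then show ?thesis
  proof cases
    case 1 then show ?thesis using N[of i k] B[of k j] by auto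
  next
    case 2 then show ?thesis using N[of k j] B[of i k] by auto
  qed
qed

lemma adJ_nilpotent:
  assumes B: "\<And>i j. entry B i j \<noteq> 0 \<Longrightarrow> i < n \<and> j < n \<and> ev i - ev j = \<mu>"
  shows "((\<lambda>A. adJ n J A - cscale \<mu> A) ^^ (2 * n)) B = 0"
proof -
  let ?Y = "\<lambda>A. adJ n J A - cscale \<mu> A"
  have "entry ((?Y ^^ k) B) i j \<noteq> 0 \<longrightarrow> i < n \<and> j < n \<and> ev i - ev j = \<mu> \<and> int j - int i \<ge> int k - int n" for k i j
  proof (induction k arbitrary: i j)
    case 0 then show ?case using B[of i j] by auto
  next
    case (Suc k)
    show ?case
    proof
      assume "entry ((?Y ^^ Suc k) B) i j \<noteq> 0"
      then have "entry (adJ n J ((?Y ^^ k) B) - cscale \<mu> ((?Y ^^ k) B)) i j \<noteq> 0" by simp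
      from adJ_shift[of "(?Y ^^ k) B" \<mu> "int k - int n", OF _ this] Suc.IH
      show "i < n \<and> j < n \<and> ev i - ev j = \<mu> \<and> int j - int i \<ge> int (Suc k) - int n" by auto
    qed
  qed
  \<comment> \<open>A matrix of size \<open>n\<close> has fewer than \<open>2 * n\<close> diagonals.\<close>
  from this[of "2 * n"] show ?thesis
    by (intro cmatrix_eqI) (fastforce simp: entry_simps)
qed

text \<open>The statement for \<open>ad H\<close>, with \<open>H\<close> the diagonal matrix of the conjugates \<open>cnj (ev i)\<close>: it maps
  \<open>N1\<close> to \<open>N2\<close> if \<open>ad J\<close> does. The component \<open>c \<mu>\<close> of \<open>B\<close> lies in \<open>N1\<close>; if \<open>\<mu> \<noteq> 0\<close>,
  it even lies in \<open>N2\<close>, because \<open>ad J\<close> is invertible on it modulo \<open>N2\<close>; and for \<open>\<mu> = 0\<close> the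
  factor \<open>cnj \<mu>\<close> vanishes.\<close>

lemma conjugate_derivation:
  assumes N2: "cm.subspace N2" "N2 \<subseteq> N1" and N1: "cm.subspace N1"
    and ad: "\<And>B. B \<in> N1 \<Longrightarrow> adJ n J B \<in> N2"
    and supp: "\<And>i j. entry B i j \<noteq> 0 \<Longrightarrow> i < n \<and> j < n" and B: "B \<in> N1"
  shows "Cmatrix (\<lambda>i j. cnj (ev i - ev j) * entry B i j) \<in> N2"
proof -
  let ?G = "(\<lambda>(i, j). ev i - ev j) ` ({..<n} \<times> {..<n})"
  define c where "c \<mu> = Cmatrix (\<lambda>i j. if i < n \<and> j < n \<and> ev i - ev j = \<mu> then entry B i j else 0)" for \<mu>
  have finG: "finite ?G" by simp
  have sum_c: "(\<Sum>\<mu>\<in>?G. cscale (f \<mu>) (c \<mu>)) = Cmatrix (\<lambda>i j. f (ev i - ev j) * entry B i j)" for f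
  proof (rule cmatrix_eqI)
    fix i j
    show "entry (\<Sum>\<mu>\<in>?G. cscale (f \<mu>) (c \<mu>)) i j = entry (Cmatrix (\<lambda>i j. f (ev i - ev j) * entry B i j)) i j"
    proof (cases "i < n \<and> j < n")
      case True
      then have "ev i - ev j \<in> ?G" by auto
      moreover have "entry (\<Sum>\<mu>\<in>?G. cscale (f \<mu>) (c \<mu>)) i j
          = (\<Sum>\<mu>\<in>?G. if ev i - ev j = \<mu> then f (ev i - ev j) * entry B i j else 0)"
        unfolding entry_sum using True by (intro sum.cong) (auto simp: entry_simps c_def)
      ultimately show ?thesis using finG by (simp add: sum.delta')
    next
      case False
      then have "entry B i j = 0" using supp by blast
      then show ?thesis using False by (auto simp: entry_sum entry_simps c_def)
    qed
  qed
  have add: "adJ n J (u + v) = adJ n J u + adJ n J v" and scl: "adJ n J (cscale a u) = cscale a (adJ n J u)" for u v a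
    by (rule cmatrix_eqI; simp add: adJ_def entry_simps algebra_simps sum.distrib sum_subtractf sum_distrib_left)+
  have nil: "((\<lambda>A. adJ n J A - cscale \<mu> A) ^^ (2 * n)) (c \<mu>) = 0" for \<mu>
    by (rule adJ_nilpotent) (auto simp: c_def split: if_splits)
  have "(\<Sum>\<mu>\<in>?G. c \<mu>) = B"
    using sum_c[of "\<lambda>_. 1"] by (simp add: entry_inverse)
  then have c_N1: "c \<mu> \<in> N1" if "\<mu> \<in> ?G" for \<mu>
    using cm.eigen_components[of "adJ n J" N1 ?G "2 * n" c \<mu>, OF add scl N1 _ finG nil _ that] ad N2(2) B by auto
  have c_N2: "cscale (cnj \<mu>) (c \<mu>) \<in> N2" if "\<mu> \<in> ?G" for \<mu>
  proof (cases "\<mu> = 0")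
    case True then show ?thesis using cm.subspace_0[OF N2(1)] by simp
  next
    case False
    have "c \<mu> \<in> N2"
    proof (rule cm.eigen_shift[of "adJ n J" N2 \<mu> 0 "2 * n", OF add scl N2(1) _ False nil])
      show "adJ n J (c \<mu>) - cscale 0 (c \<mu>) \<in> N2" using ad[OF c_N1[OF that]] by simp
    qed (use ad N2(2) in auto)
    then show ?thesis by (rule cm.subspace_scale[OF N2(1)])
  qed
  have "(\<Sum>\<mu>\<in>?G. cscale (cnj \<mu>) (c \<mu>)) \<in> N2" by (rule cm.subspace_sum[OF N2(1) c_N2])
  then show ?thesis by (simp add: sum_c)
qed

end

text \<open>The argument described above, for a representation that is already written in complex matrices
  with \<open>T X0\<close> in Jordan form. The element \<open>S\<close> has the same image as \<open>X0\<close> and is a combination of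
  brackets; in the application it differs from \<open>X0\<close> by an element of the kernel of the representation.\<close>

lemma cartan_eigenvalues_vanish:
  fixes T :: "'l::real_vector \<Rightarrow> cmatrix" and br :: "'l \<Rightarrow> 'l \<Rightarrow> 'l"
  assumes T_add: "\<And>X Y. T (X + Y) = T X + T Y" and T_scale: "\<And>c X. T (c *\<^sub>R X) = cscale (complex_of_real c) (T X)"
    and T_br: "\<And>X Y i j. entry (T (br X Y)) i j = (\<Sum>k<n. entry (T X) i k * entry (T Y) k j - entry (T Y) i k * entry (T X) k j)"
    and T_supp: "\<And>X i j. entry (T X) i j \<noteq> 0 \<Longrightarrow> i < n \<and> j < n"
    and tri: "\<And>i j. entry (T X0) i j \<noteq> 0 \<Longrightarrow> i \<le> j \<and> ev i = ev j" and diag: "\<And>i. i < n \<Longrightarrow> entry (T X0) i i = ev i"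
    and Q2: "subspace Q2" "\<And>Y. br X0 Y \<in> Q2"
    and S: "T S = T X0" "S \<in> span {br U W | U W. U \<in> Q1}"
    and form: "\<And>U A. U \<in> Q1 \<Longrightarrow> A \<in> Q2 \<Longrightarrow> (\<Sum>i<n. \<Sum>k<n. entry (T U) i k * entry (T A) k i) = 0"
  shows "i < n \<Longrightarrow> ev i = 0"
proof -
  let ?J = "entry (T X0)"
  have J: "?J i j \<noteq> 0 \<Longrightarrow> i \<le> j \<and> j < n \<and> ev i = ev j" for i j using tri T_supp by blast
  define N2 where "N2 = cm.span (T ` Q2)"
  define N1 where "N1 = cm.span (range T)"
  have sub: "cm.subspace N1" "cm.subspace N2" by (auto simp: N1_def N2_def)
  have N21: "N2 \<subseteq> N1" unfolding N1_def N2_def by (rule cm.span_mono) auto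
  have T0: "T 0 = 0" using T_add[of 0 0] by simp
  have adJT: "adJ n ?J (T Y) = T (br X0 Y)" for Y
    by (rule cmatrix_eqI) (simp add: adJ_def T_br)
  have adJ_add: "adJ n ?J (u + v) = adJ n ?J u + adJ n ?J v"
    and adJ_scl: "adJ n ?J (cscale a u) = cscale a (adJ n ?J u)" for u v a
    by (rule cmatrix_eqI; simp add: adJ_def entry_simps algebra_simps sum.distrib sum_subtractf sum_distrib_left)+
  have ad: "adJ n ?J B \<in> N2" if "B \<in> N1" for B
  proof -
    have "N1 \<subseteq> {B. adJ n ?J B \<in> N2}"
      unfolding N1_def
    proof (rule cm.span_minimal)
      show "range T \<subseteq> {B. adJ n ?J B \<in> N2}" using Q2(2) by (auto simp: adJT N2_def intro: cm.span_base)
      have "adJ n ?J 0 = 0" using adJ_add[of 0 0] by simp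
      then show "cm.subspace {B. adJ n ?J B \<in> N2}"
        using sub(2) by (auto simp: cm.subspace_def adJ_add adJ_scl)
    qed
    then show ?thesis using that by auto
  qed
  have conj: "Cmatrix (\<lambda>i j. cnj (ev i - ev j) * entry (T W) i j) \<in> N2" for W
    by (rule conjugate_derivation[where n = n and J = ?J and ev = ev, OF J diag sub(2) N21 sub(1) ad T_supp])
      (auto simp: N1_def intro: cm.span_base)
  have pair0: "(\<Sum>i<n. \<Sum>k<n. entry (T U) i k * entry A k i) = 0" if "U \<in> Q1" "A \<in> N2" for U A
  proof -
    have "N2 \<subseteq> {A. (\<Sum>i<n. \<Sum>k<n. entry (T U) i k * entry A k i) = 0}"
      unfolding N2_def
    proof (rule cm.span_minimal)
      show "T ` Q2 \<subseteq> {A. (\<Sum>i<n. \<Sum>k<n. entry (T U) i k * entry A k i) = 0}" using form[OF that(1)] by auto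
      show "cm.subspace {A. (\<Sum>i<n. \<Sum>k<n. entry (T U) i k * entry A k i) = 0}"
        by (auto simp: cm.subspace_def entry_simps algebra_simps sum.distrib simp flip: sum_distrib_left)
    qed
    then show ?thesis using that(2) by auto
  qed
  have "S \<in> {S. (\<Sum>i<n. cnj (ev i) * entry (T S) i i) = 0}"
  proof -
    have "span {br U W | U W. U \<in> Q1} \<subseteq> {S. (\<Sum>i<n. cnj (ev i) * entry (T S) i i) = 0}"
    proof (rule span_minimal)
      show "subspace {S. (\<Sum>i<n. cnj (ev i) * entry (T S) i i) = 0}"
        by (auto simp: subspace_def T0 T_add T_scale entry_simps algebra_simps sum.distrib simp flip: sum_distrib_left)
      show "{br U W | U W. U \<in> Q1} \<subseteq> {S. (\<Sum>i<n. cnj (ev i) * entry (T S) i i) = 0}"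
      proof clarify
        fix U W assume U: "U \<in> Q1"
        let ?u = "entry (T U)" and ?w = "entry (T W)"
        have "(\<Sum>i<n. cnj (ev i) * entry (T (br U W)) i i)
            = (\<Sum>i<n. \<Sum>k<n. cnj (ev i) * (?u i k * ?w k i)) - (\<Sum>i<n. \<Sum>k<n. cnj (ev i) * (?w i k * ?u k i))"
          by (simp add: T_br sum_distrib_left sum_subtractf algebra_simps)
        \<comment> \<open>This is \<open>tr (H [U, W]) = - tr (U [H, W])\<close> in coordinates.\<close>
        also have "(\<Sum>i<n. \<Sum>k<n. cnj (ev i) * (?w i k * ?u k i)) = (\<Sum>i<n. \<Sum>k<n. cnj (ev k) * (?u i k * ?w k i))"
          by (subst sum.swap) (simp add: mult.commute mult.left_commute)
        also have "(\<Sum>i<n. \<Sum>k<n. cnj (ev i) * (?u i k * ?w k i)) - \<dots>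
            = - (\<Sum>i<n. \<Sum>k<n. ?u i k * entry (Cmatrix (\<lambda>i j. cnj (ev i - ev j) * ?w i j)) k i)"
          by (simp add: sum_subtractf[symmetric] sum_negf[symmetric] algebra_simps)
        also have "\<dots> = 0" using pair0[OF U conj] by simp
        finally show "(\<Sum>i<n. cnj (ev i) * entry (T (br U W)) i i) = 0" .
      qed
    qed
    then show ?thesis using S(2) by blast
  qed
  then have "(\<Sum>i<n. cnj (ev i) * ev i) = 0" using S(1) diag by simp
  moreover have "(\<Sum>i<n. cnj (ev i) * ev i) = complex_of_real (\<Sum>i<n. (cmod (ev i))\<^sup>2)"
  proof -
    have "cnj z * z = complex_of_real ((cmod z)\<^sup>2)" for z by (metis complex_norm_square mult.commute)
    then show ?thesis by (simp only: of_real_sum)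
  qed
  ultimately have "(\<Sum>i<n. (cmod (ev i))\<^sup>2) = 0" by (metis of_real_eq_0_iff)
  then show "i < n \<Longrightarrow> ev i = 0" by (simp add: sum_nonneg_eq_0_iff)
qed


text \<open>A nonzero entry of a Jordan matrix is on or above the diagonal and stays within one block, so the
  two diagonal entries in its row and column agree.\<close>

lemma jordan_matrix_entries:
  "i < sum_list (map fst n_as) \<Longrightarrow> j < sum_list (map fst n_as) \<Longrightarrow>
   jordan_matrix n_as $$ (i, j) \<noteq> (0 :: complex) \<Longrightarrow>
   i \<le> j \<and> jordan_matrix n_as $$ (i, i) = jordan_matrix n_as $$ (j, j)"
proof (induction n_as arbitrary: i j)
  case (Cons na n_as)
  obtain m a where na: "na = (m, a)" by (cases na)
  let ?B = "jordan_matrix n_as"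
  have eq: "jordan_matrix (na # n_as) = four_block_mat (jordan_block m a)
      (0\<^sub>m m (sum_list (map fst n_as))) (0\<^sub>m (sum_list (map fst n_as)) m) ?B"
    by (simp add: na jordan_matrix_def Let_def jordan_matrix_dim[unfolded jordan_matrix_def])
  have ij: "i < m + sum_list (map fst n_as)" "j < m + sum_list (map fst n_as)"
    using Cons.prems by (simp_all add: na)
  show ?case
  proof (cases "i < m"; cases "j < m")
    assume "i < m" "j < m"
    then show ?thesis using Cons.prems(3) ij by (auto simp: eq split: if_splits)
  next
    assume "i < m" "\<not> j < m"
    then show ?thesis using Cons.prems(3) ij by (auto simp: eq)
  next
    assume "\<not> i < m" "j < m"
    then show ?thesis using Cons.prems(3) ij by (auto simp: eq)
  next
    assume "\<not> i < m" "\<not> j < m"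
    then have "i - m \<le> j - m \<and> ?B $$ (i - m, i - m) = ?B $$ (j - m, j - m)"
      using Cons.prems(3) ij by (intro Cons.IH) (auto simp: eq)
    then show ?thesis using \<open>\<not> i < m\<close> \<open>\<not> j < m\<close> ij by (simp add: eq) linarith
  qed
qed simp

lemma jordan_triangular_form:
  assumes A: "(A :: complex mat) \<in> carrier_mat n n"
  obtains P Q J where "similar_mat_wit A J P Q"
    "\<And>i j. i < n \<Longrightarrow> j < n \<Longrightarrow> J $$ (i, j) \<noteq> 0 \<Longrightarrow> i \<le> j \<and> J $$ (i, i) = J $$ (j, j)"
proof -
  obtain as where "char_poly A = (\<Prod>a\<leftarrow>as. [:- a, 1:])" using char_poly_factorized[OF A] by blast
  then obtain n_as where "jordan_nf A n_as" using jordan_nf_exists[OF A] by blast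
  then obtain P Q where wit: "similar_mat_wit A (jordan_matrix n_as) P Q"
    by (auto simp: jordan_nf_def similar_mat_def)
  have "jordan_matrix n_as \<in> carrier_mat n n" using similar_mat_witD2(5)[OF A wit] .
  then have "sum_list (map fst n_as) = n" by (metis carrier_matD(1) jordan_matrix_dim(1))
  then show ?thesis using that[OF wit] jordan_matrix_entries[of _ n_as] by blast
qed

lemma strictly_upper_triangular_nilpotent:
  assumes J: "(J :: complex mat) \<in> carrier_mat n n"
    and up: "\<And>i j. i < n \<Longrightarrow> j < n \<Longrightarrow> J $$ (i, j) \<noteq> 0 \<Longrightarrow> i < j"
  shows "J ^\<^sub>m n = 0\<^sub>m n n"
proof -
  have c: "J ^\<^sub>m k \<in> carrier_mat n n" for k using J by (rule pow_carrier_mat)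
  have "i < n \<longrightarrow> j < n \<longrightarrow> (J ^\<^sub>m k) $$ (i, j) \<noteq> 0 \<longrightarrow> i + k \<le> j" for i j k
  proof (induction k arbitrary: j)
    case 0 then show ?case using J by auto
  next
    case (Suc k)
    show ?case
    proof (intro impI)
      assume ij: "i < n" "j < n" and nz: "(J ^\<^sub>m Suc k) $$ (i, j) \<noteq> 0"
      have "(J ^\<^sub>m Suc k) $$ (i, j) = (\<Sum>l\<in>{0..<n}. (J ^\<^sub>m k) $$ (i, l) * J $$ (l, j))"
        using c[of k] J ij by (simp add: scalar_prod_def)
      then obtain l where "l < n" "(J ^\<^sub>m k) $$ (i, l) * J $$ (l, j) \<noteq> 0"
        using nz by (metis (no_types, lifting) atLeastLessThan_iff sum.not_neutral_contains_not_neutral)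
      then show "i + Suc k \<le> j" using Suc.IH[of l] up[of l j] ij by fastforce
    qed
  qed
  then show ?thesis using c[of n] by (intro eq_matI) (fastforce, auto)
qed

definition coord :: "'v::findim_real_vector \<Rightarrow> 'v \<Rightarrow> real" where
  "coord v b = representation findim_basis v b"

lemma coord_add: "coord (v + w) b = coord v b + coord w b"
  and coord_scale: "coord (c *\<^sub>R v) b = c * coord v b"
  by (simp_all add: coord_def representation_add representation_scale findim_basis)

lemma lin_coord: "linear (\<lambda>v. coord v b)"
  by (rule linearI) (simp_all add: coord_add coord_scale)

lemma sum_coord: "(\<Sum>b\<in>findim_basis. coord v b *\<^sub>R b) = v"
proof -
  have "v \<in> span findim_basis" by (simp add: findim_basis(3))
  then show ?thesis
    unfolding coord_def by (rule sum_representation_eq[OF findim_basis(2) _ findim_basis(1) order_refl])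
qed

lemma coord_expand:
  assumes "linear f" shows "coord (f v) b = (\<Sum>c\<in>findim_basis. coord v c * coord (f c) b)"
proof -
  have "coord (f v) b = coord (f (\<Sum>c\<in>findim_basis. coord v c *\<^sub>R c)) b" by (simp only: sum_coord)
  also have "\<dots> = (\<Sum>c\<in>findim_basis. coord v c * coord (f c) b)"
    by (simp add: linear_sum[OF assms] linear_cmul[OF assms] linear_sum[OF lin_coord] coord_scale)
  finally show ?thesis .
qed

definition trace_of :: "('v::findim_real_vector \<Rightarrow> 'v) \<Rightarrow> real" where
  "trace_of f = (\<Sum>b\<in>findim_basis. coord (f b) b)"

lemma trace_of_comp:
  assumes "linear f"
  shows "trace_of (\<lambda>v. f (g v)) = (\<Sum>b\<in>findim_basis. \<Sum>c\<in>findim_basis. coord (f c) b * coord (g b) c)"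
  unfolding trace_of_def
  by (intro sum.cong refl, subst coord_expand[OF assms]) (simp add: mult.commute)

lemma trace_of_commute:
  assumes "linear f" "linear g" shows "trace_of (\<lambda>v. f (g v)) = trace_of (\<lambda>v. g (f v))"
  unfolding trace_of_comp[OF assms(1)] trace_of_comp[OF assms(2)]
  by (subst sum.swap) (simp add: mult.commute)

lemma trace_of_add: "trace_of (\<lambda>v. f v + g v) = trace_of f + trace_of g"
  and trace_of_diff: "trace_of (\<lambda>v. f v - g v) = trace_of f - trace_of g"
  and trace_of_scale: "trace_of (\<lambda>v. c *\<^sub>R f v) = c * trace_of f"
  and trace_of_0: "trace_of (\<lambda>v. 0) = 0"
  by (simp_all add: trace_of_def coord_add coord_scale linear_diff[OF lin_coord] linear_0[OF lin_coord]
      sum.distrib sum_subtractf sum_distrib_left)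

lemma mat_trace_commute:
  assumes "(A :: complex mat) \<in> carrier_mat n n" "B \<in> carrier_mat n n"
  shows "(\<Sum>i<n. (A * B) $$ (i, i)) = (\<Sum>i<n. (B * A) $$ (i, i))"
proof -
  have e: "(\<Sum>i<n. (A * B) $$ (i, i)) = (\<Sum>i<n. \<Sum>k<n. A $$ (i, k) * B $$ (k, i))"
    if "A \<in> carrier_mat n n" "B \<in> carrier_mat n n" for A B :: "complex mat"
    using that by (intro sum.cong refl) (auto simp: scalar_prod_def lessThan_atLeast0)
  show ?thesis unfolding e[OF assms] e[OF assms(2,1)]
    by (subst sum.swap) (simp add: mult.commute)
qed

text \<open>Choose a basis and conjugate the complexified matrices so that the one of \<open>X0\<close> is in Jordan
  form; conjugation preserves products and traces. All eigenvalues vanish, so the Jordan form is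
  strictly upper triangular and its power is zero.\<close>

theorem cartan_nilpotent:
  fixes \<rho> :: "'l::real_vector \<Rightarrow> 'v::findim_real_vector \<Rightarrow> 'v" and br :: "'l \<Rightarrow> 'l \<Rightarrow> 'l"
  assumes bil: "bilinear \<rho>" and rep: "\<And>X Y v. \<rho> (br X Y) v = \<rho> X (\<rho> Y v) - \<rho> Y (\<rho> X v)"
    and Q2: "subspace Q2" "\<And>Y. br X0 Y \<in> Q2"
    and S: "\<And>v. \<rho> S v = \<rho> X0 v" "S \<in> span {br U W | U W. U \<in> Q1}"
    and form: "\<And>U A. U \<in> Q1 \<Longrightarrow> A \<in> Q2 \<Longrightarrow> trace_of (\<lambda>v. \<rho> U (\<rho> A v)) = 0"
  shows "\<exists>k. \<forall>v. (\<rho> X0 ^^ k) v = 0"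
proof -
  let ?B = "findim_basis :: 'v set"
  obtain n and b :: "nat \<Rightarrow> 'v" where b: "bij_betw b {..<n} ?B"
    using ex_bij_betw_nat_finite[OF findim_basis(1)] by (auto simp: lessThan_atLeast0)
  have sum_b: "(\<Sum>c\<in>?B. h c) = (\<Sum>i<n. h (b i))" for h :: "'v \<Rightarrow> 'c::comm_monoid_add"
    using sum.reindex_bij_betw[OF b, of h] by simp
  have lin: "linear (\<rho> X)" for X using bil by (simp add: bilinear_def)
  define mx :: "('v \<Rightarrow> 'v) \<Rightarrow> complex mat" where
    "mx f = mat n n (\<lambda>(i, j). complex_of_real (coord (f (b j)) (b i)))" for f
  have mx_c: "mx f \<in> carrier_mat n n" for f by (simp add: mx_def)
  have mx_comp: "mx (\<lambda>v. f (g v)) = mx f * mx g" if "linear f" for f g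
  proof -
    have "coord (f (g (b j))) (b i) = (\<Sum>k = 0..<n. coord (f (b k)) (b i) * coord (g (b j)) (b k))" for i j
      by (subst coord_expand[OF that]) (simp add: sum_b lessThan_atLeast0 mult.commute)
    then show ?thesis by (intro eq_matI) (auto simp: mx_def scalar_prod_def)
  qed
  obtain P Q J where wit: "similar_mat_wit (mx (\<rho> X0)) J P Q"
    and J: "\<And>i j. i < n \<Longrightarrow> j < n \<Longrightarrow> J $$ (i, j) \<noteq> 0 \<Longrightarrow> i \<le> j \<and> J $$ (i, i) = J $$ (j, j)"
    using jordan_triangular_form[OF mx_c] by metis
  note PQ = similar_mat_witD2[OF mx_c wit]
  \<comment> \<open>Conjugation by the change of basis that brings \<open>\<rho> X0\<close> into Jordan form.\<close>
  define K where "K F = Q * F * P" for F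
  have K_c: "K F \<in> carrier_mat n n" if "F \<in> carrier_mat n n" for F
    using that PQ by (auto simp: K_def)
  have K_mult: "K (F * G) = K F * K G" if F: "F \<in> carrier_mat n n" and G: "G \<in> carrier_mat n n" for F G
  proof -
    have "K F * K G = Q * F * (P * (Q * G * P))"
      unfolding K_def using F G PQ by (intro assoc_mult_mat) auto
    also have "P * (Q * G * P) = G * P"
      using assoc_mult_mat[of Q n n G n P n] assoc_mult_mat[of P n n Q n "G * P" n] G PQ(1,6,7) by simp
    also have "Q * F * (G * P) = K (F * G)"
      unfolding K_def using F G PQ by (simp add: assoc_mult_mat[of _ n n _ n _ n])
    finally show ?thesis by simp
  qed
  have K_J: "K (mx (\<rho> X0)) = J"
  proof -
    have "K (mx (\<rho> X0)) = (Q * P) * J * (Q * P)"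
      unfolding K_def PQ(3) using PQ(5-7) by (simp add: assoc_mult_mat[of _ n n _ n _ n])
    then show ?thesis using PQ by simp
  qed
  define T where "T X = Cmatrix (\<lambda>i j. if i < n \<and> j < n then K (mx (\<rho> X)) $$ (i, j) else 0)" for X
  have K_entry: "K F $$ (i, j) = (\<Sum>k<n. Q $$ (i, k) * (\<Sum>l<n. F $$ (k, l) * P $$ (l, j)))"
    if "F \<in> carrier_mat n n" "i < n" "j < n" for F i j
    using that PQ by (simp add: K_def scalar_prod_def lessThan_atLeast0)
  have mx_entry: "mx f $$ (i, j) = complex_of_real (coord (f (b j)) (b i))" if "i < n" "j < n" for f i j
    using that by (simp add: mx_def)
  have T_add: "T (X + Y) = T X + T Y" for X Y
    by (rule cmatrix_eqI)
      (simp add: T_def entry_simps K_entry[OF mx_c] mx_entry bilinear_ladd[OF bil] coord_add algebra_simps sum.distrib)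
  have T_scale: "T (c *\<^sub>R X) = cscale (complex_of_real c) (T X)" for c X
    by (rule cmatrix_eqI)
      (simp add: T_def entry_simps K_entry[OF mx_c] mx_entry bilinear_lmul[OF bil] coord_scale
        sum_distrib_left sum_distrib_right mult.commute mult.left_commute)
  have T_prod: "(\<Sum>k<n. entry (T X) i k * entry (T Y) k j)
      = K (mx (\<lambda>v. \<rho> X (\<rho> Y v))) $$ (i, j)" if "i < n" "j < n" for X Y i j
    unfolding mx_comp[OF lin[of X], of "\<rho> Y"] K_mult[OF mx_c mx_c]
    using that K_c[OF mx_c[of "\<rho> X"]] K_c[OF mx_c[of "\<rho> Y"]]
    by (simp add: T_def scalar_prod_def lessThan_atLeast0)
  have T_br: "entry (T (br X Y)) i j = (\<Sum>k<n. entry (T X) i k * entry (T Y) k j - entry (T Y) i k * entry (T X) k j)"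
    for X Y i j
  proof (cases "i < n \<and> j < n")
    case True
    have "K (mx (\<rho> (br X Y))) $$ (i, j) = K (mx (\<lambda>v. \<rho> X (\<rho> Y v))) $$ (i, j) - K (mx (\<lambda>v. \<rho> Y (\<rho> X v))) $$ (i, j)"
      using True by (simp add: K_entry[OF mx_c] mx_entry rep linear_diff[OF lin_coord] algebra_simps sum_subtractf)
    then show ?thesis using True by (simp add: sum_subtractf T_prod) (simp add: T_def)
  next
    case False then show ?thesis by (auto simp: T_def)
  qed
  have trace: "(\<Sum>i<n. \<Sum>k<n. entry (T U) i k * entry (T A) k i) = 0" if "U \<in> Q1" "A \<in> Q2" for U A
  proof -
    let ?F = "mx (\<lambda>v. \<rho> U (\<rho> A v))"
    have "(\<Sum>i<n. \<Sum>k<n. entry (T U) i k * entry (T A) k i) = (\<Sum>i<n. K ?F $$ (i, i))"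
      by (intro sum.cong refl) (simp add: T_prod)
    also have "\<dots> = (\<Sum>i<n. (P * (Q * ?F)) $$ (i, i))"
      unfolding K_def using PQ mx_c by (intro mat_trace_commute) auto
    also have "P * (Q * ?F) = ?F"
      using PQ mx_c[of "\<lambda>v. \<rho> U (\<rho> A v)"] assoc_mult_mat[of P n n Q n ?F n] by simp
    also have "(\<Sum>i<n. ?F $$ (i, i)) = complex_of_real (trace_of (\<lambda>v. \<rho> U (\<rho> A v)))"
      by (simp add: trace_of_def sum_b mx_entry)
    also have "\<dots> = 0" using form[OF that] by simp
    finally show ?thesis .
  qed
  have TJ: "entry (T X0) i j = (if i < n \<and> j < n then J $$ (i, j) else 0)" for i j
    by (simp add: T_def K_J)
  have "J $$ (i, i) = 0" if "i < n" for i
  proof (rule cartan_eigenvalues_vanish[where T = T and n = n and br = br and ?X0.0 = X0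
        and ev = "\<lambda>i. J $$ (i, i)" and ?Q2.0 = Q2 and S = S and ?Q1.0 = Q1, OF T_add T_scale T_br])
    show "T S = T X0" by (rule cmatrix_eqI) (simp add: T_def K_entry[OF mx_c] mx_entry S(1))
    show "entry (T X0) i j \<noteq> 0 \<Longrightarrow> i \<le> j \<and> J $$ (i, i) = J $$ (j, j)" for i j
      using J[of i j] by (simp add: TJ split: if_splits)
    show "entry (T X) i j \<noteq> 0 \<Longrightarrow> i < n \<and> j < n" for X i j by (simp add: T_def split: if_splits)
  qed (use Q2 S(2) trace that in \<open>auto simp: TJ\<close>)
  then have "i < j" if "i < n" "j < n" "J $$ (i, j) \<noteq> 0" for i j
    using J[OF that] that by (cases "i = j") auto
  then have J0: "J ^\<^sub>m n = 0\<^sub>m n n" using strictly_upper_triangular_nilpotent[OF PQ(5)] by blast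
  have "mx (\<rho> X0) ^\<^sub>m n = 0\<^sub>m n n"
    using similar_mat_wit_pow_id[OF wit, of n] PQ by (simp add: J0)
  moreover have "mx (\<rho> X0 ^^ k) = mx (\<rho> X0) ^\<^sub>m k" for k
  proof (induction k)
    case 0
    have "coord (b j) (b i) = (if i = j then 1 else 0)" if "i < n" "j < n" for i j
    proof -
      have "b j \<in> ?B" using b that by (auto simp: bij_betw_def)
      then have "coord (b j) (b i) = (if b j = b i then 1 else 0)"
        by (simp add: coord_def representation_basis[OF findim_basis(2)])
      moreover have "b j = b i \<longleftrightarrow> i = j" using b that by (auto simp: bij_betw_def inj_on_def)
      ultimately show ?thesis by simp
    qed
    then show ?case by (intro eq_matI) (auto simp: mx_def)
  next
    case (Suc k)
    have "mx (\<rho> X0 ^^ Suc k) = mx (\<lambda>v. (\<rho> X0 ^^ k) (\<rho> X0 v))"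
      by (simp add: funpow_Suc_right o_def del: funpow.simps)
    moreover have "linear (\<rho> X0 ^^ k)"
      by (induction k) (simp_all add: linear_id[unfolded id_def] linear_compose[OF _ lin, unfolded o_def] o_def id_def)
    ultimately show ?case using Suc mx_comp[of "\<rho> X0 ^^ k" "\<rho> X0"] by (simp del: funpow.simps)
  qed
  ultimately have "mx (\<rho> X0 ^^ n) = 0\<^sub>m n n" by simp
  then have z: "coord ((\<rho> X0 ^^ n) (b j)) (b i) = 0" if "i < n" "j < n" for i j
    using mx_entry[OF that, of "\<rho> X0 ^^ n"] that by simp
  have linp: "linear (\<rho> X0 ^^ n)"
    by (induction n) (simp_all add: linear_id[unfolded id_def] linear_compose[OF _ lin, unfolded o_def] o_def id_def)
  have "(\<rho> X0 ^^ n) v = 0" for v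
  proof -
    have "coord ((\<rho> X0 ^^ n) v) (b i) = 0" if "i < n" for i
      using that by (simp add: coord_expand[OF linp, of v] sum_b z)
    then have "(\<Sum>c\<in>?B. coord ((\<rho> X0 ^^ n) v) c *\<^sub>R c) = 0" by (simp add: sum_b)
    then show ?thesis by (simp only: sum_coord)
  qed
  then show ?thesis by blast
qed

section \<open>Semi-simple representations are trivial on the radical of the adjoint module\<close>

text \<open>Let \<open>P\<close> be an ideal contained in every ideal \<open>I\<close> for which \<open>L / I\<close> is a semi-simple module.
  If \<open>P\<close> does not act trivially in a semi-simple representation, there is an ideal \<open>Q\<close> minimal among the
  ideals above the kernel inside \<open>P + ker\<close>. Either the trace form is nondegenerate on \<open>Q / ker\<close>; then
  the orthogonal complement of \<open>Q\<close> has a semi-simple quotient but does not contain \<open>P\<close>. Or the trace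
  form vanishes on \<open>Q\<close>; then \<open>Q\<close> consists of nilpotent operators by Cartan's criterion, and
  Engel's theorem makes \<open>Q\<close> act trivially.\<close>

locale representation =
  fixes br :: "'l::findim_real_vector \<Rightarrow> 'l \<Rightarrow> 'l" and \<rho> :: "'l \<Rightarrow> 'v::findim_real_vector \<Rightarrow> 'v"
  assumes bil_br: "bilinear br" and br_same: "br X X = 0"
    and jacobi: "br X (br Y Z) + br Y (br Z X) + br Z (br X Y) = 0"
    and bil_rho: "bilinear \<rho>" and rho_br: "\<rho> (br X Y) v = \<rho> X (\<rho> Y v) - \<rho> Y (\<rho> X v)"
begin

lemma br_antisym: "br Y X = - br X Y"
proof -
  have "br (X + Y) (X + Y) = br X Y + br Y X"
    unfolding bilinear_ladd[OF bil_br] bilinear_radd[OF bil_br] by (simp add: br_same)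
  then have "br X Y + br Y X = 0" by (simp add: br_same)
  then show ?thesis by (simp add: eq_neg_iff_add_eq_0 add.commute)
qed

lemma lin_rho: "linear (\<rho> X)" using bil_rho by (simp add: bilinear_def)

lemma lin_br: "\<forall>X. linear (br X)" using bil_br by (simp add: bilinear_def)

lemmas rho_simps = bilinear_ladd[OF bil_rho] bilinear_radd[OF bil_rho] bilinear_lmul[OF bil_rho]
  bilinear_rmul[OF bil_rho] bilinear_lneg[OF bil_rho] bilinear_rneg[OF bil_rho]
  bilinear_lzero[OF bil_rho] bilinear_rzero[OF bil_rho] bilinear_lsub[OF bil_rho] bilinear_rsub[OF bil_rho]
lemmas br_simps = bilinear_ladd[OF bil_br] bilinear_radd[OF bil_br] bilinear_lmul[OF bil_br]
  bilinear_rmul[OF bil_br] bilinear_lneg[OF bil_br] bilinear_rneg[OF bil_br]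
  bilinear_lzero[OF bil_br] bilinear_rzero[OF bil_br] bilinear_lsub[OF bil_br] bilinear_rsub[OF bil_br]

text \<open>The ascending filtration whose graded pieces are killed by \<open>M\<close>; it reaches the whole space exactly
  if products of sufficiently many operators from \<open>M\<close> vanish.\<close>

primrec ann :: "'l set \<Rightarrow> nat \<Rightarrow> 'v set" where
  "ann M 0 = {0}"
| "ann M (Suc i) = {v. \<forall>X\<in>M. \<rho> X v \<in> ann M i}"

lemma subspace_ann: "subspace (ann M i)"
  by (induction i) (auto simp: subspace_def rho_simps)

lemma ann_Suc_mono: "ann M i \<subseteq> ann M (Suc i)"
proof (induction i)
  case 0 then show ?case by (auto simp: rho_simps)
next
  case (Suc i) then show ?case by fastforce
qed

lemma ann_mono: "i \<le> j \<Longrightarrow> ann M i \<subseteq> ann M j"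
  by (rule lift_Suc_mono_le[of "ann M"]) (rule ann_Suc_mono)

definition ker :: "'l set" where "ker = {X. \<forall>v. \<rho> X v = 0}"

lemma submodule_ker: "submodule br ker"
proof -
  have "br X Y \<in> ker" if "Y \<in> ker" for X Y using that by (simp add: ker_def rho_br rho_simps)
  then show ?thesis by (auto simp: submodule_def subspace_def ker_def rho_simps)
qed

text \<open>An operator has degree at least \<open>d\<close> if it maps \<open>ann M i\<close> into \<open>ann M (i - d)\<close>. Brackets with
  elements of \<open>M\<close> raise the degree by one, all operators have degree at least \<open>- k\<close>, and
  those of degree \<open>k\<close> are zero. If no element normalised \<open>M\<close>, then \<open>w0\<close> could be bracketed with
  elements of \<open>M\<close> forever without entering \<open>M\<close>; but after \<open>2 * k\<close> brackets it acts as zero, and the kernel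
  is inside \<open>M\<close>.\<close>

lemma normalizing_element:
  assumes M: "ann M k = UNIV" "ker \<inter> N \<subseteq> M"
    and N: "\<And>X Y. X \<in> M \<Longrightarrow> Y \<in> N \<Longrightarrow> br X Y \<in> N" and w0: "w0 \<in> N" "w0 \<notin> M"
  shows "\<exists>w\<in>N. w \<notin> M \<and> (\<forall>X\<in>M. br X w \<in> M)"
proof (rule ccontr)
  assume no: "\<not> (\<exists>w\<in>N. w \<notin> M \<and> (\<forall>X\<in>M. br X w \<in> M))"
  have step: "\<exists>X\<in>M. br X w \<notin> M" if "w \<in> N" "w \<notin> M" for w using no that by blast
  \<comment> \<open>Integer indices, so that degrees may be negative; below 0 the filtration is zero.\<close>
  let ?V = "\<lambda>i::int. ann M (nat i)"
  have V_step: "\<rho> X v \<in> ?V (i - 1)" if "X \<in> M" "v \<in> ?V i" for X v i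
  proof (cases "i \<le> 0")
    case True then show ?thesis using that(2) by (simp add: rho_simps)
  next
    case False
    then have "nat i = Suc (nat (i - 1))" by simp
    then show ?thesis using that by simp
  qed
  have "\<exists>w\<in>N. w \<notin> M \<and> (\<forall>i v. v \<in> ?V i \<longrightarrow> \<rho> w v \<in> ?V (i - (int m - int k)))" for m
  proof (induction m)
    case 0
    have "\<rho> w0 v \<in> ?V (i - (int 0 - int k))" if "v \<in> ?V i" for i v
    proof (cases "i \<le> 0")
      case True then show ?thesis using that subspace_0[OF subspace_ann] by (simp add: rho_simps)
    next
      case False
      then have "k \<le> nat (i + int k)" by simp
      then show ?thesis using ann_mono[of k "nat (i + int k)" M] M(1) by auto
    qed
    then show ?case using w0 by blast
  next
    case (Suc m)
    then obtain w where w: "w \<in> N" "w \<notin> M" and deg: "\<And>i v. v \<in> ?V i \<Longrightarrow> \<rho> w v \<in> ?V (i - (int m - int k))"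
      by blast
    obtain X where X: "X \<in> M" "br X w \<notin> M" using step[OF w] by blast
    have "\<rho> (br X w) v \<in> ?V (i - (int (Suc m) - int k))" if v: "v \<in> ?V i" for i v
    proof -
      have "\<rho> X (\<rho> w v) \<in> ?V (i - (int m - int k) - 1)" by (rule V_step[OF X(1) deg[OF v]])
      moreover have "\<rho> w (\<rho> X v) \<in> ?V (i - 1 - (int m - int k))" by (rule deg[OF V_step[OF X(1) v]])
      moreover have "i - (int m - int k) - 1 = i - (int (Suc m) - int k)"
        "i - 1 - (int m - int k) = i - (int (Suc m) - int k)" by auto
      ultimately show ?thesis unfolding rho_br by (metis subspace_diff subspace_ann)
    qed
    then show ?case using X N[OF X(1) w(1)] by blast
  qed
  from this[of "2 * k"] obtain w where w: "w \<in> N" "w \<notin> M"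
    and deg: "\<And>i v. v \<in> ?V i \<Longrightarrow> \<rho> w v \<in> ?V (i - (int (2 * k) - int k))" by blast
  have "\<rho> w v = 0" for v using deg[of v "int k"] M(1) by simp
  then have "w \<in> ker \<inter> N" using w by (simp add: ker_def)
  then show False using M(2) w(2) by blast
qed

text \<open>The operator \<open>w\<close> normalises \<open>M\<close>, so it preserves every \<open>ann M i\<close>; being nilpotent of order \<open>r\<close>, it
  refines each step of the filtration into \<open>r\<close> steps.\<close>

lemma ann_extend:
  assumes M: "ann M k = UNIV" and w: "\<And>X. X \<in> M \<Longrightarrow> br X w \<in> M" and nil: "\<And>v. (\<rho> w ^^ r) v = 0"
    and M': "\<And>X. X \<in> M' \<Longrightarrow> \<exists>Y\<in>M. \<exists>c. X = Y + c *\<^sub>R w"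
  shows "\<exists>k. ann M' k = UNIV"
proof -
  have stable: "v \<in> ann M i \<Longrightarrow> \<rho> w v \<in> ann M i" for i v
  proof (induction i arbitrary: v)
    case 0 then show ?case by (simp add: rho_simps)
  next
    case (Suc i)
    have "\<rho> X (\<rho> w v) \<in> ann M i" if X: "X \<in> M" for X
    proof -
      have "\<rho> X (\<rho> w v) = \<rho> w (\<rho> X v) + \<rho> (br X w) v" by (simp add: rho_br)
      moreover have "\<rho> w (\<rho> X v) \<in> ann M i" using Suc X by simp
      moreover have "\<rho> (br X w) v \<in> ann M i" using Suc.prems w[OF X] by simp
      ultimately show ?thesis using subspace_add[OF subspace_ann] by simp
    qed
    then show ?case by simp
  qed
  have incl: "ann M i \<subseteq> ann M' (i * r)" for i
  proof (induction i)
    case 0 then show ?case by simp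
  next
    case (Suc i)
    have "v \<in> ann M (Suc i) \<Longrightarrow> (\<rho> w ^^ j) v \<in> ann M i \<Longrightarrow> v \<in> ann M' (i * r + j)" for j v
    proof (induction j arbitrary: v)
      case 0 then show ?case using \<open>ann M i \<subseteq> ann M' (i * r)\<close> by auto
    next
      case (Suc j)
      have "\<rho> X v \<in> ann M' (i * r + j)" if "X \<in> M'" for X
      proof -
        from M'[OF that] obtain Y c where Y: "Y \<in> M" "X = Y + c *\<^sub>R w" by blast
        have "\<rho> Y v \<in> ann M i" using Suc.prems(1) Y(1) by simp
        then have 1: "\<rho> Y v \<in> ann M' (i * r + j)"
          using \<open>ann M i \<subseteq> ann M' (i * r)\<close> ann_mono[of "i * r" "i * r + j" M'] by auto
        have "(\<rho> w ^^ j) (\<rho> w v) \<in> ann M i" using Suc.prems(2) by (simp add: funpow_swap1)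
        then have 2: "\<rho> w v \<in> ann M' (i * r + j)" by (rule Suc.IH[OF stable[OF Suc.prems(1)]])
        show ?thesis unfolding Y(2) bilinear_ladd[OF bil_rho] bilinear_lmul[OF bil_rho]
          by (rule subspace_add[OF subspace_ann 1 subspace_scale[OF subspace_ann 2]])
      qed
      then show ?case by simp
    qed
    from this[of _ r] show ?case using nil subspace_0[OF subspace_ann] by (auto simp: add.commute)
  qed
  then have "ann M' (k * r) = UNIV" using M incl[of k] by auto
  then show ?thesis by blast
qed

text \<open>A maximal subalgebra \<open>M\<close> of \<open>N\<close> with a finite filtration equals \<open>N\<close>: otherwise
  \<open>normalizing_element\<close> supplies a vector by which \<open>M\<close> can be enlarged. Maximality is taken above
  \<open>ker \<inter> N\<close>, so that operators rather than Lie algebra elements count.\<close>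

theorem engel:
  assumes N: "subspace N" "\<And>X Y. X \<in> N \<Longrightarrow> Y \<in> N \<Longrightarrow> br X Y \<in> N"
    and nil: "\<And>X. X \<in> N \<Longrightarrow> \<exists>r. \<forall>v. (\<rho> X ^^ r) v = 0"
  shows "\<exists>k. ann N k = UNIV"
proof -
  let ?P = "\<lambda>M. subspace M \<and> M \<subseteq> N \<and> ker \<inter> N \<subseteq> M \<and> (\<forall>X\<in>M. \<forall>Y\<in>M. br X Y \<in> M) \<and> (\<exists>k. ann M k = UNIV)"
  have "ann (ker \<inter> N) (Suc 0) = UNIV" by (auto simp: ker_def)
  moreover have "\<forall>X\<in>ker \<inter> N. \<forall>Y\<in>ker \<inter> N. br X Y \<in> ker \<inter> N"
    using submodule_ker N(2) by (auto simp: submodule_def)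
  moreover have "subspace (ker \<inter> N)" using submodule_ker N(1) by (simp add: submodule_def subspace_inter)
  ultimately have "?P (ker \<inter> N)" by blast
  moreover have "\<forall>y. ?P y \<longrightarrow> dim y < Suc (dim (UNIV :: 'l set))"
    by (metis findim.dim_subset less_Suc_eq_le subset_UNIV)
  ultimately have "\<exists>M. ?P M \<and> (\<forall>M'. ?P M' \<longrightarrow> dim M' \<le> dim M)"
    by (rule ex_has_greatest_nat)
  then obtain M where PM: "?P M" and max: "\<And>M'. ?P M' \<Longrightarrow> dim M' \<le> dim M" by auto
  have subM: "subspace M" and MN: "M \<subseteq> N" and kerM: "ker \<inter> N \<subseteq> M"
    and brM: "\<And>X Y. X \<in> M \<Longrightarrow> Y \<in> M \<Longrightarrow> br X Y \<in> M"
    using PM by simp_all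
  obtain k where k: "ann M k = UNIV" using PM by auto
  show ?thesis
  proof (cases "M = N")
    case True then show ?thesis using k by auto
  next
    case False
    then obtain w0 where w0: "w0 \<in> N" "w0 \<notin> M" using MN by auto
    have "\<exists>w\<in>N. w \<notin> M \<and> (\<forall>X\<in>M. br X w \<in> M)"
    proof (rule normalizing_element[OF k _ _ w0])
      show "ker \<inter> N \<subseteq> M" by (rule kerM)
      show "br X Y \<in> N" if "X \<in> M" "Y \<in> N" for X Y using N(2) MN that by blast
    qed
    then obtain w where w: "w \<in> N" "w \<notin> M" "\<And>X. X \<in> M \<Longrightarrow> br X w \<in> M" by blast
    obtain r where r: "\<And>v. (\<rho> w ^^ r) v = 0" using nil[OF w(1)] by blast
    let ?M' = "{Y + c *\<^sub>R w | Y c. Y \<in> M}"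
    have M'I: "Y + c *\<^sub>R w \<in> ?M'" if "Y \<in> M" for Y c using that by blast
    have sub: "subspace ?M'"
      unfolding subspace_def
    proof (intro conjI ballI allI)
      show "0 \<in> ?M'" using M'I[OF subspace_0[OF subM], of 0] by simp
      fix x y and a :: real assume "x \<in> ?M'"
      then obtain Y c where x: "x = Y + c *\<^sub>R w" "Y \<in> M" by blast
      have ax: "a *\<^sub>R x = a *\<^sub>R Y + (a * c) *\<^sub>R w" by (simp add: x scaleR_right_distrib)
      show "a *\<^sub>R x \<in> ?M'" unfolding ax by (rule M'I[OF subspace_scale[OF subM x(2)]])
      assume "y \<in> ?M'"
      then obtain Y' c' where y: "y = Y' + c' *\<^sub>R w" "Y' \<in> M" by blast
      have xy: "x + y = (Y + Y') + (c + c') *\<^sub>R w" by (simp add: x y scaleR_left_distrib)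
      show "x + y \<in> ?M'" unfolding xy by (rule M'I[OF subspace_add[OF subM x(2) y(2)]])
    qed
    have MM': "M \<subseteq> ?M'" using M'I[of _ 0] by auto
    have "w \<in> ?M'" using M'I[OF subspace_0[OF subM], of 1] by simp
    then have "M \<subset> ?M'" using MM' w(2) by blast
    then have dim: "dim M < dim ?M'" by (rule dim_less_of_psubset[OF subM sub])
    have "br x y \<in> M" if "x \<in> ?M'" "y \<in> ?M'" for x y
    proof -
      obtain Y c where x: "x = Y + c *\<^sub>R w" "Y \<in> M" using \<open>x \<in> ?M'\<close> by blast
      obtain Y' c' where y: "y = Y' + c' *\<^sub>R w" "Y' \<in> M" using \<open>y \<in> ?M'\<close> by blast
      have "br x y = br Y Y' + c' *\<^sub>R br Y w + c *\<^sub>R (- br Y' w)"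
        by (simp add: x y br_simps br_same br_antisym[of Y' w] algebra_simps)
      moreover have "br Y Y' \<in> M" by (rule brM[OF x(2) y(2)])
      moreover have "- br Y' w \<in> M" by (rule subspace_neg[OF subM w(3)[OF y(2)]])
      ultimately show ?thesis
        using w(3)[OF x(2)] by (simp only: subspace_add[OF subM] subspace_scale[OF subM])
    qed
    then have cl: "\<forall>X\<in>?M'. \<forall>Y\<in>?M'. br X Y \<in> ?M'" using MM' by blast
    have "?M' \<subseteq> N"
    proof
      fix x assume "x \<in> ?M'"
      then obtain Y c where x: "x = Y + c *\<^sub>R w" "Y \<in> M" by blast
      then have "Y \<in> N" using MN by blast
      then show "x \<in> N" unfolding x(1) by (rule subspace_add[OF N(1) _ subspace_scale[OF N(1) w(1)]])
    qed
    moreover have "\<exists>k. ann ?M' k = UNIV" by (rule ann_extend[OF k w(3) r]) auto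
    moreover have "ker \<inter> N \<subseteq> ?M'" using kerM MM' by (rule order_trans)
    ultimately have "?P ?M'" using sub cl by (intro conjI)
    then show ?thesis using max[of ?M'] dim by simp
  qed
qed

abbreviation tf :: "'l \<Rightarrow> 'l \<Rightarrow> real" where
  "tf X Y \<equiv> trace_of (\<lambda>v. \<rho> X (\<rho> Y v))"

lemma bil_tf: "bilinear tf"
  unfolding bilinear_def
  by (intro conjI allI linearI) (simp_all add: rho_simps trace_of_add trace_of_scale)

lemma tf_sym: "tf X Y = tf Y X"
  by (rule trace_of_commute[OF lin_rho lin_rho])

text \<open>Cyclic invariance of the trace.\<close>

lemma tf_inv: "tf (br X Y) Z = - tf Y (br X Z)"
proof -
  have "linear (\<lambda>v. \<rho> Y (\<rho> Z v))" using linear_compose[OF lin_rho lin_rho] by (simp add: o_def)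
  then have "trace_of (\<lambda>v. \<rho> X (\<rho> Y (\<rho> Z v))) = trace_of (\<lambda>v. \<rho> Y (\<rho> Z (\<rho> X v)))"
    using trace_of_commute[OF lin_rho, of "\<lambda>v. \<rho> Y (\<rho> Z v)" X] by simp
  then show ?thesis by (simp add: rho_br rho_simps trace_of_diff)
qed

text \<open>The vectors killed by \<open>Q\<close> form a submodule because \<open>Q\<close> is an ideal. On a complement the filtration
  would have to start again, so the complement is zero.\<close>

lemma nilpotent_ideal_trivial:
  assumes ss: "semisimple \<rho> UNIV" and Q: "submodule br Q" and k: "ann Q k = UNIV"
  shows "Q \<subseteq> ker"
proof -
  let ?K = "ann Q (Suc 0)"
  have subK: "submodule \<rho> ?K"
  proof -
    have "\<rho> Y (\<rho> X v) = 0" if v: "\<forall>Y\<in>Q. \<rho> Y v = 0" and Y: "Y \<in> Q" for X Y v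
    proof -
      have "br X Y \<in> Q" using Q Y by (simp add: submodule_def)
      then have "\<rho> (br X Y) v = 0" using v by blast
      then show ?thesis using v Y by (simp add: rho_br rho_simps)
    qed
    then show ?thesis using subspace_ann[of Q "Suc 0"] by (auto simp: submodule_def)
  qed
  have "{0} \<subseteq> ?K" using subspace_0[OF subspace_ann[of Q "Suc 0"]] by blast
  then obtain C where C: "submodule \<rho> C" "{0} \<subseteq> C" "C \<subseteq> UNIV" "?K \<inter> C = {0}" "ssum ?K C = UNIV"
    by (rule complement_submodule[OF ss[unfolded semisimple_def] subK _ subset_UNIV])
  have "C \<inter> ann Q i \<subseteq> {0}" for i
  proof (induction i)
    case (Suc i)
    show ?case
    proof
      fix v assume v: "v \<in> C \<inter> ann Q (Suc i)"
      have "\<rho> X v \<in> C \<inter> ann Q i" if "X \<in> Q" for X using v that C(1) by (simp add: submodule_def)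
      then have "v \<in> ?K" using Suc by auto
      then show "v \<in> {0}" using v C(4) by blast
    qed
  qed simp
  then have "C \<subseteq> {0}" using k by (metis Int_UNIV_right)
  then have "C \<subseteq> ?K" using subspace_0[OF subspace_ann[of Q "Suc 0"]] by blast
  then have "ssum ?K C \<subseteq> ?K" by (rule ssum_least[OF subspace_ann order_refl])
  then have "?K = UNIV" using C(5) by blast
  then show ?thesis by (auto simp: ker_def)
qed

text \<open>By minimality \<open>Q\<close> meets its orthogonal complement for the trace form either in the kernel or in
  all of \<open>Q\<close>.\<close>

lemma minimal_ideal_not_in_radical:
  assumes ss: "semisimple \<rho> UNIV"
    and Q: "submodule br Q" "ker \<subset> Q" and min: "\<And>I. submodule br I \<Longrightarrow> ker \<subseteq> I \<Longrightarrow> I \<subseteq> Q \<Longrightarrow> I = ker \<or> I = Q"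
    and P: "Q \<subseteq> P"
    and rad: "\<And>I. submodule br I \<Longrightarrow> ker \<subseteq> I \<Longrightarrow> semisimple_quotient br UNIV I \<Longrightarrow> P \<subseteq> I"
  shows False
proof -
  have inv: "\<forall>X Y Z. tf (br X Y) Z = - tf Y (br X Z)" using tf_inv by blast
  let ?O = "perp tf Q"
  have O: "submodule br ?O" by (rule submodule_perp[OF bil_tf inv Q(1)])
  have sub: "subspace Q" "subspace ?O" "subspace ker" using Q O submodule_ker by (auto simp: submodule_def)
  have kerO: "ker \<subseteq> ?O"
    by (auto simp: perp_def ker_def rho_simps trace_of_0)
  consider "Q \<inter> ?O = ker" | "Q \<subseteq> ?O"
    using min[OF submodule_Int[OF Q(1) O]] kerO Q(2) by blast
  then show False
  proof cases
    case 1
    \<comment> \<open>A linear complement stands in for \<open>Q / ker\<close>, on which the trace form is nondegenerate.\<close>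
    obtain Q' where Q': "subspace Q'" "Q' \<subseteq> Q" "ker \<inter> Q' = {0}" "ssum ker Q' = Q"
      using subspace_complement[OF sub(3,1)] Q(2) by blast
    have kk: "tf X Y = 0" if "Y \<in> ker" for X Y using that by (simp add: ker_def rho_simps trace_of_0)
    have nd: "nondegenerate_on tf Q'"
      unfolding nondegenerate_on_def
    proof (intro ballI impI)
      fix x assume x: "x \<in> Q'" "\<forall>y\<in>Q'. tf x y = 0"
      have "tf y x = 0" if "y \<in> Q" for y
      proof -
        have "y \<in> ssum ker Q'" using that Q'(4) by simp
        then obtain a b where "y = a + b" "a \<in> ker" "b \<in> Q'" by (rule ssumE)
        then show ?thesis using x(2) kk[of a x] by (simp add: bilinear_ladd[OF bil_tf] tf_sym[of _ x])
      qed
      then have "x \<in> Q \<inter> ?O" using x(1) Q'(2) by (auto simp: perp_def)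
      then show "x = 0" using 1 x(1) Q'(3) by blast
    qed
    have "ssum Q ?O = UNIV"
    proof -
      have "X \<in> ssum Q ?O" for X
      proof -
        have "linear (tf X)" using bil_tf by (simp add: bilinear_def)
        then obtain q where q: "q \<in> Q'" "\<forall>y\<in>Q'. tf q y = tf X y"
          using form_represents_on[OF bil_tf Q'(1) nd] by blast
        have "tf y (X - q) = 0" if "y \<in> Q" for y
        proof -
          have "y \<in> ssum ker Q'" using that Q'(4) by simp
          then obtain a b where ab: "y = a + b" "a \<in> ker" "b \<in> Q'" by (rule ssumE)
          then show ?thesis using q(2) kk[of a]
            by (simp add: bilinear_ladd[OF bil_tf] bilinear_rsub[OF bil_tf] tf_sym[of a] tf_sym[of b])
        qed
        then have "X - q \<in> ?O" by (auto simp: perp_def)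
        then have "q + (X - q) \<in> ssum Q ?O" using q(1) Q'(2) by (intro ssumI) auto
        then show ?thesis by simp
      qed
      then show ?thesis by auto
    qed
    moreover have "semisimple_quotient br Q (Q \<inter> ?O)"
      unfolding 1 semisimple_quotient_iff
    proof (intro allI impI, elim conjE)
      fix U assume U: "submodule br U" "ker \<subseteq> U" "U \<subseteq> Q"
      have kQ: "ker \<subseteq> Q" using Q(2) by blast
      consider "U = ker" | "U = Q" using min[OF U] by blast
      then show "\<exists>U'. submodule br U' \<and> ker \<subseteq> U' \<and> U' \<subseteq> Q \<and> U \<inter> U' = ker \<and> ssum U U' = Q"
      proof cases
        case 1
        have "ssum ker Q = Q"
          using ssum_least[OF sub(1) kQ order_refl] ssum_upper2[OF sub(3), of Q] by blast
        then show ?thesis using Q(1) kQ 1 by (intro exI[of _ Q]) auto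
      next
        case 2
        have "ssum Q ker = Q"
          using ssum_least[OF sub(1) order_refl kQ] ssum_upper1[OF sub(3), of Q] by blast
        then show ?thesis using submodule_ker kQ 2 by (intro exI[of _ ker]) auto
      qed
    qed
    ultimately have "semisimple_quotient br UNIV ?O"
      using semisimple_quotient_second_iso[OF lin_br Q(1) O] by simp
    then have "P \<subseteq> ?O" by (rule rad[OF O kerO])
    then show False using P 1 Q(2) by blast
  next
    case 2
    have tQ: "tf U A = 0" if "U \<in> Q" "A \<in> Q" for U A using 2 that by (auto simp: perp_def)
    \<comment> \<open>Cartan's criterion needs the elements of \<open>Q\<close> as combinations of brackets, up to the kernel.
      If \<open>[Q, L]\<close> is all of \<open>Q\<close> modulo the kernel, these are brackets with \<open>Q\<close>. Otherwise \<open>Q\<close> is central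
      modulo the kernel; the quotient by \<open>[L, L]\<close> is a trivial module, hence semi-simple, so that
      \<open>P\<close> lies in \<open>[L, L] + ker\<close>.\<close>
    let ?D0 = "span {br U W | U W. U \<in> Q}"
    have spanD: "br X Y \<in> ?D0" if "X \<in> Q" for X Y using that by (auto intro: span_base)
    have D0Q: "?D0 \<subseteq> Q"
    proof (rule span_minimal[OF _ sub(1)])
      show "{br U W | U W. U \<in> Q} \<subseteq> Q"
      proof clarify
        fix U W assume "U \<in> Q"
        then have "- br W U \<in> Q" using Q(1) sub(1) by (simp add: submodule_def subspace_neg)
        then show "br U W \<in> Q" by (simp add: br_antisym[of W U])
      qed
    qed
    have D0: "submodule br ?D0"
    proof -
      have "br X Y \<in> ?D0" if "Y \<in> ?D0" for X Y
      proof -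
        have "Y \<in> Q" using that D0Q by blast
        then have "- br Y X \<in> ?D0" by (intro subspace_neg[OF subspace_span] spanD)
        then show ?thesis by (simp add: br_antisym[of X Y])
      qed
      then show ?thesis by (simp add: submodule_def)
    qed
    have D: "submodule br (ssum ?D0 ker)" by (rule submodule_ssum[OF lin_br D0 submodule_ker])
    have kQ: "ker \<subseteq> Q" using Q(2) by blast
    have "ssum ?D0 ker \<subseteq> Q" by (rule ssum_least[OF sub(1) D0Q kQ])
    then consider "ssum ?D0 ker = ker" | "ssum ?D0 ker = Q"
      using min[OF D ssum_upper2[OF subspace_span]] by blast
    then have nil: "\<exists>k. \<forall>v. (\<rho> X ^^ k) v = 0" if X: "X \<in> Q" for X
    proof cases
      case 1
      have XD: "br X Y \<in> ker" for Y
        using spanD[OF X, of Y] ssum_upper1[OF sub(3), of ?D0] 1 by blast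
      let ?L = "span {br U W | U W. U \<in> (UNIV :: 'l set)}"
      have L: "br X Y \<in> ?L" for X Y by (auto intro: span_base)
      have subL: "submodule br ?L" using L by (simp add: submodule_def)
      have "semisimple_quotient br UNIV (ssum ?L ker)"
      proof (rule semisimple_quotient_trivial)
        show "subspace (ssum ?L ker)" by (rule subspace_ssum[OF subspace_span sub(3)])
        show "br X v \<in> ssum ?L ker" for X v using L ssum_upper1[OF sub(3), of ?L] by blast
      qed auto
      then have "P \<subseteq> ssum ?L ker"
        by (rule rad[OF submodule_ssum[OF lin_br subL submodule_ker] ssum_upper2[OF subspace_span]])
      then have "X \<in> ssum ?L ker" using X P by blast
      then obtain S a where Sa: "X = S + a" "S \<in> ?L" "a \<in> ker" by (rule ssumE)
      show ?thesis
      proof (rule cartan_nilpotent[OF bil_rho rho_br sub(3) XD _ Sa(2)])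
        show "\<rho> S v = \<rho> X v" for v using Sa(3) by (simp add: Sa(1) ker_def rho_simps)
        show "tf U A = 0" if "A \<in> ker" for U A using that by (simp add: ker_def rho_simps trace_of_0)
      qed
    next
      case 2
      have "X \<in> ssum ?D0 ker" using X 2 by simp
      then obtain S a where Sa: "X = S + a" "S \<in> ?D0" "a \<in> ker" by (rule ssumE)
      show ?thesis
      proof (rule cartan_nilpotent[OF bil_rho rho_br sub(1) _ _ Sa(2) tQ])
        show "br X Y \<in> Q" for Y using spanD[OF X] D0Q by blast
        show "\<rho> S v = \<rho> X v" for v using Sa(3) by (simp add: Sa(1) ker_def rho_simps)
      qed
    qed
    have "\<exists>k. ann Q k = UNIV"
      by (rule engel[OF sub(1) _ nil]) (use Q(1) in \<open>auto simp: submodule_def\<close>)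
    then show False using nilpotent_ideal_trivial[OF ss Q(1)] Q(2) by blast
  qed
qed

theorem semisimple_trivial_on_radical:
  assumes ss: "semisimple \<rho> UNIV" and P: "submodule br P"
    and rad: "\<And>I. submodule br I \<Longrightarrow> semisimple_quotient br UNIV I \<Longrightarrow> P \<subseteq> I"
  shows "P \<subseteq> ker"
proof (rule ccontr)
  assume nP: "\<not> P \<subseteq> ker"
  let ?P = "ssum P ker"
  have sub: "subspace P" "subspace ker" using P submodule_ker by (auto simp: submodule_def)
  let ?Ok = "\<lambda>Q. submodule br Q \<and> ker \<subset> Q \<and> Q \<subseteq> ?P"
  have "?Ok ?P"
    using submodule_ssum[OF lin_br P submodule_ker] ssum_upper1[OF sub(2), of P] ssum_upper2[OF sub(1), of ker] nP
    by blast
  then obtain Q where Q: "?Ok Q" and least: "\<And>Q'. ?Ok Q' \<Longrightarrow> dim Q \<le> dim Q'"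
    using ex_has_least_nat[of ?Ok ?P dim] by blast
  show False
  proof (rule minimal_ideal_not_in_radical[OF ss, of Q ?P])
    show "I = ker \<or> I = Q" if I: "submodule br I" "ker \<subseteq> I" "I \<subseteq> Q" for I
    proof (rule ccontr)
      assume "\<not> (I = ker \<or> I = Q)"
      then have "?Ok I" "I \<subset> Q" using I Q by auto
      then show False using least[of I] dim_less_of_psubset[of I Q] Q by (auto simp: submodule_def)
    qed
    show "?P \<subseteq> I" if "submodule br I" "ker \<subseteq> I" "semisimple_quotient br UNIV I" for I
      using rad[OF that(1,3)] that by (intro ssum_least) (auto simp: submodule_def)
  qed (use Q in auto)
qed

end

section \<open>The standard model\<close>

lemmas bilinear_expand = bilinear_ladd bilinear_radd bilinear_lmul bilinear_rmul bilinear_lneg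
  bilinear_rneg bilinear_lzero bilinear_rzero bilinear_lsub bilinear_rsub

lemmas linear_expand = linear_add linear_cmul linear_neg linear_0 linear_diff

lemmas dual_expand = zero_dual.rep_eq plus_dual.rep_eq minus_dual.rep_eq uminus_dual.rep_eq scaleR_dual.rep_eq

locale lie_module =
  fixes L :: "'l::findim_real_vector inv_lie"
    and M :: "('l, 'a::findim_real_vector) orth_mod"
  assumes lie: "lie_algebra_with_involution L" and om: "orthogonal_module L M"
begin

abbreviation "br \<equiv> brac L"
abbreviation "\<rho> \<equiv> rho M"
abbreviation "sp \<equiv> pairing M"
abbreviation "\<theta> \<equiv> theta L"
abbreviation "\<theta>a \<equiv> mtheta M"

lemma bil_br: "bilinear br" and br_same: "br X X = 0"
  and br_jacobi: "br X (br Y Z) + br Y (br Z X) + br Z (br X Y) = 0"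
  and lin_theta: "linear \<theta>" and theta_theta: "\<theta> (\<theta> X) = X"
  and theta_br: "\<theta> (br X Y) = br (\<theta> X) (\<theta> Y)"
  using lie by (auto simp: lie_algebra_with_involution_def)

lemma bil_rho: "bilinear \<rho>" and rho_br: "\<rho> (br X Y) A = \<rho> X (\<rho> Y A) - \<rho> Y (\<rho> X A)"
  and sp: "scalar_product sp" and sp_inv: "sp (\<rho> X A) B = - sp A (\<rho> X B)"
  and lin_mtheta: "linear \<theta>a" and mtheta_mtheta: "\<theta>a (\<theta>a A) = A"
  and sp_mtheta: "sp (\<theta>a A) (\<theta>a B) = sp A B"
  using om by (auto simp: orthogonal_module_def)

lemma mtheta_rho: "\<theta>a (\<rho> X A) = \<rho> (\<theta> X) (\<theta>a A)"
proof -
  have "\<theta>a (\<rho> (\<theta> (\<theta> X)) A) = \<rho> (\<theta> X) (\<theta>a A)" using om by (simp add: orthogonal_module_def)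
  then show ?thesis by (simp add: theta_theta)
qed

lemma bil_sp: "bilinear sp" and sp_sym: "sp A B = sp B A" and sp_nondeg: "nondegenerate_on sp UNIV"
  using sp by (auto simp: scalar_product_def)

lemma sp_eqI: "(\<And>B. sp A B = sp A' B) \<Longrightarrow> A = A'"
  using sp_nondeg bilinear_lsub[OF bil_sp, of A A']
  by (metis UNIV_I eq_iff_diff_eq_0 nondegenerate_on_def)

lemmas br_expand = bilinear_expand[OF bil_br]
lemmas rho_expand = bilinear_expand[OF bil_rho]
lemmas sp_expand = bilinear_expand[OF bil_sp]
lemmas theta_expand = linear_expand[OF lin_theta]
lemmas mtheta_expand = linear_expand[OF lin_mtheta]
lemmas dual_apply_expand = linear_expand[OF linear_dual_apply]

lemma br_antisym: "br Y X = - br X Y"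
proof -
  have "br (X + Y) (X + Y) = br X Y + br Y X"
    unfolding bilinear_ladd[OF bil_br] bilinear_radd[OF bil_br] by (simp add: br_same)
  then have "br X Y + br Y X = 0" by (simp add: br_same)
  then show ?thesis by (simp add: eq_neg_iff_add_eq_0 add.commute)
qed

end

lemma alternating_antisym:
  assumes "bilinear f" "\<forall>X. f X X = 0"
  shows "f Y X = - f X Y"
proof -
  have "f (X + Y) (X + Y) = f X Y + f Y X"
    unfolding bilinear_ladd[OF assms(1)] bilinear_radd[OF assms(1)] using assms(2) by simp
  then have "f X Y + f Y X = 0" using assms(2) by simp
  then show ?thesis by (simp add: eq_neg_iff_add_eq_0 add.commute)
qed

text \<open>The standard model is defined for all cochains; its scalar product and involution, the alternation
  and the invariance of its bracket hold in this generality, and so does the comparison of standard models by shears. The cocycle equations, added in the next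
  locale, are the Jacobi identity.\<close>

locale quad_cochain = lie_module L M
  for L :: "'l::findim_real_vector inv_lie" and M :: "('l, 'a::findim_real_vector) orth_mod" +
  fixes \<alpha> :: "'l \<Rightarrow> 'l \<Rightarrow> 'a" and \<gamma> :: "'l \<Rightarrow> 'l \<Rightarrow> 'l \<Rightarrow> real"
  assumes alpha: "\<alpha> \<in> cochain2_plus (theta L) (mtheta M)"
    and gamma: "\<gamma> \<in> cochain3_plus (theta L) id"
begin

abbreviation "D \<equiv> standard_model L M (\<alpha>, \<gamma>)"

lemma bil_alpha: "bilinear \<alpha>" and alpha_same: "\<alpha> X X = 0"
  and alpha_theta: "\<alpha> (\<theta> X) (\<theta> Y) = \<theta>a (\<alpha> X Y)"
proof -
  show "bilinear \<alpha>" "\<alpha> X X = 0" using alpha by (auto simp: cochain2_plus_def cochain2_def)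
  have "\<theta>a (\<alpha> (\<theta> X) (\<theta> Y)) = \<alpha> X Y" using alpha by (auto simp: cochain2_plus_def)
  then show "\<alpha> (\<theta> X) (\<theta> Y) = \<theta>a (\<alpha> X Y)" using mtheta_mtheta by metis
qed

lemma lin_gamma: "linear (\<lambda>Z. \<gamma> X Y Z)" "linear (\<lambda>Y. \<gamma> X Y Z)" "linear (\<lambda>X. \<gamma> X Y Z)"
  and gamma_same: "\<gamma> X X Y = 0" "\<gamma> X Y X = 0" "\<gamma> Y X X = 0"
  and gamma_theta: "\<gamma> (\<theta> X) (\<theta> Y) (\<theta> Z) = \<gamma> X Y Z"
  using gamma by (auto simp: cochain3_plus_def cochain3_def)

lemmas alpha_expand = bilinear_expand[OF bil_alpha]
lemmas gamma_expand = linear_expand[OF lin_gamma(1)] linear_expand[OF lin_gamma(2)] linear_expand[OF lin_gamma(3)]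
lemmas expand = br_expand rho_expand sp_expand alpha_expand gamma_expand dual_apply_expand dual_expand

lemma alpha_antisym: "\<alpha> Y X = - \<alpha> X Y"
  using alternating_antisym[OF bil_alpha] alpha_same by blast

lemma gamma_antisym: "\<gamma> Y X Z = - \<gamma> X Y Z" "\<gamma> X Z Y = - \<gamma> X Y Z"
proof -
  have "\<gamma> (X + Y) (X + Y) Z = \<gamma> X Y Z + \<gamma> Y X Z" "\<gamma> X (Y + Z) (Y + Z) = \<gamma> X Y Z + \<gamma> X Z Y"
    unfolding linear_add[OF lin_gamma(1)] linear_add[OF lin_gamma(2)] linear_add[OF lin_gamma(3)]
    by (simp_all add: gamma_same)
  then show "\<gamma> Y X Z = - \<gamma> X Y Z" "\<gamma> X Z Y = - \<gamma> X Y Z"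
    by (simp_all add: gamma_same)
qed

lemma gamma_rotate: "\<gamma> X Y Z = \<gamma> Y Z X"
  by (simp add: gamma_antisym(1)[of X Y] gamma_antisym(2)[of Y X Z])

lemma lin_bracket_dual:
  "linear (\<lambda>X. \<gamma> L1 L2 X - sp A2 (\<alpha> L1 X) + sp A1 (\<alpha> L2 X)
     - dual_apply Z2 (br L1 X) + dual_apply Z1 (br L2 X) + sp (\<rho> X A1) A2)"
  by (rule linearI) (simp_all add: expand algebra_simps)

lemma D_brac:
  "brac D (Z1, A1, L1) (Z2, A2, L2) =
     (Dual (\<lambda>X. \<gamma> L1 L2 X - sp A2 (\<alpha> L1 X) + sp A1 (\<alpha> L2 X)
         - dual_apply Z2 (br L1 X) + dual_apply Z1 (br L2 X) + sp (\<rho> X A1) A2),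
      \<alpha> L1 L2 + \<rho> L1 A2 - \<rho> L2 A1, br L1 L2)"
  by (simp add: standard_model_def)

lemma D_brac_fst:
  "dual_apply (fst (brac D (Z1, A1, L1) (Z2, A2, L2))) X = \<gamma> L1 L2 X - sp A2 (\<alpha> L1 X) + sp A1 (\<alpha> L2 X)
         - dual_apply Z2 (br L1 X) + dual_apply Z1 (br L2 X) + sp (\<rho> X A1) A2"
  by (simp add: D_brac dual_apply_Dual[OF lin_bracket_dual])

text \<open>The components of the bracket for arguments that are not split into triples; simplification with
  this form works on single variables.\<close>

lemma D_brac_proj:
  "dual_apply (fst (brac D u v)) X = \<gamma> (snd (snd u)) (snd (snd v)) X
      - sp (fst (snd v)) (\<alpha> (snd (snd u)) X) + sp (fst (snd u)) (\<alpha> (snd (snd v)) X)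
      - dual_apply (fst v) (br (snd (snd u)) X) + dual_apply (fst u) (br (snd (snd v)) X)
      + sp (\<rho> X (fst (snd u))) (fst (snd v))"
  "fst (snd (brac D u v)) = \<alpha> (snd (snd u)) (snd (snd v)) + \<rho> (snd (snd u)) (fst (snd v))
      - \<rho> (snd (snd v)) (fst (snd u))"
  "snd (snd (brac D u v)) = br (snd (snd u)) (snd (snd v))"
proof -
  obtain Z1 A1 L1 where u: "u = (Z1, A1, L1)" by (rule prod_cases3)
  obtain Z2 A2 L2 where v: "v = (Z2, A2, L2)" by (rule prod_cases3)
  show "dual_apply (fst (brac D u v)) X = \<gamma> (snd (snd u)) (snd (snd v)) X
      - sp (fst (snd v)) (\<alpha> (snd (snd u)) X) + sp (fst (snd u)) (\<alpha> (snd (snd v)) X)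
      - dual_apply (fst v) (br (snd (snd u)) X) + dual_apply (fst u) (br (snd (snd v)) X)
      + sp (\<rho> X (fst (snd u))) (fst (snd v))"
    by (simp only: u v D_brac_fst fst_conv snd_conv)
  show "fst (snd (brac D u v)) = \<alpha> (snd (snd u)) (snd (snd v)) + \<rho> (snd (snd u)) (fst (snd v))
      - \<rho> (snd (snd v)) (fst (snd u))"
    "snd (snd (brac D u v)) = br (snd (snd u)) (snd (snd v))"
    by (simp_all only: u v D_brac fst_conv snd_conv)
qed

lemma D_form: "form D (Z1, A1, L1) (Z2, A2, L2) = sp A1 A2 + dual_apply Z1 L2 + dual_apply Z2 L1"
  by (simp add: standard_model_def)

lemma D_theta: "theta D (Z, A, X) = (Dual (\<lambda>Y. dual_apply Z (\<theta> Y)), \<theta>a A, \<theta> X)"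
  by (simp add: standard_model_def)

lemma lin_theta_dual: "linear (\<lambda>Y. dual_apply Z (\<theta> Y))"
  using linear_compose[OF lin_theta linear_dual_apply[of Z]] by (simp add: o_def)

lemma D_theta_fst: "dual_apply (fst (theta D (Z, A, X))) Y = dual_apply Z (\<theta> Y)"
  by (simp add: D_theta dual_apply_Dual[OF lin_theta_dual])

lemma D_theta_proj:
  "dual_apply (fst (theta D u)) Y = dual_apply (fst u) (\<theta> Y)"
  "fst (snd (theta D u)) = \<theta>a (fst (snd u))" "snd (snd (theta D u)) = \<theta> (snd (snd u))"
proof -
  obtain Z A X where u: "u = (Z, A, X)" by (rule prod_cases3)
  show "dual_apply (fst (theta D u)) Y = dual_apply (fst u) (\<theta> Y)"
    by (simp only: u D_theta_fst fst_conv)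
  show "fst (snd (theta D u)) = \<theta>a (fst (snd u))" "snd (snd (theta D u)) = \<theta> (snd (snd u))"
    by (simp_all only: u D_theta fst_conv snd_conv)
qed

lemma D_eqI:
  assumes "\<And>X. dual_apply (fst u) X = dual_apply (fst v) X" "fst (snd u) = fst (snd v)" "snd (snd u) = snd (snd v)"
  shows "u = (v :: 'l dual \<times> 'a \<times> 'l)"
proof -
  have "fst u = fst v" by (rule dual_eqI) (rule assms(1))
  then show ?thesis using assms(2,3) by (simp add: prod_eq_iff)
qed

lemma D_brac_snd [simp]:
  "snd (brac D (Z1, A1, L1) (Z2, A2, L2)) = (\<alpha> L1 L2 + \<rho> L1 A2 - \<rho> L2 A1, br L1 L2)"
  by (simp add: D_brac)

lemma D_theta_snd [simp]: "snd (theta D (Z, A, X)) = (\<theta>a A, \<theta> X)"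
  by (simp add: D_theta)

lemma bil_D_brac: "bilinear (brac D)"
  unfolding bilinear_def
proof (intro conjI allI linearI)
  fix x y z :: "'l dual \<times> 'a \<times> 'l" and c
  obtain Z1 A1 L1 Z2 A2 L2 Z3 A3 L3 where xyz: "x = (Z1, A1, L1)" "y = (Z2, A2, L2)" "z = (Z3, A3, L3)"
    by (metis prod.exhaust)
  show "brac D z (x + y) = brac D z x + brac D z y" "brac D (x + y) z = brac D x z + brac D y z"
    "brac D z (c *\<^sub>R x) = c *\<^sub>R brac D z x" "brac D (c *\<^sub>R x) z = c *\<^sub>R brac D x z"
    by (rule D_eqI; simp add: xyz D_brac_fst expand algebra_simps)+
qed

lemma D_brac_same: "brac D x x = 0"
proof -
  obtain Z A X where x: "x = (Z, A, X)" by (metis prod.exhaust)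
  have "sp (\<rho> Y A) A = 0" for Y using sp_inv[of Y A A] sp_sym[of A "\<rho> Y A"] by simp
  then show ?thesis
    by (intro D_eqI) (simp_all add: x D_brac_fst zero_dual.rep_eq gamma_same alpha_same br_same)
qed

lemma lin_D_brac: "\<forall>x. linear (brac D x)"
  using bil_D_brac by (simp add: bilinear_def)

lemma bil_D_form: "bilinear (form D)"
  unfolding bilinear_def
proof (intro conjI allI linearI)
  fix x y z :: "'l dual \<times> 'a \<times> 'l" and c
  obtain Z1 A1 L1 Z2 A2 L2 Z3 A3 L3 where xyz: "x = (Z1, A1, L1)" "y = (Z2, A2, L2)" "z = (Z3, A3, L3)"
    by (metis prod.exhaust)
  show "form D z (x + y) = form D z x + form D z y" "form D (x + y) z = form D x z + form D y z"
    "form D z (c *\<^sub>R x) = c *\<^sub>R form D z x" "form D (c *\<^sub>R x) z = c *\<^sub>R form D x z"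
    by (simp_all add: xyz D_form expand algebra_simps)
qed

lemma dual_nonzero_witness:
  assumes "X \<noteq> 0"
  obtains Z :: "'l dual" where "dual_apply Z X = 1"
proof -
  have "subspace {0 :: 'l}" "X \<notin> {0}" using assms by (auto simp: subspace_single_0)
  then obtain f where "linear (f :: 'l \<Rightarrow> real)" "f X = 1"
    using separating_functional[of "{0}" X] by blast
  then show ?thesis using that[of "Dual f"] by (simp add: dual_apply_Dual)
qed

lemma sp_D_form: "scalar_product (form D)"
  unfolding scalar_product_def nondegenerate_on_def
proof (intro conjI allI ballI impI bil_D_form)
  fix x y :: "'l dual \<times> 'a \<times> 'l"
  obtain Z1 A1 L1 where x: "x = (Z1, A1, L1)" by (metis prod.exhaust)
  obtain Z2 A2 L2 where y: "y = (Z2, A2, L2)" by (metis prod.exhaust)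
  show "form D x y = form D y x" by (simp add: x y D_form sp_sym[of A1])
  assume *: "\<forall>y\<in>UNIV. form D x y = 0"
  have "L1 = 0"
  proof (rule ccontr)
    assume "L1 \<noteq> 0"
    then obtain Z :: "'l dual" where "dual_apply Z L1 = 1" by (rule dual_nonzero_witness)
    then show False using *[THEN bspec[of _ _ "(Z, 0, 0)"]]
      by (simp add: x D_form expand)
  qed
  moreover have "A1 = 0"
  proof (rule sp_eqI)
    fix B show "sp A1 B = sp 0 B"
      using *[THEN bspec[of _ _ "(0, B, 0)"]] by (simp add: x D_form expand)
  qed
  moreover have "Z1 = 0"
  proof (rule dual_eqI)
    fix Y show "dual_apply Z1 Y = dual_apply 0 Y"
      using *[THEN bspec[of _ _ "(0, 0, Y)"]] by (simp add: x D_form expand)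
  qed
  ultimately show "x = 0" by (simp add: x zero_prod_def)
qed

lemma D_form_invariant: "form D (brac D x y) z = - form D y (brac D x z)"
proof -
  obtain Z1 A1 L1 Z2 A2 L2 Z3 A3 L3 where xyz: "x = (Z1, A1, L1)" "y = (Z2, A2, L2)" "z = (Z3, A3, L3)"
    by (metis prod.exhaust)
  have f: "form D u v = sp (fst (snd u)) (fst (snd v)) + dual_apply (fst u) (snd (snd v)) +
      dual_apply (fst v) (snd (snd u))" for u v
    by (cases u; cases v) (auto simp: D_form)
  have "sp (\<rho> L3 A1) A2 = - sp A1 (\<rho> L3 A2)" "sp (\<rho> L1 A2) A3 = - sp A2 (\<rho> L1 A3)"
     "sp (\<rho> L2 A1) A3 = - sp A1 (\<rho> L2 A3)" "sp A2 (\<rho> L3 A1) = - sp A1 (\<rho> L3 A2)"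
    using sp_inv sp_sym by metis+
  then show ?thesis
    using gamma_antisym(2)[of L1 L3 L2] sp_sym[of "\<alpha> L1 L2" A3] alpha_antisym[of L3 L2]
      br_antisym[of L3 L2]
    by (simp add: xyz f D_brac_fst expand)
qed

lemma lin_D_theta: "linear (theta D)"
proof (rule linearI)
  fix x y :: "'l dual \<times> 'a \<times> 'l" and c
  obtain Z1 A1 L1 Z2 A2 L2 where xy: "x = (Z1, A1, L1)" "y = (Z2, A2, L2)"
    by (metis prod.exhaust)
  show "theta D (x + y) = theta D x + theta D y" "theta D (c *\<^sub>R x) = c *\<^sub>R theta D x"
    by (rule D_eqI; simp add: xy D_theta_fst dual_expand theta_expand mtheta_expand)+
qed

lemma D_theta_theta: "theta D (theta D x) = x"
  by (rule D_eqI) (simp_all add: D_theta_proj theta_theta mtheta_mtheta)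

lemma D_theta_brac: "theta D (brac D x y) = brac D (theta D x) (theta D y)"
proof (rule D_eqI)
  fix W
  have g: "\<gamma> X Y (\<theta> W) = \<gamma> (\<theta> X) (\<theta> Y) W" for X Y
    using gamma_theta[of X Y "\<theta> W"] by (simp add: theta_theta)
  have a: "sp A (\<alpha> X (\<theta> W)) = sp (\<theta>a A) (\<alpha> (\<theta> X) W)" for A X
  proof -
    have "\<alpha> (\<theta> X) W = \<theta>a (\<alpha> X (\<theta> W))" using alpha_theta[of X "\<theta> W"] by (simp add: theta_theta)
    then show ?thesis by (simp add: sp_mtheta)
  qed
  have r: "sp (\<rho> (\<theta> W) A) B = sp (\<rho> W (\<theta>a A)) (\<theta>a B)" for A B
  proof -
    have "\<rho> W (\<theta>a A) = \<theta>a (\<rho> (\<theta> W) A)" by (simp add: mtheta_rho theta_theta)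
    then show ?thesis by (simp add: sp_mtheta)
  qed
  have b: "br X (\<theta> W) = \<theta> (br (\<theta> X) W)" for X
    by (simp add: theta_br theta_theta)
  show "dual_apply (fst (theta D (brac D x y))) W = dual_apply (fst (brac D (theta D x) (theta D y))) W"
    by (simp only: D_theta_proj D_brac_proj g a r b)
qed (simp_all only: D_theta_proj D_brac_proj linear_add[OF lin_mtheta] linear_diff[OF lin_mtheta]
      alpha_theta mtheta_rho theta_br)

lemma D_form_proj: "form D u v = sp (fst (snd u)) (fst (snd v)) + dual_apply (fst u) (snd (snd v)) +
    dual_apply (fst v) (snd (snd u))"
  by (cases u; cases v) (simp add: D_form)

lemma D_form_theta: "form D (theta D x) (theta D y) = form D x y"
  by (simp only: D_form_proj D_theta_proj theta_theta sp_mtheta)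

end

locale quad_cocycle = quad_cochain +
  assumes d_alpha: "d2 (brac L) (rho M) \<alpha> = (\<lambda>X Y Z. 0)"
    and d_gamma: "d3 (brac L) (\<lambda>_ _. 0) \<gamma> = (\<lambda>X Y Z W. 1/2 * wedge22 (pairing M) \<alpha> \<alpha> X Y Z W)"
begin

lemma alpha_closed:
  "\<rho> X (\<alpha> Y Z) - \<rho> Y (\<alpha> X Z) + \<rho> Z (\<alpha> X Y) - \<alpha> (br X Y) Z + \<alpha> (br X Z) Y - \<alpha> (br Y Z) X = 0"
  using fun_cong[OF fun_cong[OF fun_cong[OF d_alpha]], of X Y Z] by (simp add: d2_def)

text \<open>The dual component of the Jacobi identity for three elements of the Lie algebra:
  \<open>d \<gamma> = 1/2 \<langle>\<alpha> \<and> \<alpha>\<rangle>\<close>, evaluated.\<close>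

lemma jacobi_gamma:
  "\<gamma> X1 (br X2 X3) W - \<gamma> X2 X3 (br X1 W) - sp (\<alpha> X2 X3) (\<alpha> X1 W) +
   (\<gamma> X2 (br X3 X1) W - \<gamma> X3 X1 (br X2 W) - sp (\<alpha> X3 X1) (\<alpha> X2 W)) +
   (\<gamma> X3 (br X1 X2) W - \<gamma> X1 X2 (br X3 W) - sp (\<alpha> X1 X2) (\<alpha> X3 W)) = 0"
proof -
  have "- \<gamma> (br X1 X2) X3 W + \<gamma> (br X1 X3) X2 W - \<gamma> (br X1 W) X2 X3
      - \<gamma> (br X2 X3) X1 W + \<gamma> (br X2 W) X1 X3 - \<gamma> (br X3 W) X1 X2
    = sp (\<alpha> X1 X2) (\<alpha> X3 W) - sp (\<alpha> X1 X3) (\<alpha> X2 W) + sp (\<alpha> X1 W) (\<alpha> X2 X3)"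
    using fun_cong[OF fun_cong[OF fun_cong[OF fun_cong[OF d_gamma]]], of X1 X2 X3 W]
      sp_sym[of "\<alpha> X2 X3" "\<alpha> X1 W"] sp_sym[of "\<alpha> X2 W" "\<alpha> X1 X3"] sp_sym[of "\<alpha> X3 W" "\<alpha> X1 X2"]
    by (simp add: d3_def wedge22_def)
  moreover have "\<gamma> (br X1 X2) X3 W = - \<gamma> X3 (br X1 X2) W" "\<gamma> (br X2 X3) X1 W = - \<gamma> X1 (br X2 X3) W"
    "\<gamma> (br X1 X3) X2 W = \<gamma> X2 (br X3 X1) W"
    "\<gamma> (br X1 W) X2 X3 = \<gamma> X2 X3 (br X1 W)" "\<gamma> (br X2 W) X1 X3 = - \<gamma> X3 X1 (br X2 W)"
    "\<gamma> (br X3 W) X1 X2 = \<gamma> X1 X2 (br X3 W)"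
    using gamma_antisym(1)[of X3 "br X1 X2" W] gamma_antisym(1)[of X1 "br X2 X3" W]
      gamma_antisym(1)[of X2 "br X1 X3" W] br_antisym[of X1 X3]
      gamma_rotate[of "br X1 W" X2 X3] gamma_rotate[of "br X2 W" X1 X3] gamma_rotate[of "br X3 W" X1 X2]
      gamma_antisym(1)[of X3 X1 "br X2 W"] by (simp_all add: gamma_expand)
  moreover have "sp (\<alpha> X3 X1) (\<alpha> X2 W) = - sp (\<alpha> X1 X3) (\<alpha> X2 W)"
    "sp (\<alpha> X2 X3) (\<alpha> X1 W) = sp (\<alpha> X1 W) (\<alpha> X2 X3)"
    using alpha_antisym[of X3 X1] sp_sym by (simp_all add: sp_expand)
  ultimately show ?thesis by linarith
qed

text \<open>The dual component of the Jacobi identity for two elements of the Lie algebra and one of the module: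
  \<open>d \<alpha> = 0\<close>, paired with \<open>A\<close>.\<close>

lemma jacobi_alpha:
  "sp A (\<alpha> (br X2 X3) W) + sp (\<rho> W A) (\<alpha> X2 X3) - sp (\<rho> X3 A) (\<alpha> X2 W) + sp A (\<alpha> X3 (br X2 W))
   + sp (\<rho> X2 A) (\<alpha> X3 W) - sp A (\<alpha> X2 (br X3 W)) = 0"
proof -
  have "sp A (\<rho> X2 (\<alpha> X3 W) - \<rho> X3 (\<alpha> X2 W) + \<rho> W (\<alpha> X2 X3)
      - \<alpha> (br X2 X3) W + \<alpha> (br X2 W) X3 - \<alpha> (br X3 W) X2) = 0"
    by (simp add: alpha_closed sp_expand)
  then show ?thesis
    using alpha_antisym[of "br X2 W" X3] alpha_antisym[of "br X3 W" X2]
    by (simp add: sp_expand sp_inv)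
qed

lemma D_jacobi: "brac D x (brac D y z) + brac D y (brac D z x) + brac D z (brac D x y) = 0"
proof -
  obtain Z1 A1 X1 Z2 A2 X2 Z3 A3 X3 where xyz: "x = (Z1, A1, X1)" "y = (Z2, A2, X2)" "z = (Z3, A3, X3)"
    by (metis prod.exhaust)
  show ?thesis
  proof (rule D_eqI)
    fix W
    have jac: "dual_apply Z (br (br U V) W) = dual_apply Z (br U (br V W)) - dual_apply Z (br V (br U W))" for Z U V
    proof -
      have "br (br U V) W = br U (br V W) - br V (br U W)"
        using br_jacobi[of U V W] br_antisym[of W U] br_antisym[of W "br U V"]
        by (simp add: br_expand algebra_simps)
      then show ?thesis by (simp add: expand)
    qed
    have rr: "sp (\<rho> W A) (\<rho> U B) - sp (\<rho> W B) (\<rho> U A) - sp (\<rho> (br U W) B) A = 0" for A B U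
    proof -
      have "sp (\<rho> W B) (\<rho> U A) = - sp (\<rho> W (\<rho> U A)) B"
        by (metis sp_inv sp_sym)
      moreover have "sp (\<rho> W A) (\<rho> U B) = - sp (\<rho> U (\<rho> W A)) B" by (simp add: sp_inv)
      moreover have "sp (\<rho> (br U W) B) A = - sp (\<rho> (br U W) A) B"
        by (metis sp_inv sp_sym)
      ultimately show ?thesis by (simp add: rho_br[of U W A] sp_expand)
    qed
    have "dual_apply (fst (brac D x (brac D y z) + brac D y (brac D z x) + brac D z (brac D x y))) W = 0"
      by (simp add: xyz dual_expand D_brac_proj, simp add: sp_expand jac,
        use jacobi_gamma[of X1 X2 X3 W] jacobi_alpha[of A1 X2 X3 W] jacobi_alpha[of A2 X3 X1 W]
          jacobi_alpha[of A3 X1 X2 W] rr[of A1 X2 A3] rr[of A2 X3 A1] rr[of A3 X1 A2] in linarith)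
    then show "dual_apply (fst (brac D x (brac D y z) + brac D y (brac D z x) + brac D z (brac D x y))) W = dual_apply (fst 0) W"
      by (simp add: dual_expand)
  next
    have "\<rho> X1 (\<alpha> X2 X3) - \<alpha> (br X2 X3) X1 + (\<rho> X2 (\<alpha> X3 X1) - \<alpha> (br X3 X1) X2) + (\<rho> X3 (\<alpha> X1 X2) - \<alpha> (br X1 X2) X3) = 0"
      using alpha_closed[of X1 X2 X3] alpha_antisym[of X3 X1] br_antisym[of X3 X1]
      by (simp add: rho_expand alpha_expand algebra_simps)
    then show "fst (snd (brac D x (brac D y z) + brac D y (brac D z x) + brac D z (brac D x y))) = fst (snd 0)"
      using alpha_antisym[of X1 "br X2 X3"] alpha_antisym[of X2 "br X3 X1"] alpha_antisym[of X3 "br X1 X2"]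
      by (simp add: xyz D_brac_proj rho_expand rho_br algebra_simps)
  next
    show "snd (snd (brac D x (brac D y z) + brac D y (brac D z x) + brac D z (brac D x y))) = snd (snd 0)"
      by (simp add: xyz D_brac_proj br_jacobi)
  qed
qed

lemma D_lie: "lie_algebra_with_involution D"
  unfolding lie_algebra_with_involution_def
  by (intro conjI allI bil_D_brac D_brac_same D_jacobi lin_D_theta D_theta_theta D_theta_brac)

end

section \<open>Equivalence of cocycles and isomorphisms of standard models\<close>

text \<open>Two pairs of cochains lie in the same orbit exactly if there is an isomorphism between their
  standard models that is compatible with the filtration by \<open>L* \<subseteq> L* \<oplus> M\<close> and the
  identity on \<open>L\<close> and on \<open>M\<close> as graded pieces. This description of the orbits makes it evident
  that they are equivalence classes.\<close>

definition metric_lie_iso ::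
  "'g::findim_real_vector inv_metric_lie \<Rightarrow> 'h::findim_real_vector inv_metric_lie \<Rightarrow> ('g \<Rightarrow> 'h) \<Rightarrow> bool" where
  "metric_lie_iso G H F \<longleftrightarrow> linear F \<and> bij F \<and>
        (\<forall>X Y. F (brac G X Y) = brac H (F X) (F Y)) \<and>
        (\<forall>X Y. form H (F X) (F Y) = form G X Y) \<and>
        (\<forall>X. F (theta G X) = theta H (F X))"

lemma metric_lie_iso_comp:
  "metric_lie_iso G H F \<Longrightarrow> metric_lie_iso H K F' \<Longrightarrow> metric_lie_iso G K (F' \<circ> F)"
  by (auto simp: metric_lie_iso_def intro: linear_compose bij_comp)

lemma metric_lie_iso_inv:
  assumes "metric_lie_iso G H F"
  shows "metric_lie_iso H G (inv F)"
proof -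
  have F: "linear F" "bij F" "\<And>X Y. F (brac G X Y) = brac H (F X) (F Y)"
    "\<And>X Y. form H (F X) (F Y) = form G X Y" "\<And>X. F (theta G X) = theta H (F X)"
    using assms by (auto simp: metric_lie_iso_def)
  have FI: "F (inv F y) = y" for y using F(2) by (simp add: bij_is_surj surj_f_inv_f)
  have IF: "inv F (F x) = x" for x using F(2) by (simp add: bij_is_inj)
  have "linear (inv F)"
  proof (rule linearI)
    fix x y and c :: real
    show "inv F (x + y) = inv F x + inv F y"
      using IF[of "inv F x + inv F y"] by (simp add: linear_add[OF F(1)] FI)
    show "inv F (c *\<^sub>R x) = c *\<^sub>R inv F x"
      using IF[of "c *\<^sub>R inv F x"] by (simp add: linear_cmul[OF F(1)] FI)
  qed
  moreover have "inv F (brac H x y) = brac G (inv F x) (inv F y)" for x y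
    using IF[of "brac G (inv F x) (inv F y)"] by (simp add: F(3) FI)
  moreover have "form G (inv F x) (inv F y) = form H x y" for x y
    using F(4)[of "inv F x" "inv F y"] by (simp add: FI)
  moreover have "inv F (theta H x) = theta G (inv F x)" for x
    using IF[of "theta G (inv F x)"] by (simp add: F(5) FI)
  ultimately show ?thesis using F(2) by (simp add: metric_lie_iso_def bij_imp_bij_inv)
qed

text \<open>An isometry with these two properties is also the identity on the dual space, which is paired
  with \<open>L\<close>.\<close>

definition filtered_identity ::
  "('l::real_vector dual \<times> 'a::real_vector \<times> 'l \<Rightarrow> 'l dual \<times> 'a \<times> 'l) \<Rightarrow> bool" where
  "filtered_identity F \<longleftrightarrow> (\<forall>u. snd (snd (F u)) = snd (snd u)) \<and>
     (\<forall>u. snd (snd u) = 0 \<longrightarrow> fst (snd (F u)) = fst (snd u))"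

lemma filtered_identity_comp:
  "filtered_identity F \<Longrightarrow> filtered_identity F' \<Longrightarrow> filtered_identity (F' \<circ> F)"
  by (simp add: filtered_identity_def del: split_paired_All)

lemma filtered_identity_inv:
  assumes "filtered_identity F" "bij F" shows "filtered_identity (inv F)"
proof -
  have FI: "F (inv F y) = y" for y using assms(2) by (simp add: bij_is_surj surj_f_inv_f)
  have 1: "snd (snd (inv F u)) = snd (snd u)" for u
    using assms(1) FI[of u] by (metis filtered_identity_def)
  have "fst (snd (inv F u)) = fst (snd u)" if "snd (snd u) = 0" for u
    using assms(1) FI[of u] 1[of u] that by (metis filtered_identity_def)
  with 1 show ?thesis by (simp add: filtered_identity_def)
qed

text \<open>The isometry with \<open>filtered_identity\<close> that maps \<open>X\<close> in \<open>L\<close> to \<open>X - \<tau> X - \<sigma> X - 1/2 \<langle>\<tau> X, \<tau> \<cdot>\<rangle>\<close>: the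
  symmetric part of its dual component is determined by \<open>\<tau>\<close>, the alternating part is \<open>- \<sigma>\<close>.\<close>

definition shear ::
  "('l, 'a) orth_mod \<Rightarrow> ('l \<Rightarrow> 'a) \<Rightarrow> ('l \<Rightarrow> 'l \<Rightarrow> real) \<Rightarrow>
   'l::real_vector dual \<times> 'a::real_vector \<times> 'l \<Rightarrow> 'l dual \<times> 'a \<times> 'l" where
  "shear M \<tau> \<sigma> u =
     (fst u + Dual (\<lambda>Y. pairing M (fst (snd u)) (\<tau> Y)
         - 1/2 * pairing M (\<tau> (snd (snd u))) (\<tau> Y) - \<sigma> (snd (snd u)) Y),
      fst (snd u) - \<tau> (snd (snd u)), snd (snd u))"

context quad_cochain
begin

context
  fixes \<tau> :: "'l \<Rightarrow> 'a" and \<sigma> :: "'l \<Rightarrow> 'l \<Rightarrow> real"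
  assumes tau: "\<tau> \<in> cochain1_plus \<theta> \<theta>a" and sigma: "\<sigma> \<in> cochain2_plus \<theta> id"
begin

lemma lin_tau: "linear \<tau>" and tau_theta: "\<tau> (\<theta> X) = \<theta>a (\<tau> X)"
proof -
  show "linear \<tau>" using tau by (simp add: cochain1_plus_def cochain1_def)
  have "\<theta>a (\<tau> (\<theta> X)) = \<tau> X" using tau by (simp add: cochain1_plus_def)
  then show "\<tau> (\<theta> X) = \<theta>a (\<tau> X)" by (metis mtheta_mtheta)
qed

lemma bil_sigma: "bilinear \<sigma>" and sigma_same: "\<sigma> X X = 0" and sigma_theta: "\<sigma> (\<theta> X) (\<theta> Y) = \<sigma> X Y"
  using sigma by (auto simp: cochain2_plus_def cochain2_def)

lemmas tau_expand = linear_expand[OF lin_tau]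
lemmas sigma_expand = bilinear_expand[OF bil_sigma]

lemma sigma_antisym: "\<sigma> Y X = - \<sigma> X Y"
  using alternating_antisym[OF bil_sigma] sigma_same by blast

lemma shear_proj:
  "dual_apply (fst (shear M \<tau> \<sigma> u)) Y = dual_apply (fst u) Y + sp (fst (snd u)) (\<tau> Y)
     - 1/2 * sp (\<tau> (snd (snd u))) (\<tau> Y) - \<sigma> (snd (snd u)) Y"
  "fst (snd (shear M \<tau> \<sigma> u)) = fst (snd u) - \<tau> (snd (snd u))"
  "snd (snd (shear M \<tau> \<sigma> u)) = snd (snd u)"
proof -
  have "linear (\<lambda>Y. sp (fst (snd u)) (\<tau> Y) - 1/2 * sp (\<tau> (snd (snd u))) (\<tau> Y) - \<sigma> (snd (snd u)) Y)"
    by (rule linearI) (simp_all add: expand tau_expand sigma_expand algebra_simps)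
  then show "dual_apply (fst (shear M \<tau> \<sigma> u)) Y = dual_apply (fst u) Y + sp (fst (snd u)) (\<tau> Y)
     - 1/2 * sp (\<tau> (snd (snd u))) (\<tau> Y) - \<sigma> (snd (snd u)) Y"
    by (simp add: shear_def dual_expand dual_apply_Dual)
qed (simp_all add: shear_def)

lemma lin_shear: "linear (shear M \<tau> \<sigma>)"
proof (rule linearI)
  fix u v and c :: real
  show "shear M \<tau> \<sigma> (u + v) = shear M \<tau> \<sigma> u + shear M \<tau> \<sigma> v"
    by (rule D_eqI) (simp_all add: shear_proj expand tau_expand sigma_expand algebra_simps)
  show "shear M \<tau> \<sigma> (c *\<^sub>R u) = c *\<^sub>R shear M \<tau> \<sigma> u"
    by (rule D_eqI) (simp_all add: shear_proj expand tau_expand sigma_expand algebra_simps)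
qed

lemma bij_shear: "bij (shear M \<tau> \<sigma>)"
proof -
  have "u = 0" if "shear M \<tau> \<sigma> u = 0" for u
  proof -
    have 1: "snd (snd u) = 0" using shear_proj(3)[of u] that by simp
    then have 2: "fst (snd u) = 0" using shear_proj(2)[of u] that by (simp add: tau_expand)
    have "dual_apply (fst u) Y = dual_apply 0 Y" for Y
      using shear_proj(1)[of u Y] that 1 2 by (simp add: tau_expand sigma_expand sp_expand dual_expand)
    then show ?thesis using 1 2 by (intro D_eqI) simp_all
  qed
  then have "inj (shear M \<tau> \<sigma>)" using linear_injective_0[OF lin_shear] by blast
  then show ?thesis using findim.linear_inj_imp_surj[OF lin_shear] by (simp add: bij_def)
qed

lemma shear_form: "form D' (shear M \<tau> \<sigma> u) (shear M \<tau> \<sigma> v) = form D u v"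
  if "D' = standard_model L M c'" for D' c'
proof -
  have f: "form D' u v = sp (fst (snd u)) (fst (snd v)) + dual_apply (fst u) (snd (snd v)) +
    dual_apply (fst v) (snd (snd u))" for u v
    by (cases c'; cases u; cases v) (simp add: that standard_model_def)
  show ?thesis
    unfolding f D_form_proj shear_proj
    using sigma_antisym[of "snd (snd v)" "snd (snd u)"]
      sp_sym[of "fst (snd v)" "\<tau> (snd (snd u))"] sp_sym[of "\<tau> (snd (snd v))" "\<tau> (snd (snd u))"]
    by (simp add: sp_expand)
qed

lemma shear_theta: "shear M \<tau> \<sigma> (theta D' u) = theta D' (shear M \<tau> \<sigma> u)"
  if "quad_cochain L M \<alpha>' \<gamma>'" "D' = standard_model L M (\<alpha>', \<gamma>')" for D' \<alpha>' \<gamma>'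
proof (rule D_eqI)
  note proj = quad_cochain.D_theta_proj[OF that(1), folded that(2)]
  fix Y
  have s: "\<sigma> (\<theta> X) Y = \<sigma> X (\<theta> Y)" for X using sigma_theta[of X "\<theta> Y"] by (simp add: theta_theta)
  have t: "sp (\<theta>a A) (\<tau> Y) = sp A (\<tau> (\<theta> Y))" for A
    using sp_mtheta[of A "\<tau> (\<theta> Y)"] by (simp add: tau_theta[of Y] mtheta_mtheta)
  show "dual_apply (fst (shear M \<tau> \<sigma> (theta D' u))) Y = dual_apply (fst (theta D' (shear M \<tau> \<sigma> u))) Y"
    by (simp only: shear_proj proj tau_theta[of "snd (snd u)"] s t)
qed (simp_all only: shear_proj quad_cochain.D_theta_proj[OF that(1), folded that(2)]
       linear_diff[OF lin_mtheta] tau_theta)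

lemma quad_act_proj:
  "fst (quad_act L M (\<alpha>, \<gamma>) \<tau> \<sigma>) X Y = \<alpha> X Y + \<rho> X (\<tau> Y) - \<rho> Y (\<tau> X) - \<tau> (br X Y)"
  "snd (quad_act L M (\<alpha>, \<gamma>) \<tau> \<sigma>) X Y Z = \<gamma> X Y Z - \<sigma> (br X Y) Z + \<sigma> (br X Z) Y - \<sigma> (br Y Z) X
     + sp (\<alpha> X Y + (1/2) *\<^sub>R (\<rho> X (\<tau> Y) - \<rho> Y (\<tau> X) - \<tau> (br X Y))) (\<tau> Z)
     - sp (\<alpha> X Z + (1/2) *\<^sub>R (\<rho> X (\<tau> Z) - \<rho> Z (\<tau> X) - \<tau> (br X Z))) (\<tau> Y)
     + sp (\<alpha> Y Z + (1/2) *\<^sub>R (\<rho> Y (\<tau> Z) - \<rho> Z (\<tau> Y) - \<tau> (br Y Z))) (\<tau> X)"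
  by (simp_all add: quad_act_def d1_def d2_def wedge21_def)

lemma quad_act_cochain:
  "quad_cochain L M (fst (quad_act L M (\<alpha>, \<gamma>) \<tau> \<sigma>)) (snd (quad_act L M (\<alpha>, \<gamma>) \<tau> \<sigma>))"
proof unfold_locales
  let ?a = "fst (quad_act L M (\<alpha>, \<gamma>) \<tau> \<sigma>)" and ?g = "snd (quad_act L M (\<alpha>, \<gamma>) \<tau> \<sigma>)"
  show "?a \<in> cochain2_plus \<theta> \<theta>a"
    unfolding cochain2_plus_def cochain2_def mem_Collect_eq bilinear_def
  proof (intro conjI allI linearI)
    fix X Y Z and c :: real
    show "?a Z (X + Y) = ?a Z X + ?a Z Y" "?a (X + Y) Z = ?a X Z + ?a Y Z"
      "?a Z (c *\<^sub>R X) = c *\<^sub>R ?a Z X" "?a (c *\<^sub>R X) Z = c *\<^sub>R ?a X Z"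
      by (simp_all add: quad_act_proj expand tau_expand algebra_simps)
    show "?a X X = 0" by (simp add: quad_act_proj alpha_same br_same tau_expand)
    show "\<theta>a (?a (\<theta> X) (\<theta> Y)) = ?a X Y"
      by (simp add: quad_act_proj alpha_theta tau_theta mtheta_rho[symmetric] theta_br[symmetric]
          mtheta_mtheta mtheta_expand)
  qed
  have an: "\<alpha> X Y = - \<alpha> Y X" "br X Y = - br Y X" "\<sigma> X Y = - \<sigma> Y X" for X Y
    by (rule alpha_antisym br_antisym sigma_antisym)+
  show "?g \<in> cochain3_plus \<theta> id"
    unfolding cochain3_plus_def cochain3_def mem_Collect_eq
  proof (intro conjI allI linearI)
    fix X Y Z W and c :: real
    show "?g X Y (Z + W) = ?g X Y Z + ?g X Y W" "?g X (Z + W) Y = ?g X Z Y + ?g X W Y"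
      "?g (Z + W) X Y = ?g Z X Y + ?g W X Y"
      by (simp_all add: quad_act_proj expand tau_expand sigma_expand algebra_simps)
    show "?g X Y (c *\<^sub>R Z) = c *\<^sub>R ?g X Y Z" "?g X (c *\<^sub>R Z) Y = c *\<^sub>R ?g X Z Y"
      "?g (c *\<^sub>R Z) X Y = c *\<^sub>R ?g Z X Y"
      by (simp_all add: quad_act_proj expand tau_expand sigma_expand algebra_simps)
    show "?g X X Y = 0"
      by (simp add: quad_act_proj expand tau_expand sigma_expand gamma_same alpha_same br_same)
    show "?g X Y X = 0"
      by (simp add: quad_act_proj expand tau_expand sigma_expand gamma_same alpha_same br_same
          an(1)[of Y X] an(2)[of Y X] add_divide_distrib diff_divide_distrib)
    show "?g Y X X = 0"
      by (simp add: quad_act_proj expand tau_expand sigma_expand gamma_same alpha_same br_same)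
    show "id (?g (\<theta> X) (\<theta> Y) (\<theta> Z)) = ?g X Y Z"
      by (simp add: quad_act_proj gamma_theta alpha_theta tau_theta mtheta_rho[symmetric] theta_br[symmetric]
          sigma_theta linear_add[OF lin_mtheta, symmetric] linear_diff[OF lin_mtheta, symmetric]
          linear_cmul[OF lin_mtheta, symmetric] sp_mtheta)
  qed
qed

text \<open>All components of \<open>F [u, v] - [F u, F v]\<close> cancel identically in the cochains except this one, which is
  the difference of the two three-forms. So a shear is a homomorphism exactly if the target is the
  transformed pair; both directions are used.\<close>

lemma shear_brac_defect:
  assumes c': "quad_cochain L M \<alpha>' \<gamma>'" and a': "\<alpha>' = fst (quad_act L M (\<alpha>, \<gamma>) \<tau> \<sigma>)"
  shows "dual_apply (fst (shear M \<tau> \<sigma> (brac D u v))) W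
      - dual_apply (fst (brac (standard_model L M (\<alpha>', \<gamma>')) (shear M \<tau> \<sigma> u) (shear M \<tau> \<sigma> v))) W
      = snd (quad_act L M (\<alpha>, \<gamma>) \<tau> \<sigma>) (snd (snd u)) (snd (snd v)) W - \<gamma>' (snd (snd u)) (snd (snd v)) W"
proof -
  obtain Z1 A1 X where u: "u = (Z1, A1, X)" by (rule prod_cases3)
  obtain Z2 A2 Y where v: "v = (Z2, A2, Y)" by (rule prod_cases3)
  have a'': "\<alpha>' X Y = \<alpha> X Y + \<rho> X (\<tau> Y) - \<rho> Y (\<tau> X) - \<tau> (br X Y)" for X Y
    by (simp only: a' quad_act_proj)
  have moves: "sp (\<tau> P) (\<rho> Q (\<tau> T)) = - sp (\<tau> T) (\<rho> Q (\<tau> P))" for P Q T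
    by (metis sp_inv sp_sym)
  have A1: "sp (\<tau> Y) (\<rho> W A1) = - sp A1 (\<rho> W (\<tau> Y))" "sp (\<tau> W) (\<rho> Y A1) = - sp A1 (\<rho> Y (\<tau> W))"
    and A2: "sp (\<tau> X) (\<rho> W A2) = - sp A2 (\<rho> W (\<tau> X))" "sp (\<tau> W) (\<rho> X A2) = - sp A2 (\<rho> X (\<tau> W))"
    by (metis sp_inv sp_sym)+
  show ?thesis
    unfolding u v shear_proj D_brac_proj quad_cochain.D_brac_proj[OF c'] quad_act_proj fst_conv snd_conv a''
    by (simp add: sp_expand rho_expand sp_inv)
      (use moves[of Y X W] moves[of X Y W] moves[of X W Y] A1 A2
        sp_sym[of "\<tau> X" "\<tau> (br Y W)"] sp_sym[of "\<tau> Y" "\<tau> (br X W)"] sp_sym[of "\<tau> W" "\<tau> (br X Y)"]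
        sp_sym[of "\<tau> X" "\<alpha> Y W"] sp_sym[of "\<tau> Y" "\<alpha> X W"] sp_sym[of "\<tau> W" "\<alpha> X Y"]
        sigma_antisym[of X "br Y W"] sigma_antisym[of Y "br X W"] in argo)
qed

lemma shear_brac:
  assumes c': "quad_cochain L M \<alpha>' \<gamma>'" and q: "(\<alpha>', \<gamma>') = quad_act L M (\<alpha>, \<gamma>) \<tau> \<sigma>"
  shows "shear M \<tau> \<sigma> (brac D u v) = brac (standard_model L M (\<alpha>', \<gamma>')) (shear M \<tau> \<sigma> u) (shear M \<tau> \<sigma> v)"
proof (rule D_eqI)
  have a': "\<alpha>' = fst (quad_act L M (\<alpha>, \<gamma>) \<tau> \<sigma>)" and g': "\<gamma>' = snd (quad_act L M (\<alpha>, \<gamma>) \<tau> \<sigma>)"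
    by (simp_all add: q[symmetric])
  fix W
  show "dual_apply (fst (shear M \<tau> \<sigma> (brac D u v))) W =
      dual_apply (fst (brac (standard_model L M (\<alpha>', \<gamma>')) (shear M \<tau> \<sigma> u) (shear M \<tau> \<sigma> v))) W"
    using shear_brac_defect[OF c' a', of u v W] by (simp add: g')
  have a'': "\<alpha>' X Y = \<alpha> X Y + \<rho> X (\<tau> Y) - \<rho> Y (\<tau> X) - \<tau> (br X Y)" for X Y
    by (simp only: a' quad_act_proj)
  show "fst (snd (shear M \<tau> \<sigma> (brac D u v))) =
      fst (snd (brac (standard_model L M (\<alpha>', \<gamma>')) (shear M \<tau> \<sigma> u) (shear M \<tau> \<sigma> v)))"
    unfolding shear_proj D_brac_proj quad_cochain.D_brac_proj[OF c'] a''
    by (simp add: rho_expand)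
qed (simp only: shear_proj D_brac_proj quad_cochain.D_brac_proj[OF c'])

lemma shear_iso:
  assumes c': "quad_cochain L M \<alpha>' \<gamma>'" and q: "(\<alpha>', \<gamma>') = quad_act L M (\<alpha>, \<gamma>) \<tau> \<sigma>"
  shows "metric_lie_iso D (standard_model L M (\<alpha>', \<gamma>')) (shear M \<tau> \<sigma>)"
proof -
  have "theta D = theta (standard_model L M (\<alpha>', \<gamma>'))" by (simp add: standard_model_def)
  then show ?thesis
    unfolding metric_lie_iso_def
    using lin_shear bij_shear shear_brac[OF c' q] shear_form[OF refl] shear_theta[OF c' refl] by simp
qed

lemma shear_filtered: "filtered_identity (shear M \<tau> \<sigma>)"
  by (simp add: filtered_identity_def shear_proj tau_expand)

end

text \<open>Read \<open>\<tau>\<close> and \<open>\<sigma>\<close> off from the image of \<open>L\<close>. The isometry property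
  determines \<open>F\<close> on the dual space and on \<open>M\<close> and fixes the symmetric part of the dual component on
  \<open>L\<close>, so that \<open>F\<close> is a shear; then compare brackets.\<close>

lemma filtered_iso_is_shear:
  assumes c': "quad_cochain L M \<alpha>' \<gamma>'" and iso: "metric_lie_iso D (standard_model L M (\<alpha>', \<gamma>')) F"
    and fil: "filtered_identity F"
  shows "(\<alpha>', \<gamma>') \<in> quad_class L M (\<alpha>, \<gamma>)"
proof -
  let ?D' = "standard_model L M (\<alpha>', \<gamma>')"
  have F: "linear F" "\<And>X Y. F (brac D X Y) = brac ?D' (F X) (F Y)"
    "\<And>X Y. form ?D' (F X) (F Y) = form D X Y" "\<And>X. F (theta D X) = theta ?D' (F X)"
    using iso by (auto simp: metric_lie_iso_def)
  note form_proj = quad_cochain.D_form_proj[OF c'] and theta_proj = quad_cochain.D_theta_proj[OF c']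
    and brac_proj = quad_cochain.D_brac_proj[OF c']
  have F3: "snd (snd (F u)) = snd (snd u)" and F2: "snd (snd u) = 0 \<Longrightarrow> fst (snd (F u)) = fst (snd u)" for u
    using fil unfolding filtered_identity_def by blast+
  define t where "t X = fst (snd (F (0, 0, X)))" for X
  define s where "s X = fst (F (0, 0, X))" for X
  have triple_add: "(0 :: 'l dual, 0 :: 'a, X + Y) = (0, 0, X) + (0, 0, Y)"
    "(0 :: 'l dual, 0 :: 'a, c *\<^sub>R X) = c *\<^sub>R (0, 0, X)"
    for X Y :: 'l and c by simp_all
  have lin_t: "linear t" and lin_s: "linear s"
    unfolding t_def s_def
    by (intro linearI; simp only: triple_add linear_add[OF F(1)] linear_cmul[OF F(1)] fst_add snd_add
        fst_scaleR snd_scaleR)+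
  have m: "fst (F (Z, 0, 0)) = Z" for Z
  proof (rule dual_eqI)
    fix Y
    show "dual_apply (fst (F (Z, 0, 0))) Y = dual_apply Z Y"
      using F(3)[of "(Z, 0, 0)" "(0, 0, Y)"]
      by (simp add: form_proj D_form_proj F3 F2 expand)
  qed
  have n: "dual_apply (fst (F (0, A, 0))) Y = - sp A (t Y)" for A Y
    using F(3)[of "(0, A, 0)" "(0, 0, Y)"]
    by (simp add: form_proj D_form_proj F3 F2 expand t_def)
  have ss: "dual_apply (s X) Y + dual_apply (s Y) X + sp (t X) (t Y) = 0" for X Y
    using F(3)[of "(0, 0, X)" "(0, 0, Y)"]
    by (simp add: form_proj D_form_proj F3 expand t_def s_def)
  have F_split: "F (Z, A, X) = F (Z, 0, 0) + F (0, A, 0) + F (0, 0, X)" for Z A X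
    by (simp flip: linear_add[OF F(1)])
  define \<tau> where "\<tau> X = - t X" for X
  define \<sigma> where "\<sigma> X Y = - dual_apply (s X) Y - 1/2 * sp (t X) (t Y)" for X Y
  have tau: "\<tau> \<in> cochain1_plus \<theta> \<theta>a"
  proof -
    have "t (\<theta> X) = \<theta>a (t X)" for X
    proof -
      have "theta D (0, 0, X) = (0, 0, \<theta> X)"
        by (rule D_eqI) (simp_all add: D_theta_proj expand mtheta_expand)
      then show ?thesis using F(4)[of "(0, 0, X)"] by (simp add: t_def theta_proj)
    qed
    then show ?thesis
      unfolding cochain1_plus_def cochain1_def \<tau>_def
      using linear_compose_neg[OF lin_t] by (simp add: mtheta_expand mtheta_mtheta)
  qed
  have sigma: "\<sigma> \<in> cochain2_plus \<theta> id"
    unfolding cochain2_plus_def cochain2_def mem_Collect_eq bilinear_def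
  proof (intro conjI allI linearI)
    fix X Y Z and c :: real
    show "\<sigma> Z (X + Y) = \<sigma> Z X + \<sigma> Z Y" "\<sigma> (X + Y) Z = \<sigma> X Z + \<sigma> Y Z"
      "\<sigma> Z (c *\<^sub>R X) = c *\<^sub>R \<sigma> Z X" "\<sigma> (c *\<^sub>R X) Z = c *\<^sub>R \<sigma> X Z"
      by (simp_all add: \<sigma>_def expand linear_expand[OF lin_t] linear_expand[OF lin_s] algebra_simps)
    show "\<sigma> X X = 0" using ss[of X X] by (simp add: \<sigma>_def)
    have th: "theta D (0, 0, X) = (0, 0, \<theta> X)" for X
      by (rule D_eqI) (simp_all add: D_theta_proj expand mtheta_expand)
    have "t (\<theta> X) = \<theta>a (t X)" for X
      using F(4)[of "(0, 0, X)"] by (simp add: th t_def theta_proj)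
    moreover have "dual_apply (s (\<theta> X)) (\<theta> Y) = dual_apply (s X) Y"
      using F(4)[of "(0, 0, X)"] theta_proj(1)[of "F (0, 0, X)" "\<theta> Y"]
      by (simp add: th s_def theta_theta)
    ultimately show "id (\<sigma> (\<theta> X) (\<theta> Y)) = \<sigma> X Y" by (simp add: \<sigma>_def sp_mtheta)
  qed
  have F_shear: "F u = shear M \<tau> \<sigma> u" for u
  proof -
    obtain Z A X where u: "u = (Z, A, X)" by (rule prod_cases3)
    show ?thesis
      by (rule D_eqI)
        (simp_all add: u shear_proj[OF tau sigma] F_split[of Z A X] m n F2 F3 expand \<tau>_def \<sigma>_def
          s_def[symmetric] t_def[symmetric])
  qed
  have brac_t: "shear M \<tau> \<sigma> (brac D u v) = brac ?D' (shear M \<tau> \<sigma> u) (shear M \<tau> \<sigma> v)" for u v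
    using F(2)[of u v] by (simp add: F_shear)
  have a': "\<alpha>' = fst (quad_act L M (\<alpha>, \<gamma>) \<tau> \<sigma>)"
  proof (intro ext)
    fix X Y
    have "fst (snd (shear M \<tau> \<sigma> (brac D (0, 0, X) (0, 0, Y)))) =
        fst (snd (brac ?D' (shear M \<tau> \<sigma> (0, 0, X)) (shear M \<tau> \<sigma> (0, 0, Y))))" by (simp only: brac_t)
    then show "\<alpha>' X Y = fst (quad_act L M (\<alpha>, \<gamma>) \<tau> \<sigma>) X Y"
      unfolding shear_proj[OF tau sigma] D_brac_proj brac_proj quad_act_proj[OF tau sigma] fst_conv snd_conv
      by (simp add: rho_expand algebra_simps)
  qed
  moreover have "\<gamma>' = snd (quad_act L M (\<alpha>, \<gamma>) \<tau> \<sigma>)"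
  proof (intro ext)
    fix X Y W
    show "\<gamma>' X Y W = snd (quad_act L M (\<alpha>, \<gamma>) \<tau> \<sigma>) X Y W"
      using shear_brac_defect[OF tau sigma c' a', of "(0, 0, X)" "(0, 0, Y)" W] by (simp add: brac_t)
  qed
  ultimately have "(\<alpha>', \<gamma>') = quad_act L M (\<alpha>, \<gamma>) \<tau> \<sigma>" by (simp add: prod_eq_iff)
  then show ?thesis using tau sigma by (auto simp: quad_class_def)
qed

lemma quad_class_member:
  assumes "(\<alpha>', \<gamma>') \<in> quad_class L M (\<alpha>, \<gamma>)"
  shows "quad_cochain L M \<alpha>' \<gamma>'"
    and "\<exists>F. metric_lie_iso D (standard_model L M (\<alpha>', \<gamma>')) F \<and> filtered_identity F"
proof -
  obtain \<tau> \<sigma> where ts: "\<tau> \<in> cochain1_plus \<theta> \<theta>a" "\<sigma> \<in> cochain2_plus \<theta> id"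
    and q: "(\<alpha>', \<gamma>') = quad_act L M (\<alpha>, \<gamma>) \<tau> \<sigma>"
    using assms by (auto simp: quad_class_def)
  show c': "quad_cochain L M \<alpha>' \<gamma>'" using quad_act_cochain[OF ts] by (simp add: q[symmetric])
  show "\<exists>F. metric_lie_iso D (standard_model L M (\<alpha>', \<gamma>')) F \<and> filtered_identity F"
    using shear_iso[OF ts c' q] shear_filtered[OF ts] by blast
qed

end

text \<open>The group law on the pairs \<open>(\<tau>, \<sigma>)\<close> is replaced by composition of isomorphisms.\<close>

lemma quad_class_subset:
  assumes c: "quad_cochain L M \<alpha> \<gamma>" and c': "(\<alpha>', \<gamma>') \<in> quad_class L M (\<alpha>, \<gamma>)"
  shows "quad_class L M (\<alpha>', \<gamma>') \<subseteq> quad_class L M (\<alpha>, \<gamma>)"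
proof
  fix c'' assume c'': "c'' \<in> quad_class L M (\<alpha>', \<gamma>')"
  obtain \<alpha>'' \<gamma>'' where cc: "c'' = (\<alpha>'', \<gamma>'')" by (cases c'')
  have coc': "quad_cochain L M \<alpha>' \<gamma>'" using quad_cochain.quad_class_member(1)[OF c c'] .
  have coc'': "quad_cochain L M \<alpha>'' \<gamma>''" using quad_cochain.quad_class_member(1)[OF coc'] c'' cc by simp
  obtain F where F: "metric_lie_iso (standard_model L M (\<alpha>, \<gamma>)) (standard_model L M (\<alpha>', \<gamma>')) F" "filtered_identity F"
    using quad_cochain.quad_class_member(2)[OF c c'] by blast
  obtain F' where F': "metric_lie_iso (standard_model L M (\<alpha>', \<gamma>')) (standard_model L M (\<alpha>'', \<gamma>'')) F'" "filtered_identity F'"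
    using quad_cochain.quad_class_member(2)[OF coc', of \<alpha>'' \<gamma>''] c'' cc by blast
  show "c'' \<in> quad_class L M (\<alpha>, \<gamma>)"
    unfolding cc
    by (rule quad_cochain.filtered_iso_is_shear[OF c coc'' metric_lie_iso_comp[OF F(1) F'(1)]
          filtered_identity_comp[OF F(2) F'(2)]])
qed

lemma quad_class_sym:
  assumes c: "quad_cochain L M \<alpha> \<gamma>" and c': "(\<alpha>', \<gamma>') \<in> quad_class L M (\<alpha>, \<gamma>)"
  shows "(\<alpha>, \<gamma>) \<in> quad_class L M (\<alpha>', \<gamma>')"
proof -
  have coc': "quad_cochain L M \<alpha>' \<gamma>'" using quad_cochain.quad_class_member(1)[OF c c'] .
  obtain F where F: "metric_lie_iso (standard_model L M (\<alpha>, \<gamma>)) (standard_model L M (\<alpha>', \<gamma>')) F" "filtered_identity F"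
    using quad_cochain.quad_class_member(2)[OF c c'] by blast
  have "bij F" using F(1) by (simp add: metric_lie_iso_def)
  then show ?thesis
    by (rule quad_cochain.filtered_iso_is_shear[OF coc' c metric_lie_iso_inv[OF F(1)]
          filtered_identity_inv[OF F(2)]])
qed

lemma quad_class_refl:
  assumes "quad_cochain L M \<alpha> \<gamma>" shows "(\<alpha>, \<gamma>) \<in> quad_class L M (\<alpha>, \<gamma>)"
proof (rule quad_cochain.filtered_iso_is_shear[OF assms assms])
  show "metric_lie_iso (standard_model L M (\<alpha>, \<gamma>)) (standard_model L M (\<alpha>, \<gamma>)) id"
    by (simp add: metric_lie_iso_def linear_id)
  show "filtered_identity id" by (simp add: filtered_identity_def)
qed

lemma quad_class_eqI:
  assumes "quad_cochain L M \<alpha> \<gamma>" "(\<alpha>', \<gamma>') \<in> quad_class L M (\<alpha>, \<gamma>)"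
  shows "quad_class L M (\<alpha>', \<gamma>') = quad_class L M (\<alpha>, \<gamma>)"
  using quad_class_subset[OF assms]
    quad_class_subset[OF quad_cochain.quad_class_member(1)[OF assms] quad_class_sym[OF assms]] by blast

section \<open>Isomorphisms of triples\<close>

(* An element of the standard model is handled as one variable u with its components
   fst u, fst (snd u), snd (snd u); splitting of quantified pairs would break it up. *)
declare split_paired_All [simp del] split_paired_Ex [simp del]

lemma quad_cochainI:
  "lie_algebra_with_involution L \<Longrightarrow> orthogonal_module L M \<Longrightarrow> \<alpha> \<in> cochain2_plus (theta L) (mtheta M) \<Longrightarrow>
   \<gamma> \<in> cochain3_plus (theta L) id \<Longrightarrow> quad_cochain L M \<alpha> \<gamma>"
  by unfold_locales


lemma linear_inv:
  assumes "linear f" "bij f" shows "linear (inv f)"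
proof (rule linearI)
  have FI: "f (inv f y) = y" for y using assms(2) by (simp add: bij_is_surj surj_f_inv_f)
  have IF: "inv f (f x) = x" for x using assms(2) by (simp add: bij_is_inj)
  fix x y and c :: real
  show "inv f (x + y) = inv f x + inv f y"
    using IF[of "inv f x + inv f y"] by (simp add: linear_add[OF assms(1)] FI)
  show "inv f (c *\<^sub>R x) = c *\<^sub>R inv f x"
    using IF[of "c *\<^sub>R inv f x"] by (simp add: linear_cmul[OF assms(1)] FI)
qed

text \<open>The isomorphism of standard models induced by an isomorphism of triples. The map \<open>U\<close> goes backwards,
  hence its inverse here.\<close>

definition triple_map ::
  "('l1 \<Rightarrow> 'l2) \<Rightarrow> ('a2 \<Rightarrow> 'a1) \<Rightarrow> 'l1::real_vector dual \<times> 'a1 \<times> 'l1 \<Rightarrow> 'l2::real_vector dual \<times> 'a2 \<times> 'l2" where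
  "triple_map S U u = (Dual (\<lambda>Y. dual_apply (fst u) (inv S Y)), inv U (fst (snd u)), S (snd (snd u)))"

locale triple_iso_cochain = m1: lie_module L1 M1 + c2: quad_cochain L2 M2 \<alpha> \<gamma>
  for L1 :: "'l1::findim_real_vector inv_lie" and M1 :: "('l1, 'a1::findim_real_vector) orth_mod"
    and L2 :: "'l2::findim_real_vector inv_lie" and M2 :: "('l2, 'a2::findim_real_vector) orth_mod"
    and \<alpha> \<gamma> +
  fixes S :: "'l1 \<Rightarrow> 'l2" and U :: "'a2 \<Rightarrow> 'a1"
  assumes iso: "triple_isomorphism L1 M1 L2 M2 S U"
begin

lemma S: "linear S" "bij S" "S (brac L1 X Y) = brac L2 (S X) (S Y)" "S (theta L1 X) = theta L2 (S X)"
  and U: "linear U" "bij U" "pairing M1 (U A) (U B) = pairing M2 A B" "U (mtheta M2 A) = mtheta M1 (U A)"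
    "U (rho M2 (S X) A) = rho M1 X (U A)"
  using iso by (auto simp: triple_isomorphism_def triple_morphism_def)

lemma S_inv: "S (inv S Y) = Y" "inv S (S X) = X" and U_inv: "U (inv U A) = A" "inv U (U B) = B"
  using S(2) U(2) by (simp_all add: bij_is_surj surj_f_inv_f bij_is_inj)

abbreviation "\<alpha>p \<equiv> \<lambda>X Y. U (\<alpha> (S X) (S Y))"
abbreviation "\<gamma>p \<equiv> \<lambda>X Y Z. \<gamma> (S X) (S Y) (S Z)"

lemma pullback_cochain: "quad_cochain L1 M1 \<alpha>p \<gamma>p"
proof (rule quad_cochainI[OF m1.lie m1.om])
  show "\<alpha>p \<in> cochain2_plus (theta L1) (mtheta M1)"
    unfolding cochain2_plus_def cochain2_def mem_Collect_eq bilinear_def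
  proof (intro conjI allI linearI)
    fix X Y Z and c :: real
    show "\<alpha>p Z (X + Y) = \<alpha>p Z X + \<alpha>p Z Y" "\<alpha>p (X + Y) Z = \<alpha>p X Z + \<alpha>p Y Z"
      "\<alpha>p Z (c *\<^sub>R X) = c *\<^sub>R \<alpha>p Z X" "\<alpha>p (c *\<^sub>R X) Z = c *\<^sub>R \<alpha>p X Z"
      by (simp_all add: linear_expand[OF S(1)] linear_expand[OF U(1)] c2.alpha_expand)
    show "\<alpha>p X X = 0" by (simp add: c2.alpha_same linear_0[OF U(1)])
    show "mtheta M1 (\<alpha>p (theta L1 X) (theta L1 Y)) = \<alpha>p X Y"
      by (simp add: S(4) c2.alpha_theta U(4) m1.mtheta_mtheta)
  qed
  show "\<gamma>p \<in> cochain3_plus (theta L1) id"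
    unfolding cochain3_plus_def cochain3_def mem_Collect_eq
  proof (intro conjI allI linearI)
    fix X Y Z W and c :: real
    show "\<gamma>p X Y (Z + W) = \<gamma>p X Y Z + \<gamma>p X Y W" "\<gamma>p X (Z + W) Y = \<gamma>p X Z Y + \<gamma>p X W Y"
      "\<gamma>p (Z + W) X Y = \<gamma>p Z X Y + \<gamma>p W X Y"
      "\<gamma>p X Y (c *\<^sub>R Z) = c *\<^sub>R \<gamma>p X Y Z" "\<gamma>p X (c *\<^sub>R Z) Y = c *\<^sub>R \<gamma>p X Z Y"
      "\<gamma>p (c *\<^sub>R Z) X Y = c *\<^sub>R \<gamma>p Z X Y"
      by (simp_all add: linear_expand[OF S(1)] c2.gamma_expand)
    show "\<gamma>p X X Y = 0" "\<gamma>p X Y X = 0" "\<gamma>p Y X X = 0" by (simp_all add: c2.gamma_same)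
    show "id (\<gamma>p (theta L1 X) (theta L1 Y) (theta L1 Z)) = \<gamma>p X Y Z"
      by (simp add: S(4) c2.gamma_theta)
  qed
qed

lemma triple_map_proj:
  "dual_apply (fst (triple_map S U u)) Y = dual_apply (fst u) (inv S Y)"
  "fst (snd (triple_map S U u)) = inv U (fst (snd u))" "snd (snd (triple_map S U u)) = S (snd (snd u))"
proof -
  have "linear (\<lambda>Y. dual_apply (fst u) (inv S Y))"
    using linear_compose[OF linear_inv[OF S(1,2)] linear_dual_apply[of "fst u"]] by (simp add: o_def)
  then show "dual_apply (fst (triple_map S U u)) Y = dual_apply (fst u) (inv S Y)"
    by (simp add: triple_map_def dual_apply_Dual)
qed (simp_all add: triple_map_def)

lemma triple_map_iso:
  "metric_lie_iso (standard_model L1 M1 (\<alpha>p, \<gamma>p)) (standard_model L2 M2 (\<alpha>, \<gamma>)) (triple_map S U)"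
proof -
  interpret p: quad_cochain L1 M1 \<alpha>p \<gamma>p by (rule pullback_cochain)
  note linv = linear_inv[OF S(1,2)] linear_inv[OF U(1,2)]
  have lin: "linear (triple_map S U)"
  proof (rule linearI)
    fix u v and c :: real
    show "triple_map S U (u + v) = triple_map S U u + triple_map S U v"
      by (rule c2.D_eqI) (simp_all add: triple_map_proj dual_expand linear_expand[OF linv(2)] linear_expand[OF S(1)])
    show "triple_map S U (c *\<^sub>R u) = c *\<^sub>R triple_map S U u"
      by (rule c2.D_eqI) (simp_all add: triple_map_proj dual_expand linear_expand[OF linv(2)] linear_expand[OF S(1)])
  qed
  have bij: "bij (triple_map S U)"
  proof (rule bijI)
    show "inj (triple_map S U)"
    proof (rule injI)
      fix u v assume uv: "triple_map S U u = triple_map S U v"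
      show "u = v"
      proof (rule p.D_eqI)
        fix X
        show "dual_apply (fst u) X = dual_apply (fst v) X"
          using triple_map_proj(1)[of u "S X"] triple_map_proj(1)[of v "S X"] uv by (simp add: S_inv)
        show "fst (snd u) = fst (snd v)"
          using triple_map_proj(2)[of u] triple_map_proj(2)[of v] uv by (metis U_inv(1))
        show "snd (snd u) = snd (snd v)"
          using triple_map_proj(3)[of u] triple_map_proj(3)[of v] uv by (metis S_inv(2))
      qed
    qed
    show "surj (triple_map S U)"
    proof (rule surjI)
      fix v :: "'l2 dual \<times> 'a2 \<times> 'l2"
      have l: "linear (\<lambda>Y. dual_apply (fst v) (S Y))"
        using linear_compose[OF S(1) linear_dual_apply[of "fst v"]] by (simp add: o_def)
      show "triple_map S U (Dual (\<lambda>Y. dual_apply (fst v) (S Y)), U (fst (snd v)), inv S (snd (snd v))) = v"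
        by (rule c2.D_eqI) (simp_all add: triple_map_proj dual_apply_Dual[OF l] S_inv U_inv)
    qed
  qed
  have pU: "pairing M2 (inv U A) B = pairing M1 A (U B)" "pairing M2 B (inv U A) = pairing M1 (U B) A" for A B
    using U(3)[of "inv U A" B] U(3)[of B "inv U A"] by (simp_all add: U_inv)
  have rU: "U (rho M2 Y A) = rho M1 (inv S Y) (U A)" for Y A using U(5)[of "inv S Y" A] by (simp add: S_inv)
  have bS: "inv S (brac L2 (S X) Y) = brac L1 X (inv S Y)" for X Y
    using S(3)[of X "inv S Y"] S_inv by metis
  have rU': "rho M2 (S X) (inv U A) = inv U (rho M1 X A)" for X A
    using U(5)[of X "inv U A"] U_inv by metis
  have tS: "inv S (theta L2 Y) = theta L1 (inv S Y)" for Y using S(4)[of "inv S Y"] S_inv by metis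
  have tU: "mtheta M2 (inv U A) = inv U (mtheta M1 A)" for A using U(4)[of "inv U A"] U_inv by metis
  have "triple_map S U (brac p.D u v) = brac c2.D (triple_map S U u) (triple_map S U v)" for u v
  proof (rule c2.D_eqI)
    fix Y
    show "dual_apply (fst (triple_map S U (brac p.D u v))) Y
        = dual_apply (fst (brac c2.D (triple_map S U u) (triple_map S U v))) Y"
      by (simp add: triple_map_proj p.D_brac_proj c2.D_brac_proj pU rU bS S_inv U_inv)
    show "fst (snd (triple_map S U (brac p.D u v)))
        = fst (snd (brac c2.D (triple_map S U u) (triple_map S U v)))"
      by (simp add: triple_map_proj p.D_brac_proj c2.D_brac_proj rU' U_inv linear_expand[OF linv(2)])
    show "snd (snd (triple_map S U (brac p.D u v)))
        = snd (snd (brac c2.D (triple_map S U u) (triple_map S U v)))"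
      by (simp add: triple_map_proj p.D_brac_proj c2.D_brac_proj S(3))
  qed
  moreover have "form c2.D (triple_map S U u) (triple_map S U v) = form p.D u v" for u v
    by (simp add: triple_map_proj p.D_form_proj c2.D_form_proj pU U_inv S_inv)
  moreover have "triple_map S U (theta p.D u) = theta c2.D (triple_map S U u)" for u
    by (rule c2.D_eqI) (simp_all add: triple_map_proj p.D_theta_proj c2.D_theta_proj tS tU S(4))
  ultimately show ?thesis using lin bij by (simp add: metric_lie_iso_def)
qed

end

definition lower :: "('z \<times> 'a \<times> 'l::zero) set" where
  "lower = {u. snd (snd u) = 0}"

text \<open>An isometry preserving \<open>lower = L* \<oplus> M\<close> preserves its orthogonal complement \<open>L*\<close> as well. So \<open>F\<close>
  induces \<open>S\<close> on \<open>L\<close> and an isometry \<open>V\<close> on \<open>M\<close>, compatible with all structures; \<open>U\<close> is the inverse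
  of \<open>V\<close>. After composition with the inverse of \<open>triple_map S U\<close> the isomorphism is the identity on the
  graded pieces, hence a shear, and the cocycles are equivalent.\<close>

lemma filtered_isomorphism_descends:
  fixes F :: "'l1::findim_real_vector dual \<times> 'a1::findim_real_vector \<times> 'l1 \<Rightarrow>
      'l2::findim_real_vector dual \<times> 'a2::findim_real_vector \<times> 'l2"
  assumes c1: "quad_cochain L1 M1 \<alpha>1 \<gamma>1" and c2: "quad_cochain L2 M2 \<alpha>2 \<gamma>2"
    and F: "metric_lie_iso (standard_model L1 M1 (\<alpha>1, \<gamma>1)) (standard_model L2 M2 (\<alpha>2, \<gamma>2)) F"
    and low: "F ` lower = lower"
  shows "\<exists>S U. triple_isomorphism L1 M1 L2 M2 S U \<and>
      quad_pullback S U (\<alpha>2, \<gamma>2) \<in> quad_class L1 M1 (\<alpha>1, \<gamma>1)"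
proof -
  interpret c1: quad_cochain L1 M1 \<alpha>1 \<gamma>1 by (rule c1)
  interpret c2: quad_cochain L2 M2 \<alpha>2 \<gamma>2 by (rule c2)
  have F: "linear F" "bij F" "\<And>X Y. F (brac c1.D X Y) = brac c2.D (F X) (F Y)"
    "\<And>X Y. form c2.D (F X) (F Y) = form c1.D X Y" "\<And>X. F (theta c1.D X) = theta c2.D (F X)"
    and iso: "metric_lie_iso c1.D c2.D F"
    using F by (auto simp: metric_lie_iso_def)
  have surj: "\<exists>u. F u = v" for v using F(2) by (metis bij_pointE)
  have low1: "snd (snd (F u)) = 0" if "snd (snd u) = 0" for u
    using low that unfolding lower_def by blast
  have low2: "snd (snd u) = 0" if "snd (snd (F u)) = 0" for u
  proof -
    have "F u \<in> F ` lower" using that low by (simp add: lower_def)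
    then show ?thesis using F(2) by (auto simp: lower_def bij_def inj_eq)
  qed
  \<comment> \<open>\<open>F\<close> and its inverse preserve \<open>L*\<close>, the orthogonal complement of \<open>lower\<close>.\<close>
  have bottom: "snd (F u) = (0, 0)" if u: "snd u = (0, 0)" for u
  proof -
    have 1: "snd (snd (F u)) = 0" using u low1[of u] by simp
    have "pairing M2 (fst (snd (F u))) B = pairing M2 0 B" for B
    proof -
      obtain v where v: "F v = (0, B, 0)" using surj by blast
      have "snd (snd v) = 0" using low2[of v] v by simp
      then have "form c1.D u v = 0" using u by (simp add: c1.D_form_proj c1.expand)
      then have "form c2.D (F u) (F v) = 0" by (simp add: F(4))
      then show ?thesis using v 1 by (simp add: c2.D_form_proj c2.expand)
    qed
    then have "fst (snd (F u)) = 0" by (rule c2.sp_eqI)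
    with 1 show ?thesis by (simp add: prod_eq_iff)
  qed
  have bottom2: "fst (snd u) = 0" if u: "snd (F u) = (0, 0)" for u
  proof (rule c1.sp_eqI)
    fix B
    have 1: "snd (snd u) = 0" using u low2[of u] by simp
    have "snd (snd (F (0, B, 0))) = 0" using low1[of "(0, B, 0)"] by simp
    then have "form c2.D (F u) (F (0, B, 0)) = 0" using u by (simp add: c2.D_form_proj c2.expand)
    then have "form c1.D u (0, B, 0) = 0" by (simp add: F(4))
    then show "pairing M1 (fst (snd u)) B = pairing M1 0 B"
      using 1 by (simp add: c1.D_form_proj c1.expand)
  qed
  define S where "S X = snd (snd (F (0, 0, X)))" for X
  define V where "V A = fst (snd (F (0, A, 0)))" for A
  have split1: "F u = F (fst u, fst (snd u), 0) + F (0, 0, snd (snd u))" for u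
    by (cases u) (simp flip: linear_add[OF F(1)])
  have FS: "snd (snd (F u)) = S (snd (snd u))" for u
    using split1[of u] low1[of "(fst u, fst (snd u), 0)"] by (simp add: S_def)
  have FV: "fst (snd (F u)) = V (fst (snd u))" if "snd (snd u) = 0" for u
  proof -
    have "u = (fst u, 0, 0) + (0, fst (snd u), 0)" using that by (simp add: prod_eq_iff)
    then have "F u = F (fst u, 0, 0) + F (0, fst (snd u), 0)" using linear_add[OF F(1)] by metis
    then show ?thesis using bottom[of "(fst u, 0, 0)"] by (simp add: V_def)
  qed
  have lin_S: "linear S" and lin_V: "linear V"
  proof -
    have "(0 :: 'l1 dual, 0 :: 'a1, X + Y) = (0, 0, X) + (0, 0, Y)"
      "(0 :: 'l1 dual, 0 :: 'a1, c *\<^sub>R X) = c *\<^sub>R (0, 0, X)"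
      "(0 :: 'l1 dual, A + B, 0 :: 'l1) = (0, A, 0) + (0, B, 0)"
      "(0 :: 'l1 dual, c *\<^sub>R A, 0 :: 'l1) = c *\<^sub>R (0, A, 0)" for X Y :: 'l1 and A B :: 'a1 and c
      by simp_all
    then show "linear S" "linear V" unfolding S_def V_def
      by (intro linearI; simp only: linear_add[OF F(1)] linear_cmul[OF F(1)] fst_add snd_add
        fst_scaleR snd_scaleR)+
  qed
  have bij_S: "bij S"
  proof (rule bijI)
    have "X = 0" if "S X = 0" for X using low2[of "(0, 0, X)"] that by (simp add: S_def)
    then show "inj S" using linear_injective_0[OF lin_S] by blast
    have "\<exists>X. S X = Y" for Y using surj[of "(0, 0, Y)"] FS by (metis snd_conv)
    then show "surj S" by (metis surjI)
  qed
  have bij_V: "bij V"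
  proof (rule bijI)
    have "A = 0" if "V A = 0" for A
    proof -
      have "snd (F (0, A, 0)) = (0, 0)" using that low1[of "(0, A, 0)"] by (simp add: V_def prod_eq_iff)
      then show ?thesis using bottom2[of "(0, A, 0)"] by simp
    qed
    then show "inj V" using linear_injective_0[OF lin_V] by blast
    have "\<exists>A. V A = B" for B
    proof -
      obtain u where u: "F u = (0, B, 0)" using surj by blast
      then have "snd (snd u) = 0" using low2[of u] by simp
      then show ?thesis using FV[of u] u by auto
    qed
    then show "surj V" by (metis surjI)
  qed
  have VI: "V (inv V B) = B" "inv V (V A) = A" for A B
    using bij_V by (simp_all add: bij_is_surj surj_f_inv_f bij_is_inj)
  have V_sp: "pairing M2 (V A) (V B) = pairing M1 A B" for A B
    using F(4)[of "(0, A, 0)" "(0, B, 0)"] low1[of "(0, A, 0)"] low1[of "(0, B, 0)"]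
    by (simp add: c2.D_form_proj c1.D_form_proj c1.expand c2.expand V_def)
  have V_theta: "V (mtheta M1 A) = mtheta M2 (V A)" for A
  proof -
    have "fst (snd (F (theta c1.D (0, A, 0)))) = fst (snd (theta c2.D (F (0, A, 0))))" by (simp only: F(5))
    then show ?thesis
      using FV[of "theta c1.D (0, A, 0)"] by (simp add: c2.D_theta_proj c1.D_theta_proj c1.theta_expand V_def)
  qed
  have V_rho: "V (rho M1 X A) = rho M2 (S X) (V A)" for X A
  proof -
    have "fst (snd (F (brac c1.D (0, 0, X) (0, A, 0)))) = fst (snd (brac c2.D (F (0, 0, X)) (F (0, A, 0))))"
      by (simp only: F(3))
    moreover have "fst (snd (F (brac c1.D (0, 0, X) (0, A, 0)))) = V (rho M1 X A)"
      using FV[of "brac c1.D (0, 0, X) (0, A, 0)"] by (simp add: c1.D_brac_proj c1.expand)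
    ultimately show ?thesis
      using low1[of "(0, A, 0)"] by (simp add: c2.D_brac_proj c2.expand V_def S_def)
  qed
  have S_br: "S (brac L1 X Y) = brac L2 (S X) (S Y)" for X Y
    using F(3)[of "(0, 0, X)" "(0, 0, Y)"] FS[of "brac c1.D (0, 0, X) (0, 0, Y)"]
    by (simp add: c2.D_brac_proj c1.D_brac_proj S_def)
  have S_theta: "S (theta L1 X) = theta L2 (S X)" for X
    using F(5)[of "(0, 0, X)"] FS[of "theta c1.D (0, 0, X)"]
    by (simp add: c2.D_theta_proj c1.D_theta_proj S_def)
  have tri: "triple_isomorphism L1 M1 L2 M2 S (inv V)"
    unfolding triple_isomorphism_def triple_morphism_def
  proof (intro conjI allI lin_S S_br S_theta bij_S linear_inv[OF lin_V bij_V] bij_imp_bij_inv[OF bij_V])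
    show "inj (inv V)" using bij_imp_bij_inv[OF bij_V] by (simp add: bij_def)
    fix A B X
    show "pairing M1 (inv V A) (inv V B) = pairing M2 A B" using V_sp[of "inv V A" "inv V B"] by (simp add: VI)
    show "inv V (mtheta M2 A) = mtheta M1 (inv V A)" using V_theta[of "inv V A"] VI by metis
    show "inv V (rho M2 (S X) A) = rho M1 X (inv V A)" using V_rho[of X "inv V A"] VI by metis
  qed
  interpret t: triple_iso_cochain L1 M1 L2 M2 \<alpha>2 \<gamma>2 S "inv V"
    by unfold_locales (rule tri)
  let ?P = "standard_model L1 M1 (t.\<alpha>p, t.\<gamma>p)" and ?G = "triple_map S (inv V)"
  note G = t.triple_map_iso
  have bij_G: "bij ?G" using G by (simp add: metric_lie_iso_def)
  have GI: "?G (inv ?G v) = v" for v using bij_G by (simp add: bij_is_surj surj_f_inv_f)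
  have iIV: "inv (inv V) = V" using inv_inv_eq[OF bij_V] .
  have "filtered_identity (inv ?G \<circ> F)"
    unfolding filtered_identity_def
  proof (intro conjI allI impI)
    fix u
    have 1: "S (snd (snd (inv ?G v))) = snd (snd v)" for v
      using t.triple_map_proj(3)[of "inv ?G v"] by (simp add: GI)
    have 2: "V (fst (snd (inv ?G v))) = fst (snd v)" for v
      using t.triple_map_proj(2)[of "inv ?G v"] by (simp add: GI iIV)
    show "snd (snd ((inv ?G \<circ> F) u)) = snd (snd u)"
      using 1[of "F u"] FS[of u] bij_S by (simp add: bij_def inj_eq)
    assume "snd (snd u) = 0"
    then show "fst (snd ((inv ?G \<circ> F) u)) = fst (snd u)"
      using 2[of "F u"] FV[of u] bij_V by (simp add: bij_def inj_eq)
  qed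
  then have "(t.\<alpha>p, t.\<gamma>p) \<in> quad_class L1 M1 (\<alpha>1, \<gamma>1)"
    by (rule c1.filtered_iso_is_shear[OF t.pullback_cochain
          metric_lie_iso_comp[OF iso metric_lie_iso_inv[OF G]]])
  then show ?thesis using tri by (auto simp: quad_pullback_def)
qed

section \<open>Symmetric triples\<close>

text \<open>The standard model has to satisfy \<open>[D\<^sub>-, D\<^sub>-] = D\<^sub>+\<close>. The orthogonal complement of the left side in
  \<open>D\<^sub>+\<close> consists, by invariance of the scalar product, of the elements of \<open>D\<^sub>+\<close> that commute with
  \<open>D\<^sub>-\<close>. The conditions force such an element to vanish component by component.\<close>

lemma plus_minus_decomposition:
  fixes t :: "'v::real_vector \<Rightarrow> 'v"
  assumes "linear t" "\<And>x. t (t x) = x"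
  obtains y z where "x = y + z" "t y = y" "t z = - z"
proof -
  let ?y = "(1/2) *\<^sub>R (x + t x)" and ?z = "(1/2) *\<^sub>R (x - t x)"
  have "x = ?y + ?z" by (simp add: algebra_simps flip: scaleR_add_left)
  moreover have "t ?y = ?y" "t ?z = - ?z"
    by (simp_all add: linear_expand[OF assms(1)] assms(2) algebra_simps)
  ultimately show ?thesis by (rule that)
qed

context lie_module
begin

text \<open>Under \<open>T1\<close> the Lie algebra is generated by the \<open>- 1\<close>-eigenspace, so identities that are stable
  under brackets need to be checked only there.\<close>

lemma T1_generates:
  assumes T1: "T1 L" and H: "subspace H" "\<And>X Y. X \<in> H \<Longrightarrow> Y \<in> H \<Longrightarrow> br X Y \<in> H"
    "\<And>X. \<theta> X = - X \<Longrightarrow> X \<in> H"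
  shows "X \<in> H"
proof -
  obtain Y Z where X: "X = Y + Z" "\<theta> Y = Y" "\<theta> Z = - Z"
    by (rule plus_minus_decomposition[OF lin_theta theta_theta])
  have "Y \<in> span {br X Y | X Y. X \<in> minus_space \<theta> \<and> Y \<in> minus_space \<theta>}"
    using T1 X(2) by (simp add: T1_def plus_space_def)
  moreover have "span {br X Y | X Y. X \<in> minus_space \<theta> \<and> Y \<in> minus_space \<theta>} \<subseteq> H"
    by (rule span_minimal[OF _ H(1)]) (auto simp: minus_space_def intro: H(2,3))
  ultimately show ?thesis using X H by (auto intro: subspace_add)
qed

lemma lin_rho: "\<forall>X. linear (\<rho> X)"
  using bil_rho by (simp add: bilinear_def)

lemma submodule_invariants: "submodule \<rho> (invariants M)"
  by (auto simp: submodule_def subspace_def invariants_def rho_expand)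

lemma submodule_action_image: "submodule \<rho> (action_image M)"
proof -
  have "\<rho> X A \<in> action_image M" for X A by (auto simp: action_image_def intro: span_base)
  then show ?thesis by (simp add: submodule_def action_image_def)
qed

lemma invariants_perp_action_image:
  assumes "A \<in> invariants M" "B \<in> action_image M" shows "sp A B = 0"
proof -
  have "subspace {B. sp A B = 0}" by (simp add: subspace_def sp_expand)
  moreover have "sp A (\<rho> X C) = 0" for X C
    using assms(1) sp_inv[of X A C] by (simp add: invariants_def sp_expand)
  ultimately have "action_image M \<subseteq> {B. sp A B = 0}"
    unfolding action_image_def by (intro span_minimal) auto
  then show ?thesis using assms(2) by auto
qed

end

locale semisimple_module = lie_module L M
  for L :: "'l::findim_real_vector inv_lie" and M :: "('l, 'a::findim_real_vector) orth_mod" +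
  assumes ss: "semisimple (rho M) UNIV"
begin

lemma complement:
  assumes "submodule \<rho> W"
  obtains C where "submodule \<rho> C" "W \<inter> C = {0}" "ssum W C = UNIV"
proof -
  have "{0} \<subseteq> W" using assms by (simp add: submodule_def subspace_0)
  then show ?thesis
    by (rule complement_submodule[OF ss[unfolded semisimple_def] assms _ subset_UNIV]) (rule that)
qed

lemma invariants_action_image: "ssum (invariants M) (action_image M) = UNIV"
proof -
  obtain C where C: "submodule \<rho> C" "action_image M \<inter> C = {0}" "ssum (action_image M) C = UNIV"
    by (rule complement[OF submodule_action_image])
  have "C \<subseteq> invariants M"
  proof
    fix A assume "A \<in> C"
    then have "\<rho> X A \<in> action_image M \<inter> C" for X
      using C(1) by (auto simp: action_image_def submodule_def intro: span_base)
    then show "A \<in> invariants M" using C(2) by (auto simp: invariants_def)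
  qed
  then have "ssum (action_image M) C \<subseteq> ssum (action_image M) (invariants M)" by (rule ssum_mono[OF order_refl])
  then show ?thesis using C(3) ssum_commute[of "invariants M"] by auto
qed

lemma invariants_int_action_image:
  assumes "A \<in> invariants M" "A \<in> action_image M" shows "A = 0"
proof (rule sp_eqI)
  fix B
  have "B \<in> ssum (invariants M) (action_image M)" by (simp add: invariants_action_image)
  then obtain C E where "B = C + E" "C \<in> invariants M" "E \<in> action_image M" by (rule ssumE)
  then show "sp A B = sp 0 B"
    using invariants_perp_action_image[OF assms(1)] invariants_perp_action_image[OF _ assms(2), of C]
      sp_sym[of A C] by (simp add: sp_expand)
qed

lemma inv_component:
  "inv_component M f X Y \<in> invariants M" "f X Y - inv_component M f X Y \<in> action_image M"
proof -
  let ?P = "\<lambda>A. A \<in> invariants M \<and> f X Y - A \<in> action_image M"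
  have sub: "subspace (invariants M)" "subspace (action_image M)"
    using submodule_invariants submodule_action_image by (auto simp: submodule_def)
  have "f X Y \<in> ssum (invariants M) (action_image M)" by (simp add: invariants_action_image)
  then obtain C E where CE: "f X Y = C + E" "C \<in> invariants M" "E \<in> action_image M" by (rule ssumE)
  have "\<exists>!A. ?P A"
  proof (rule ex1I[of _ C])
    show "?P C" using CE by simp
    fix A assume A: "?P A"
    have "E - (f X Y - A) \<in> action_image M"
      by (rule subspace_diff[OF sub(2) CE(3) conjunct2[OF A]])
    then have "A - C \<in> action_image M" by (simp add: CE(1))
    moreover have "A - C \<in> invariants M" by (rule subspace_diff[OF sub(1) conjunct1[OF A] CE(2)])
    ultimately have "A - C = 0" using invariants_int_action_image[of "A - C"] by simp
    then show "A = C" by simp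
  qed
  then have "?P (inv_component M f X Y)" unfolding inv_component_def by (rule theI')
  then show "inv_component M f X Y \<in> invariants M" "f X Y - inv_component M f X Y \<in> action_image M" by auto
qed

lemma sp_inv_component: "A \<in> invariants M \<Longrightarrow> sp A (inv_component M f X Y) = sp A (f X Y)"
  using invariants_perp_action_image[OF _ inv_component(2)[of f X Y], of A] by (simp add: sp_expand)

lemma sp_sum_inv_component:
  assumes "A \<in> invariants M"
  shows "sp A (\<Sum>(X, Y)\<leftarrow>ps. inv_component M f X Y) = (\<Sum>(X, Y)\<leftarrow>ps. sp A (f X Y))"
  by (induction ps) (auto simp: sp_expand sp_inv_component[OF assms])

end

locale semisimple_cocycle = quad_cocycle L M \<alpha> \<gamma> + semisimple_module L M
  for L :: "'l::findim_real_vector inv_lie" and M :: "('l, 'a::findim_real_vector) orth_mod" and \<alpha> \<gamma>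
begin

text \<open>Write \<open>u = Z + A + L0\<close>. Since \<open>u\<close> commutes with the \<open>- 1\<close>-eigenspace, \<open>L0\<close> is central and acts
  trivially on the module, and \<open>u\<close> is central in the standard model; then \<open>cond_A0\<close> gives
  \<open>L0 = 0\<close>. Now \<open>A\<close> is an invariant, orthogonal to the invariant components of \<open>\<alpha>\<close> on the kernel
  of the bracket, so \<open>cond_T2\<close> gives \<open>A = 0\<close>. Finally \<open>Z\<close> vanishes on brackets and, being fixed
  by the involution, on the \<open>- 1\<close>-eigenspace.\<close>

lemma central_plus_zero:
  assumes T1: "T1 L" and A0: "cond_A0 L M (\<alpha>, \<gamma>)" and T2: "cond_T2 L M (\<alpha>, \<gamma>)"
    and u: "theta D u = u" and com: "\<And>v. theta D v = - v \<Longrightarrow> brac D v u = 0"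
  shows "u = 0"
proof -
  obtain Z A L0 where uu: "u = (Z, A, L0)" by (rule prod_cases3)
  have th: "dual_apply Z (\<theta> Y) = dual_apply Z Y" "\<theta>a A = A" for Y
    using D_theta_proj(1)[of u Y] D_theta_proj(2)[of u] unfolding u by (simp_all add: uu)
  have anti_L: "theta D (0, 0, Y) = - (0, 0, Y)" if "\<theta> Y = - Y" for Y
    by (rule D_eqI) (simp_all add: D_theta_proj that expand mtheta_expand)
  have anti_A: "theta D (0, B, 0) = - (0, B, 0)" if "\<theta>a B = - B" for B
    by (rule D_eqI) (simp_all add: D_theta_proj that expand theta_expand)
  have comL: "brac D (0, 0, Y) u = 0" if "\<theta> Y = - Y" for Y by (rule com[OF anti_L[OF that]])
  have comA: "brac D (0, B, 0) u = 0" if "\<theta>a B = - B" for B by (rule com[OF anti_A[OF that]])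
  have central: "br Y L0 = 0" for Y
  proof -
    have "Y \<in> {Y. br Y L0 = 0}"
    proof (rule T1_generates[OF T1])
      show "subspace {Y. br Y L0 = 0}" by (simp add: subspace_def br_expand)
      fix X Y assume "X \<in> {Y. br Y L0 = 0}" "Y \<in> {Y. br Y L0 = 0}"
      then show "br X Y \<in> {Y. br Y L0 = 0}"
        using br_jacobi[of X Y L0] br_antisym[of L0 X] br_antisym[of L0 "br X Y"] by (simp add: br_expand)
    next
      fix Y assume "\<theta> Y = - Y"
      then show "Y \<in> {Y. br Y L0 = 0}"
        using arg_cong[OF comL[of Y], of "\<lambda>x. snd (snd x)"] by (simp add: D_brac_proj uu)
    qed
    then show ?thesis by simp
  qed
  have central': "br L0 Y = 0" for Y using central[of Y] br_antisym[of Y L0] by simp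
  have rho0: "\<rho> L0 B = 0" for B
  proof -
    \<comment> \<open>The kernel contains the \<open>- 1\<close>-eigenspace of the module. On a complement \<open>C\<close> of it the
      \<open>- 1\<close>-eigenspace of the Lie algebra acts trivially, as it exchanges the two eigenspaces; so all of
      the Lie algebra does, and in particular \<open>L0\<close>.\<close>
    let ?K = "{B. \<rho> L0 B = 0}"
    have subK: "submodule \<rho> ?K"
    proof -
      have "\<rho> L0 (\<rho> X B) = \<rho> X (\<rho> L0 B)" for X B
        using rho_br[of L0 X B] central'[of X] by (simp add: rho_expand)
      then show ?thesis by (auto simp: submodule_def subspace_def rho_expand)
    qed
    have minusK: "B \<in> ?K" if "\<theta>a B = - B" for B
      using arg_cong[OF comA[OF that], of "\<lambda>x. fst (snd x)"] by (simp add: D_brac_proj uu expand)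
    obtain C where C: "submodule \<rho> C" "?K \<inter> C = {0}" "ssum ?K C = UNIV"
      by (rule complement[OF subK])
    have subC: "subspace C" using C(1) by (simp add: submodule_def)
    have "\<rho> X B = 0" if B: "B \<in> C" for X B
    proof -
      have "X \<in> {X. \<forall>B\<in>C. \<rho> X B = 0}"
      proof (rule T1_generates[OF T1])
        show "subspace {X. \<forall>B\<in>C. \<rho> X B = 0}" by (simp add: subspace_def rho_expand)
        fix X Y assume "X \<in> {X. \<forall>B\<in>C. \<rho> X B = 0}" "Y \<in> {X. \<forall>B\<in>C. \<rho> X B = 0}"
        then show "br X Y \<in> {X. \<forall>B\<in>C. \<rho> X B = 0}" by (simp add: rho_br rho_expand)
      next
        fix X assume X: "\<theta> X = - X"
        have "\<rho> X B \<in> ?K \<inter> C" if B: "B \<in> C" for B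
        proof -
          obtain B1 B2 where B12: "B = B1 + B2" "\<theta>a B1 = B1" "\<theta>a B2 = - B2"
            by (rule plus_minus_decomposition[OF lin_mtheta mtheta_mtheta])
          have "\<theta>a (\<rho> X B1) = - \<rho> X B1" by (simp add: mtheta_rho X B12 rho_expand)
          then have "\<rho> X B1 \<in> ?K" by (rule minusK)
          moreover have "\<rho> X B2 \<in> ?K" using minusK[OF B12(3)] submodule_act[OF subK] by blast
          ultimately have "\<rho> X B \<in> ?K" by (simp add: B12 rho_expand)
          then show ?thesis using B submodule_act[OF C(1)] by blast
        qed
        then show "X \<in> {X. \<forall>B\<in>C. \<rho> X B = 0}" using C(2) by auto
      qed
      then show ?thesis using B by simp
    qed
    then have "C \<subseteq> ?K" by auto
    then have "C = {0}" using C(2) by blast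
    then have "B \<in> ?K" using C(3) ssumE[of B ?K C] by auto
    then show ?thesis by simp
  qed
  have alphaL0: "\<alpha> Y L0 + \<rho> Y A = 0" for Y
  proof -
    have "Y \<in> {Y. \<alpha> Y L0 + \<rho> Y A = 0}"
    proof (rule T1_generates[OF T1])
      show "subspace {Y. \<alpha> Y L0 + \<rho> Y A = 0}"
        by (auto simp: subspace_def expand simp flip: scaleR_add_right) (simp add: add.commute add.left_commute)
      fix X Y assume "X \<in> {Y. \<alpha> Y L0 + \<rho> Y A = 0}" "Y \<in> {Y. \<alpha> Y L0 + \<rho> Y A = 0}"
      then have "\<alpha> X L0 = - \<rho> X A" "\<alpha> Y L0 = - \<rho> Y A" by (simp_all add: eq_neg_iff_add_eq_0)
      then have "\<alpha> (br X Y) L0 = \<rho> Y (\<rho> X A) - \<rho> X (\<rho> Y A)"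
        using alpha_closed[of X Y L0] by (simp add: central rho0 expand)
      then show "br X Y \<in> {Y. \<alpha> Y L0 + \<rho> Y A = 0}" by (simp add: rho_br)
    next
      fix Y assume "\<theta> Y = - Y"
      then show "Y \<in> {Y. \<alpha> Y L0 + \<rho> Y A = 0}"
        using arg_cong[OF comL[of Y], of "\<lambda>x. fst (snd x)"] by (simp add: D_brac_proj uu expand)
    qed
    then show ?thesis by simp
  qed
  have lowcom: "brac D (Z', B, 0) u = 0" for Z' B
  proof (rule D_eqI)
    fix W
    have "\<alpha> L0 W = \<rho> W A" using alphaL0[of W] alpha_antisym[of W L0] by (simp add: eq_neg_iff_add_eq_0)
    then show "dual_apply (fst (brac D (Z', B, 0) u)) W = dual_apply (fst 0) W"
      by (simp add: D_brac_proj uu expand sp_inv central')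
  qed (simp_all add: D_brac_proj uu expand rho0)
  have allcom: "brac D (0, 0, Y) u = 0" for Y
  proof -
    have "Y \<in> {Y. brac D (0, 0, Y) u = 0}"
    proof (rule T1_generates[OF T1])
      have e: "(0 :: 'l dual, 0 :: 'a, X + Y) = (0, 0, X) + (0, 0, Y)"
        "(0 :: 'l dual, 0 :: 'a, c *\<^sub>R X) = c *\<^sub>R (0, 0, X)" for X Y :: 'l and c by simp_all
      show "subspace {Y. brac D (0, 0, Y) u = 0}"
        unfolding subspace_def mem_Collect_eq e bilinear_expand[OF bil_D_brac]
        by (simp add: bilinear_lzero[OF bil_D_brac, unfolded zero_prod_def] zero_prod_def)
      fix X Y assume XY: "X \<in> {Y. brac D (0, 0, Y) u = 0}" "Y \<in> {Y. brac D (0, 0, Y) u = 0}"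
      let ?w = "brac D (0, 0, X) (0, 0, Y)"
      have a: "brac D x y = - brac D y x" for x y
        using alternating_antisym[OF bil_D_brac] D_brac_same by blast
      have "brac D u ?w = 0"
        using D_jacobi[of "(0, 0, X)" "(0, 0, Y)" u] XY a[of u "(0, 0, X)"]
        by (simp add: bilinear_expand[OF bil_D_brac])
      then have "brac D ?w u = 0" using a[of ?w u] by simp
      moreover have "?w = (fst ?w, fst (snd ?w), 0) + (0, 0, br X Y)"
        using D_brac_proj(3)[of "(0, 0, X)" "(0, 0, Y)"] by (simp add: prod_eq_iff)
      ultimately have "brac D (0, 0, br X Y) u = 0"
        using lowcom bilinear_ladd[OF bil_D_brac] by (metis add_0)
      then show "br X Y \<in> {Y. brac D (0, 0, Y) u = 0}" by simp
    qed (simp add: comL)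
    then show ?thesis by simp
  qed
  have gammaL0: "\<gamma> Y L0 W = sp A (\<alpha> Y W) + dual_apply Z (br Y W)" for Y W
    using arg_cong[OF allcom[of Y], of "\<lambda>x. dual_apply (fst x) W"] by (simp add: D_brac_proj uu expand)
  have L0: "L0 = 0"
  proof -
    have c1: "L0 \<in> center L" by (simp add: center_def central')
    have c2: "\<alpha> X L0 = \<rho> X (- A)" for X using alphaL0[of X] by (simp add: eq_neg_iff_add_eq_0 rho_expand)
    have c3: "\<gamma> X L0 Y = - sp (- A) (\<alpha> X Y) + dual_apply Z (br X Y)" for X Y
      by (simp add: gammaL0 sp_expand)
    show ?thesis using A0 c1 rho0 c2 c3 unfolding cond_A0_def split_conv by blast
  qed
  have Ainv: "A \<in> invariants M" using alphaL0 by (simp add: L0 invariants_def alpha_expand)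
  have AZ: "sp A (\<alpha> Y W) = - dual_apply Z (br Y W)" for Y W
    using gammaL0[of Y W] by (simp add: L0 gamma_expand)
  have perpT2: "sp A B = 0" if B: "B \<in> invariants M" "\<theta>a B = B" for B
  proof -
    have "B \<in> image_of_kernel (minus_space \<theta>) br (inv_component M \<alpha>)"
      using T2 B by (auto simp: cond_T2_def plus_space_def)
    then obtain ps where ps: "B = (\<Sum>(X, Y)\<leftarrow>ps. inv_component M \<alpha> X Y)" "(\<Sum>(X, Y)\<leftarrow>ps. br X Y) = 0"
      by (auto simp: image_of_kernel_def)
    have "(\<Sum>(X, Y)\<leftarrow>ps. - dual_apply Z (br X Y)) = - dual_apply Z (\<Sum>(X, Y)\<leftarrow>ps. br X Y)" for ps
      by (induction ps) (auto simp: expand)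
    then show ?thesis using ps by (simp add: sp_sum_inv_component[OF Ainv] AZ expand)
  qed
  have A: "A = 0"
  proof (rule sp_eqI)
    fix B
    have "B \<in> ssum (invariants M) (action_image M)" by (simp add: invariants_action_image)
    then obtain C E where CE: "B = C + E" "C \<in> invariants M" "E \<in> action_image M" by (rule ssumE)
    obtain C1 C2 where C12: "C = C1 + C2" "\<theta>a C1 = C1" "\<theta>a C2 = - C2"
      by (rule plus_minus_decomposition[OF lin_mtheta mtheta_mtheta])
    have "\<theta>a C \<in> invariants M"
    proof -
      have "\<rho> X (\<theta>a C) = 0" for X
        using mtheta_rho[of "\<theta> X" C] CE(2) by (simp add: theta_theta invariants_def mtheta_expand)
      then show ?thesis by (simp add: invariants_def)
    qed
    then have "C + \<theta>a C \<in> invariants M"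
      using CE(2) submodule_invariants by (auto simp: submodule_def intro: subspace_add)
    moreover have "C + \<theta>a C = 2 *\<^sub>R C1" by (simp add: C12 mtheta_expand scaleR_2)
    ultimately have "(1/2) *\<^sub>R (2 *\<^sub>R C1) \<in> invariants M"
      using submodule_invariants by (metis submodule_def subspace_scale)
    then have "sp A C1 = 0" using perpT2 C12(2) by simp
    moreover have "sp A C2 = 0"
      using sp_mtheta[of A C2] th(2) C12(3) by (simp add: sp_expand)
    ultimately show "sp A B = sp 0 B"
      using invariants_perp_action_image[OF Ainv CE(3)] by (simp add: CE C12 sp_expand)
  qed
  have "Z = 0"
  proof (rule dual_eqI)
    fix X
    have "X \<in> {X. dual_apply Z X = 0}"
    proof (rule T1_generates[OF T1])
      show "subspace {X. dual_apply Z X = 0}" by (simp add: subspace_def expand)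
      show "br X Y \<in> {X. dual_apply Z X = 0}" for X Y using AZ[of X Y] by (simp add: A expand)
      show "X \<in> {X. dual_apply Z X = 0}" if "\<theta> X = - X" for X using th(1)[of X] that by (simp add: expand)
    qed
    then show "dual_apply Z X = dual_apply 0 X" by (simp add: dual_expand)
  qed
  then show ?thesis by (simp add: uu A L0 zero_prod_def)
qed

theorem standard_model_symmetric_triple:
  assumes T1: "T1 L" and A0: "cond_A0 L M (\<alpha>, \<gamma>)" and T2: "cond_T2 L M (\<alpha>, \<gamma>)"
  shows "symmetric_triple D"
proof -
  let ?B = "{brac D X Y | X Y. X \<in> minus_space (theta D) \<and> Y \<in> minus_space (theta D)}"
  let ?W = "span ?B"
  have fsym: "form D x y = form D y x" for x y using sp_D_form by (simp add: scalar_product_def)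
  have W_plus: "?W \<subseteq> plus_space (theta D)"
  proof (rule span_minimal)
    show "subspace (plus_space (theta D))"
      by (auto simp: subspace_def plus_space_def linear_expand[OF lin_D_theta])
    show "?B \<subseteq> plus_space (theta D)"
    proof
      fix w assume "w \<in> ?B"
      then obtain x y where "w = brac D x y" "theta D x = - x" "theta D y = - y"
        unfolding minus_space_def by blast
      then show "w \<in> plus_space (theta D)"
        by (simp add: plus_space_def D_theta_brac bilinear_lneg[OF bil_D_brac] bilinear_rneg[OF bil_D_brac])
    qed
  qed
  have pm: "form D x y = 0" if "theta D x = x" "theta D y = - y" for x y
    using D_form_theta[of x y] that by (simp add: bilinear_expand[OF bil_D_form])
  have "plus_space (theta D) \<subseteq> perp (form D) (perp (form D) ?W)"
  proof
    fix x assume x: "x \<in> plus_space (theta D)"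
    have "form D u x = 0" if u: "u \<in> perp (form D) ?W" for u
    proof -
      obtain p m where pmu: "u = p + m" "theta D p = p" "theta D m = - m"
        by (rule plus_minus_decomposition[OF lin_D_theta D_theta_theta])
      have pW: "form D w p = 0" if "w \<in> ?W" for w
      proof -
        have "form D w m = 0" using that W_plus pm[of w m] pmu(3) by (auto simp: plus_space_def)
        moreover have "form D w u = 0" using u that by (simp add: perp_def)
        ultimately show ?thesis by (simp add: pmu(1) bilinear_expand[OF bil_D_form])
      qed
      have "brac D v p = 0" if v: "theta D v = - v" for v
      proof -
        have m: "theta D (brac D v p) = - brac D v p"
          by (simp add: D_theta_brac v pmu(2) bilinear_expand[OF bil_D_brac])
        have "form D (brac D v p) y = 0" for y
        proof -
          obtain y1 y2 where y: "y = y1 + y2" "theta D y1 = y1" "theta D y2 = - y2"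
            by (rule plus_minus_decomposition[OF lin_D_theta D_theta_theta])
          have "brac D v y2 \<in> ?W" using v y(3) by (intro span_base) (auto simp: minus_space_def)
          then have "form D (brac D v p) y2 = 0"
            using pW D_form_invariant[of v p y2] fsym[of p] by simp
          moreover have "form D (brac D v p) y1 = 0" using pm[OF y(2) m] fsym by simp
          ultimately show ?thesis by (simp add: y bilinear_expand[OF bil_D_form])
        qed
        then show ?thesis using sp_D_form by (auto simp: scalar_product_def nondegenerate_on_def)
      qed
      then have "p = 0" by (rule central_plus_zero[OF T1 A0 T2 pmu(2)])
      then show ?thesis using pm[of x m] x pmu fsym by (simp add: plus_space_def)
    qed
    then show "x \<in> perp (form D) (perp (form D) ?W)" by (simp add: perp_def)
  qed
  then have "T1 D"
    using W_plus perp_perp[OF sp_D_form subspace_span, of ?B] by (simp add: T1_def subset_antisym)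
  then show ?thesis
    using D_lie sp_D_form D_form_invariant D_form_theta by (simp add: symmetric_triple_def)
qed

end

lemma symmetric_triple_iso_transfer:
  assumes iso: "metric_lie_iso G H F" and st: "symmetric_triple G" and lie: "lie_algebra_with_involution H"
    and sp: "scalar_product (form H)"
  shows "symmetric_triple H"
proof -
  have F: "linear F" "bij F" "\<And>X Y. F (brac G X Y) = brac H (F X) (F Y)"
    "\<And>X Y. form H (F X) (F Y) = form G X Y" "\<And>X. F (theta G X) = theta H (F X)"
    using iso by (auto simp: metric_lie_iso_def)
  have surj: "\<exists>x. y = F x" for y using F(2) by (metis bij_pointE)
  have inj: "F x = F y \<longleftrightarrow> x = y" for x y using F(2) by (simp add: bij_def inj_eq)
  have inv: "form H (brac H X Y) Z = - form H Y (brac H X Z)" for X Y Z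
  proof -
    obtain x y z where "X = F x" "Y = F y" "Z = F z" using surj by metis
    then show ?thesis using st by (simp add: symmetric_triple_def F(3,4)[symmetric])
  qed
  have th: "form H (theta H X) (theta H Y) = form H X Y" for X Y
  proof -
    obtain x y where "X = F x" "Y = F y" using surj by metis
    then show ?thesis using st by (simp add: symmetric_triple_def F(4,5)[symmetric])
  qed
  have minus: "minus_space (theta H) = F ` minus_space (theta G)"
  proof -
    have "F x \<in> minus_space (theta H) \<longleftrightarrow> x \<in> minus_space (theta G)" for x
      using inj[of "theta G x" "- x"] by (simp add: minus_space_def F(5) linear_neg[OF F(1)])
    then have "y \<in> minus_space (theta H) \<longleftrightarrow> y \<in> F ` minus_space (theta G)" for y
      using surj[of y] inj_image_mem_iff[OF bij_is_inj[OF F(2)]] by metis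
    then show ?thesis by (rule Set.set_eqI)
  qed
  have plus: "plus_space (theta H) = F ` plus_space (theta G)"
  proof -
    have "F x \<in> plus_space (theta H) \<longleftrightarrow> x \<in> plus_space (theta G)" for x
      using inj[of "theta G x" "x"] by (simp add: plus_space_def F(5))
    then have "y \<in> plus_space (theta H) \<longleftrightarrow> y \<in> F ` plus_space (theta G)" for y
      using surj[of y] inj_image_mem_iff[OF bij_is_inj[OF F(2)]] by metis
    then show ?thesis by (rule Set.set_eqI)
  qed
  have "{brac H X Y | X Y. X \<in> minus_space (theta H) \<and> Y \<in> minus_space (theta H)} =
      F ` {brac G X Y | X Y. X \<in> minus_space (theta G) \<and> Y \<in> minus_space (theta G)}" (is "?BH = F ` ?BG")
  proof (intro subset_antisym subsetI)
    fix z assume "z \<in> ?BH"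
    then obtain x y where xy: "z = brac H (F x) (F y)" "x \<in> minus_space (theta G)" "y \<in> minus_space (theta G)"
      unfolding minus by blast
    then have "z = F (brac G x y)" by (simp add: F(3))
    then show "z \<in> F ` ?BG" using xy(2,3) by blast
  next
    fix z assume "z \<in> F ` ?BG"
    then obtain x y where xy: "z = F (brac G x y)" "x \<in> minus_space (theta G)" "y \<in> minus_space (theta G)"
      by blast
    then have "z = brac H (F x) (F y)" by (simp add: F(3))
    then show "z \<in> ?BH" using xy(2,3) minus by blast
  qed
  then have "T1 H" using st linear_span_image[OF F(1)] plus by (simp add: T1_def symmetric_triple_def)
  then show ?thesis using lie sp inv th by (simp add: symmetric_triple_def)
qed

section \<open>The canonical coisotropic ideal\<close>

(* From here on a radical is known only through its minimality. *)
declare R.simps(2) [simp del]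

text \<open>The first radical is the smallest ideal with a semi-simple quotient of the adjoint module. This is
  the only input from the structure theory of Lie algebras; it is needed to show that the maximal
  submodule in \<open>cond_B\<close> is \<open>bk\<close>.\<close>

lemma (in semisimple_module) rho_radical:
  assumes "X \<in> R L (Suc 0)" shows "\<rho> X A = 0"
proof -
  interpret r: representation br \<rho>
    using bil_br br_same br_jacobi bil_rho rho_br by unfold_locales
  have lin: "\<forall>X. linear (br X)" by (rule r.lin_br)
  have "R L (Suc 0) \<subseteq> r.ker"
  proof (rule r.semisimple_trivial_on_radical[OF ss submodule_R[OF lin]])
    show "R L (Suc 0) \<subseteq> I" if "submodule br I" "semisimple_quotient br UNIV I" for I
      by (rule R_Suc_minimal[OF lin that(1)]) (use that(2) in simp_all)
  qed
  then show ?thesis using assms by (auto simp: r.ker_def)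
qed


text \<open>\<open>A / (A \<inter> W)\<close> is a submodule of \<open>V / W\<close>.\<close>

lemma semisimple_quotient_restrict:
  assumes lin: "\<forall>X. linear (act X)" and V: "submodule act V" and W: "submodule act W" "W \<subseteq> V"
    and A: "submodule act A" "A \<subseteq> V" and ss: "semisimple_quotient act V W"
  shows "semisimple_quotient act A (A \<inter> W)"
proof -
  have sub: "subspace V" "subspace W" "subspace A" using V W A by (auto simp: submodule_def)
  have "semisimple_quotient act (ssum A W) W"
    by (rule semisimple_quotient_sub[OF ss submodule_ssum[OF lin A(1) W(1)] ssum_upper2[OF sub(3)]
          ssum_least[OF sub(1) A(2) W(2)]])
  then show ?thesis using semisimple_quotient_second_iso[OF lin A(1) W(1)] by simp
qed

text \<open>\<open>(A + B) / (W + B)\<close> is a quotient of \<open>A / W\<close>.\<close>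

lemma semisimple_quotient_add:
  assumes lin: "\<forall>X. linear (act X)" and A: "submodule act A" and W: "submodule act W" "W \<subseteq> A"
    and B: "submodule act B" and ss: "semisimple_quotient act A W"
  shows "semisimple_quotient act (ssum A B) (ssum W B)"
proof -
  have sub: "subspace A" "subspace W" "subspace B" using A W B by (auto simp: submodule_def)
  note WB = submodule_ssum[OF lin W(1) B]
  have "semisimple_quotient act A (A \<inter> ssum W B)"
    using W(2) ssum_upper1[OF sub(3), of W]
    by (intro semisimple_quotient_quot[OF lin ss submodule_Int[OF A WB] _ _ sub(1)]) auto
  then have "semisimple_quotient act (ssum A (ssum W B)) (ssum W B)"
    using semisimple_quotient_second_iso[OF lin A WB] by simp
  moreover have "ssum A (ssum W B) = ssum A B"
  proof
    have "ssum W B \<subseteq> ssum A B" by (rule ssum_mono[OF W(2) order_refl])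
    then show "ssum A (ssum W B) \<subseteq> ssum A B"
      by (rule ssum_least[OF subspace_ssum[OF sub(1,3)] ssum_upper1[OF sub(3)]])
    show "ssum A B \<subseteq> ssum A (ssum W B)" by (rule ssum_mono[OF order_refl ssum_upper2[OF sub(2)]])
  qed
  ultimately show ?thesis by simp
qed

text \<open>Built from the bracket and the scalar product alone, hence preserved by isomorphisms. It plays the
  role of \<open>L* \<oplus> M\<close> in a metric Lie algebra that is not given as a standard model.\<close>

definition canonical_coisotropic :: "'g::findim_real_vector inv_metric_lie \<Rightarrow> 'g set" where
  "canonical_coisotropic G = (\<Inter>k. ssum (R G k) (perp (form G) (R G k)))"

lemma metric_lie_iso_R_subset:
  assumes iso: "metric_lie_iso G H F" and lG: "\<forall>X. linear (brac G X)" and lH: "\<forall>X. linear (brac H X)"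
    and k: "F ` R G k = R H k"
  shows "R H (Suc k) \<subseteq> F ` R G (Suc k)"
proof -
  have F: "linear F" "bij F" "\<And>X Y. F (brac G X Y) = brac H (F X) (F Y)"
    using iso by (auto simp: metric_lie_iso_def)
  have inj: "F x = 0 \<Longrightarrow> x = 0" for x
    using F(2) linear_0[OF F(1)] by (metis bij_def injD)
  have sub: "submodule (brac G) (R G k)" "submodule (brac G) (R G (Suc k))"
    using submodule_R[OF lG] by blast+
  have "semisimple_quotient (brac H) (F ` R G k) (F ` R G (Suc k))"
  proof (subst semisimple_quotient_image[where act = "brac G" and \<phi> = F])
    show "semisimple_quotient (brac G) (R G k) (R G (Suc k))" by (rule R_Suc_semisimple[OF lG])
    show "R G (Suc k) \<subseteq> R G k" by (rule R_Suc_subset[OF lG])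
    show "v \<in> R G (Suc k)" if "F v = 0" for v using inj[OF that] sub(2) by (simp add: submodule_def subspace_0)
    show "surj F" using F(2) by (simp add: bij_def)
  qed (use F sub in auto)
  moreover have "submodule (brac H) (F ` R G (Suc k))"
    unfolding submodule_def
  proof (intro conjI allI ballI)
    show "subspace (F ` R G (Suc k))"
      using linear_subspace_image[OF F(1)] sub(2) by (simp add: submodule_def)
    fix Y v assume "v \<in> F ` R G (Suc k)"
    then obtain u where u: "u \<in> R G (Suc k)" "v = F u" by blast
    obtain X where X: "Y = F X" using F(2) by (metis bij_pointE)
    have "brac H Y v = F (brac G X u)" by (simp add: X u F(3))
    then show "brac H Y v \<in> F ` R G (Suc k)" using submodule_act[OF sub(2) u(1)] by blast
  qed
  moreover have "F ` R G (Suc k) \<subseteq> R H k" using R_Suc_subset[OF lG, of k] k by blast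
  ultimately show ?thesis using R_Suc_minimal[OF lH] k by metis
qed

lemma metric_lie_iso_R:
  assumes iso: "metric_lie_iso G H F" and lG: "\<forall>X. linear (brac G X)" and lH: "\<forall>X. linear (brac H X)"
  shows "F ` R G k = R H k"
proof (induction k)
  case 0 then show ?case using iso by (simp add: metric_lie_iso_def bij_def)
next
  case (Suc k)
  have bij: "bij F" using iso by (simp add: metric_lie_iso_def)
  have "inv F ` R H k = R G k"
    using Suc bij by (metis bij_is_inj image_inv_f_f)
  from metric_lie_iso_R_subset[OF metric_lie_iso_inv[OF iso] lH lG this]
  have "F ` R G (Suc k) \<subseteq> F ` inv F ` R H (Suc k)" by (rule image_mono)
  then have "F ` R G (Suc k) \<subseteq> R H (Suc k)"
    using bij by (simp add: bij_is_surj image_f_inv_f)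
  then show ?case using metric_lie_iso_R_subset[OF iso lG lH Suc] by blast
qed

lemma metric_lie_iso_canonical:
  assumes iso: "metric_lie_iso G H F" and lG: "\<forall>X. linear (brac G X)" and lH: "\<forall>X. linear (brac H X)"
  shows "F ` canonical_coisotropic G = canonical_coisotropic H"
proof -
  have F: "linear F" "bij F" "\<And>X Y. form H (F X) (F Y) = form G X Y"
    using iso by (auto simp: metric_lie_iso_def)
  have perp: "F ` perp (form G) W = perp (form H) (F ` W)" for W
  proof (rule Set.set_eqI)
    fix y
    obtain x where x: "y = F x" using F(2) by (metis bij_pointE)
    have "F x \<in> F ` perp (form G) W \<longleftrightarrow> x \<in> perp (form G) W"
      by (rule inj_image_mem_iff[OF bij_is_inj[OF F(2)]])
    then show "y \<in> F ` perp (form G) W \<longleftrightarrow> y \<in> perp (form H) (F ` W)" by (simp add: x perp_def F(3))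
  qed
  have sum: "F ` ssum A B = ssum (F ` A) (F ` B)" for A B
  proof
    show "F ` ssum A B \<subseteq> ssum (F ` A) (F ` B)"
      by (auto elim!: ssumE simp: linear_add[OF F(1)] intro!: ssumI)
    show "ssum (F ` A) (F ` B) \<subseteq> F ` ssum A B"
    proof
      fix z assume "z \<in> ssum (F ` A) (F ` B)"
      then obtain a b where "z = F a + F b" "a \<in> A" "b \<in> B" by (blast elim: ssumE)
      then have "z = F (a + b)" "a + b \<in> ssum A B" by (simp_all add: linear_add[OF F(1)] ssumI)
      then show "z \<in> F ` ssum A B" by blast
    qed
  qed
  show ?thesis
    unfolding canonical_coisotropic_def
    by (simp add: bij_image_INT[OF F(2)] sum perp metric_lie_iso_R[OF iso lG lH])
qed

definition dual_part :: "('z \<times> 'a::zero \<times> 'l::zero) set" where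
  "dual_part = {u. snd u = 0}"

context semisimple_cocycle
begin

\<comment> \<open>The series \<open>SD\<close> dual to the radical series \<open>RD\<close> is the socle series: by \<open>SD_semisimple\<close>
  and \<open>SD_maximal\<close> below, \<open>SD (Suc k) / SD k\<close> is the largest semi-simple submodule modulo \<open>SD k\<close>.\<close>
abbreviation pr :: "'l dual \<times> 'a \<times> 'l \<Rightarrow> 'l" where "pr u \<equiv> snd (snd u)"
abbreviation qr :: "'l dual \<times> 'a \<times> 'l \<Rightarrow> 'a" where "qr u \<equiv> fst (snd u)"
abbreviation RD :: "nat \<Rightarrow> ('l dual \<times> 'a \<times> 'l) set" where "RD k \<equiv> R D k"
abbreviation SD :: "nat \<Rightarrow> ('l dual \<times> 'a \<times> 'l) set" where "SD k \<equiv> perp (form D) (R D k)"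

lemma lin_L: "\<forall>X. linear (br X)" using bil_br by (simp add: bilinear_def)

lemma lin_pr: "linear pr" and lin_qr: "linear qr"
  by (rule linearI; simp)+

lemma surj_pr: "surj pr"
  by (rule surjI[of _ "\<lambda>X. (0, 0, X)"]) simp

lemma form_inv: "\<forall>x u v. form D (brac D x u) v = - form D u (brac D x v)"
  using D_form_invariant by blast

lemma form_sym: "form D x y = form D y x"
  using sp_D_form unfolding scalar_product_def by blast

lemma submodule_lower: "submodule (brac D) lower"
  by (auto simp: submodule_def subspace_def lower_def D_brac_proj expand)

lemma submodule_dual_part: "submodule (brac D) dual_part"
proof -
  have "snd (brac D x u) = 0" if "snd u = 0" for x u
    using that D_brac_proj(2,3)[of x u] by (simp add: prod_eq_iff expand)
  then show ?thesis by (simp add: submodule_def subspace_def dual_part_def)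
qed

lemma sub_lower: "subspace (lower :: ('l dual \<times> 'a \<times> 'l) set)" and sub_dual_part: "subspace (dual_part :: ('l dual \<times> 'a \<times> 'l) set)"
  and sub_RD: "subspace (RD k)" and sub_SD: "subspace (SD k)"
  and submodule_RD: "submodule (brac D) (RD k)" and submodule_SD: "submodule (brac D) (SD k)"
proof -
  show "submodule (brac D) (RD k)" by (rule submodule_R[OF lin_D_brac])
  then show "submodule (brac D) (SD k)" by (rule submodule_perp[OF bil_D_form form_inv])
  then show "subspace (SD k)" by (rule submodule_subspace)
  show "subspace (RD k)" by (rule submodule_subspace) fact
  show "subspace (lower :: ('l dual \<times> 'a \<times> 'l) set)" by (rule submodule_subspace[OF submodule_lower])
  show "subspace (dual_part :: ('l dual \<times> 'a \<times> 'l) set)" by (rule submodule_subspace[OF submodule_dual_part])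
qed

lemma dual_part_lower: "dual_part \<subseteq> lower"
  by (auto simp: dual_part_def lower_def)

lemma perp_lower: "perp (form D) lower = dual_part"
proof
  show "dual_part \<subseteq> perp (form D) lower"
    by (auto simp: perp_def lower_def dual_part_def D_form_proj expand)
  show "perp (form D) lower \<subseteq> dual_part"
  proof
    fix u assume u: "u \<in> perp (form D) lower"
    have "pr u = 0"
    proof (rule ccontr)
      assume "pr u \<noteq> 0"
      then obtain Z :: "'l dual" where Z: "dual_apply Z (pr u) = 1" by (rule dual_nonzero_witness)
      have "form D (Z, 0, 0) u = 0" using u by (simp add: perp_def lower_def)
      then show False using Z by (simp add: D_form_proj expand)
    qed
    moreover have "qr u = 0"
    proof (rule sp_eqI)
      fix B
      have "form D (0, B, 0) u = 0" using u by (simp add: perp_def lower_def)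
      then show "sp (qr u) B = sp 0 B" by (simp add: D_form_proj expand sp_sym[of B])
    qed
    ultimately show "u \<in> dual_part" by (simp add: dual_part_def prod_eq_iff)
  qed
qed

lemma perp_dual_part: "perp (form D) dual_part = lower"
  using perp_perp[OF sp_D_form sub_lower] by (simp add: perp_lower)

lemma dual_part_images:
  assumes "W \<subseteq> dual_part" "0 \<in> W" shows "qr ` W = {0}" "pr ` W = {0}"
proof -
  have "qr w = 0" "pr w = 0" if "w \<in> W" for w using assms(1) that by (auto simp: dual_part_def)
  moreover have "qr 0 \<in> qr ` W" "pr 0 \<in> pr ` W" using assms(2) by (rule imageI)+
  ultimately show "qr ` W = {0}" "pr ` W = {0}" by auto
qed

text \<open>The quotient is the module \<open>M\<close>, on which the standard model acts through \<open>L\<close>.\<close>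

lemma lower_over_dual_part: "semisimple_quotient (brac D) lower dual_part"
proof -
  have im: "qr ` lower = UNIV" "qr ` dual_part = {0}"
  proof -
    have "A \<in> qr ` lower" for A by (rule image_eqI[of _ _ "(0, A, 0)"]) (auto simp: lower_def)
    then show "qr ` lower = UNIV" by blast
    show "qr ` dual_part = {0}"
      by (rule dual_part_images(1)[OF order_refl subspace_0[OF sub_dual_part]])
  qed
  have "semisimple_quotient \<rho> (qr ` lower) (qr ` dual_part) \<longleftrightarrow> semisimple_quotient (brac D) lower dual_part"
  proof (rule semisimple_quotient_image[where \<phi> = pr])
    show "v \<in> dual_part" if "v \<in> lower" "qr v = 0" for v using that by (simp add: dual_part_def lower_def prod_eq_iff)
    show "qr (brac D X v) = \<rho> (pr X) (qr v)" if "v \<in> lower" for X v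
      using that by (simp add: lower_def D_brac_proj expand)
  qed (rule lin_qr submodule_lower submodule_dual_part dual_part_lower surj_pr)+
  then show ?thesis using ss by (simp add: im semisimple_def)
qed

lemma pr_preimage_submodule: "submodule br V \<Longrightarrow> submodule (brac D) (pr -` V)"
  by (auto simp: submodule_def D_brac_proj intro: linear_subspace_vimage[OF lin_pr])

lemma pr_image_submodule:
  assumes "submodule (brac D) V" shows "submodule br (pr ` V)"
  unfolding submodule_def
proof (intro conjI allI ballI)
  show "subspace (pr ` V)" using assms linear_subspace_image[OF lin_pr] by (simp add: submodule_def)
  fix X y assume "y \<in> pr ` V"
  then obtain v where v: "v \<in> V" "y = pr v" by blast
  have "br X y = pr (brac D (0, 0, X) v)" by (simp add: v D_brac_proj)
  then show "br X y \<in> pr ` V" using submodule_act[OF assms v(1)] by blast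
qed

lemma semisimple_preimage:
  assumes "submodule br V" "submodule br W" "W \<subseteq> V"
  shows "semisimple_quotient (brac D) (pr -` V) (pr -` W) \<longleftrightarrow> semisimple_quotient br V W"
proof -
  have "semisimple_quotient br (pr ` (pr -` V)) (pr ` (pr -` W)) \<longleftrightarrow> semisimple_quotient (brac D) (pr -` V) (pr -` W)"
  proof (rule semisimple_quotient_image[where \<phi> = pr])
    show "v \<in> pr -` W" if "pr v = 0" for v using that assms(2) by (simp add: submodule_def subspace_0)
    show "pr (brac D X v) = br (pr X) (pr v)" for X v by (simp add: D_brac_proj)
  qed (use assms lin_pr pr_preimage_submodule surj_pr in auto)
  then show ?thesis by (simp only: surj_image_vimage_eq[OF surj_pr])
qed

lemma lower_saturated:
  assumes "subspace A" "lower \<subseteq> A" shows "pr -` (pr ` A) = A"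
proof
  show "pr -` (pr ` A) \<subseteq> A"
  proof
    fix u assume "u \<in> pr -` (pr ` A)"
    then obtain v where v: "v \<in> A" "pr u = pr v" by auto
    have "u - v \<in> A" using v assms(2) by (auto simp: lower_def)
    then have "v + (u - v) \<in> A" using v(1) assms(1) by (intro subspace_add)
    then show "u \<in> A" by simp
  qed
qed auto

text \<open>Modulo \<open>lower\<close> the radical series of the standard model becomes the one of \<open>L\<close>, because the
  formation of the smallest ideal with semi-simple quotient commutes with surjections.\<close>

lemma RD_lower: "ssum (RD k) lower = pr -` R L k"
proof (induction k)
  case 0 then show ?case using ssum_upper1[OF sub_lower, of UNIV] by auto
next
  case (Suc k)
  note RL = submodule_R[OF lin_L]
  let ?B = "ssum (RD (Suc k)) lower"
  have subB: "submodule (brac D) ?B" by (rule submodule_ssum[OF lin_D_brac submodule_RD submodule_lower])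
  have RS: "RD (Suc k) \<subseteq> RD k" by (rule R_Suc_subset[OF lin_D_brac])
  have lowB: "lower \<subseteq> ?B" by (rule ssum_upper2[OF sub_RD])
  have satB: "pr -` (pr ` ?B) = ?B" by (rule lower_saturated[OF submodule_subspace[OF subB] lowB])
  have BP: "?B \<subseteq> pr -` R L k" unfolding Suc[symmetric] by (rule ssum_mono[OF RS order_refl])
  have "semisimple_quotient (brac D) (pr -` R L k) (pr -` (pr ` ?B))"
    unfolding satB Suc[symmetric]
    by (rule semisimple_quotient_add[OF lin_D_brac submodule_RD submodule_RD RS submodule_lower
          R_Suc_semisimple[OF lin_D_brac]])
  then have "semisimple_quotient br (R L k) (pr ` ?B)"
    using semisimple_preimage[OF RL pr_image_submodule[OF subB]] BP by auto
  then have "R L (Suc k) \<subseteq> pr ` ?B"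
    using BP by (intro R_Suc_minimal[OF lin_L pr_image_submodule[OF subB]]) auto
  then have 1: "pr -` R L (Suc k) \<subseteq> ?B" using satB by blast
  let ?W = "pr -` R L (Suc k)"
  have RLS: "R L (Suc k) \<subseteq> R L k" by (rule R_Suc_subset[OF lin_L])
  have "semisimple_quotient (brac D) (pr -` R L k) ?W"
    using semisimple_preimage[OF RL RL RLS] R_Suc_semisimple[OF lin_L] by blast
  then have "semisimple_quotient (brac D) (RD k) (RD k \<inter> ?W)"
    using ssum_upper1[OF sub_lower, of "RD k"] RLS Suc
    by (intro semisimple_quotient_restrict[OF lin_D_brac pr_preimage_submodule[OF RL]
          pr_preimage_submodule[OF RL] _ submodule_RD]) auto
  then have "RD (Suc k) \<subseteq> RD k \<inter> ?W"
    by (intro R_Suc_minimal[OF lin_D_brac submodule_Int[OF submodule_RD pr_preimage_submodule[OF RL]]]) auto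
  moreover have "lower \<subseteq> ?W" using RL[of "Suc k"] by (auto simp: lower_def submodule_def subspace_0)
  ultimately have "?B \<subseteq> ?W"
    using pr_preimage_submodule[OF RL[of "Suc k"]] by (intro ssum_least) (auto simp: submodule_def)
  with 1 show ?case by blast
qed

lemma SD_0: "SD 0 = {0}"
proof -
  have "u = 0" if "u \<in> SD 0" for u
  proof -
    have "form D u v = 0" for v using that form_sym[of u v] by (simp add: perp_def)
    then show ?thesis using sp_D_form unfolding scalar_product_def nondegenerate_on_def by blast
  qed
  then show ?thesis using subspace_0[OF sub_SD] by blast
qed

lemma SD_mono: "SD k \<subseteq> SD (Suc k)"
  by (rule perp_antimono[OF R_Suc_subset[OF lin_D_brac]])

lemma SD_semisimple: "semisimple_quotient (brac D) (SD (Suc k)) (SD k)"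
  by (rule semisimple_quotient_perp[OF sp_D_form form_inv submodule_RD submodule_RD
        R_Suc_subset[OF lin_D_brac] R_Suc_semisimple[OF lin_D_brac]])

text \<open>Dual to the minimality of the radicals.\<close>

lemma SD_maximal:
  assumes U: "submodule (brac D) U" and ss: "semisimple_quotient (brac D) U W" and W: "W \<subseteq> U" "W \<subseteq> SD k"
  shows "U \<subseteq> SD (Suc k)"
proof -
  have subU: "subspace U" using U by (rule submodule_subspace)
  have "semisimple_quotient (brac D) U (U \<inter> SD k)"
    using W by (intro semisimple_quotient_quot[OF lin_D_brac ss submodule_Int[OF U submodule_SD] _ _ subU]) auto
  then have "semisimple_quotient (brac D) (ssum U (SD k)) (SD k)"
    using semisimple_quotient_second_iso[OF lin_D_brac U submodule_SD] by blast
  then have "semisimple_quotient (brac D) (perp (form D) (SD k)) (perp (form D) (ssum U (SD k)))"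
    by (intro semisimple_quotient_perp[OF sp_D_form form_inv
          submodule_ssum[OF lin_D_brac U submodule_SD] submodule_SD ssum_upper2[OF subU]])
  moreover have pp: "perp (form D) (SD k) = RD k" by (rule perp_perp[OF sp_D_form sub_RD])
  moreover have "perp (form D) (ssum U (SD k)) = perp (form D) U \<inter> RD k"
    using perp_ssum[OF bil_D_form subU sub_SD, of k] pp by simp
  ultimately have "RD (Suc k) \<subseteq> perp (form D) U \<inter> RD k"
    by (intro R_Suc_minimal[OF lin_D_brac submodule_Int[OF submodule_perp[OF bil_D_form form_inv U] submodule_RD]]) auto
  then have "perp (form D) (perp (form D) U) \<subseteq> SD (Suc k)" by (intro perp_antimono) auto
  then show ?thesis by (simp add: perp_perp[OF sp_D_form subU])
qed

text \<open>The part of \<open>SD k\<close> in the dual space is the annihilator of the radical \<open>R L k\<close>: take orthogonal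
  complements in \<open>RD_lower\<close>.\<close>

lemma SD_dual_part:
  "u \<in> SD k \<inter> dual_part \<longleftrightarrow> snd u = 0 \<and> (\<forall>X\<in>R L k. dual_apply (fst u) X = 0)"
proof -
  have "SD k \<inter> dual_part = perp (form D) (pr -` R L k)"
    using perp_ssum[OF bil_D_form sub_RD sub_lower, of k] by (simp add: RD_lower perp_lower)
  moreover have "u \<in> perp (form D) (pr -` R L k) \<longleftrightarrow> snd u = 0 \<and> (\<forall>X\<in>R L k. dual_apply (fst u) X = 0)"
  proof
    assume u: "u \<in> perp (form D) (pr -` R L k)"
    then have "u \<in> dual_part" using calculation by blast
    then have s: "snd u = 0" by (simp add: dual_part_def)
    have "dual_apply (fst u) X = 0" if "X \<in> R L k" for X
    proof -
      have "form D (0, 0, X) u = 0" using u that by (simp add: perp_def)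
      then show ?thesis using s by (simp add: D_form_proj expand)
    qed
    with s show "snd u = 0 \<and> (\<forall>X\<in>R L k. dual_apply (fst u) X = 0)" by blast
  next
    assume "snd u = 0 \<and> (\<forall>X\<in>R L k. dual_apply (fst u) X = 0)"
    then show "u \<in> perp (form D) (pr -` R L k)" by (simp add: perp_def D_form_proj expand)
  qed
  ultimately show ?thesis by simp
qed

lemma submodule_SD_dual_part: "submodule (brac D) (SD k \<inter> dual_part)"
  by (rule submodule_Int[OF submodule_SD submodule_dual_part])

text \<open>The image of \<open>SD (Suc k) \<inter> lower\<close> in \<open>M\<close>. For positive \<open>k\<close> it turns out to be the maximal submodule
  in \<open>cond_B k\<close>, and \<open>bk 0\<close> is, under \<open>cond_A0\<close>, the orthogonal complement within the invariants of the subspace in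
  \<open>cond_B0\<close>.\<close>

definition bk :: "nat \<Rightarrow> 'a set" where "bk k = qr ` (SD (Suc k) \<inter> lower)"

lemma submodule_bk: "submodule \<rho> (bk k)"
  unfolding submodule_def
proof (intro conjI allI ballI)
  have m: "submodule (brac D) (SD (Suc k) \<inter> lower)" by (rule submodule_Int[OF submodule_SD submodule_lower])
  then show "subspace (bk k)"
    unfolding bk_def using linear_subspace_image[OF lin_qr] by (simp add: submodule_def)
  fix X B assume "B \<in> bk k"
  then obtain v where v: "v \<in> SD (Suc k) \<inter> lower" "B = qr v" unfolding bk_def by blast
  have "\<rho> X B = qr (brac D (0, 0, X) v)" using v by (simp add: D_brac_proj lower_def expand)
  then show "\<rho> X B \<in> bk k" unfolding bk_def using submodule_act[OF m v(1)] by blast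
qed

lemma bk_perp_zero:
  assumes nd: "nondegenerate_on sp (bk k)" and x: "x \<in> SD (Suc k)" "x \<in> lower"
    and orth: "\<And>y. y \<in> SD (Suc k) \<Longrightarrow> y \<in> lower \<Longrightarrow> form D x y = 0"
  shows "x \<in> dual_part"
proof -
  have "qr x \<in> bk k" using x by (auto simp: bk_def)
  moreover have "sp (qr x) B = 0" if "B \<in> bk k" for B
  proof -
    from that obtain y where y: "y \<in> SD (Suc k)" "y \<in> lower" "B = qr y" unfolding bk_def by blast
    show ?thesis using orth[OF y(1,2)] x(2) y(2,3) by (simp add: D_form_proj lower_def expand)
  qed
  ultimately have "qr x = 0" using nd by (auto simp: nondegenerate_on_def)
  then show ?thesis using x(2) by (simp add: dual_part_def lower_def prod_eq_iff)
qed

lemma SD_lower_semisimple: "semisimple_quotient (brac D) (SD (Suc k) \<inter> lower) (SD k \<inter> dual_part)"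
proof -
  let ?E = "SD (Suc k) \<inter> lower"
  have E: "submodule (brac D) ?E" by (rule submodule_Int[OF submodule_SD submodule_lower])
  have 1: "semisimple_quotient (brac D) ?E (?E \<inter> SD k)"
    by (rule semisimple_quotient_restrict[OF lin_D_brac submodule_SD submodule_SD SD_mono E _ SD_semisimple]) auto
  have 2: "semisimple_quotient (brac D) ?E (?E \<inter> dual_part)"
    by (rule semisimple_quotient_restrict[OF lin_D_brac submodule_lower submodule_dual_part dual_part_lower E _
          lower_over_dual_part]) auto
  have "semisimple_quotient (brac D) ?E ((?E \<inter> SD k) \<inter> (?E \<inter> dual_part))"
    by (rule semisimple_quotient_Int[OF lin_D_brac E submodule_Int[OF E submodule_SD] _
          submodule_Int[OF E submodule_dual_part] _ 1 2]) auto
  moreover have "(?E \<inter> SD k) \<inter> (?E \<inter> dual_part) = SD k \<inter> dual_part"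
    using SD_mono[of k] dual_part_lower by blast
  ultimately show ?thesis by simp
qed

subsection \<open>The conditions of degree 0\<close>

text \<open>The socle \<open>SD 1\<close> is a semi-simple module, so \<open>SD 1 \<inter> lower\<close> has a complementary ideal. Its elements
  commute with \<open>lower\<close>, which forces their components in \<open>L\<close> to be central; then they
  commute with everything, and \<open>cond_A0\<close> kills these components.\<close>

lemma SD_1_lower:
  assumes A0: "cond_A0 L M (\<alpha>, \<gamma>)"
  shows "SD (Suc 0) \<subseteq> lower"
proof -
  let ?S = "SD (Suc 0)"
  have m: "submodule (brac D) (?S \<inter> lower)" by (rule submodule_Int[OF submodule_SD submodule_lower])
  have z: "{0} \<subseteq> ?S \<inter> lower" using subspace_0[OF submodule_subspace[OF m]] by blast
  obtain E where E: "submodule (brac D) E" "{0} \<subseteq> E" "E \<subseteq> ?S" "?S \<inter> lower \<inter> E = {0}" "ssum (?S \<inter> lower) E = ?S"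
    by (rule complement_submodule[OF SD_semisimple[of 0, unfolded SD_0] m z Int_lower1])
  have E_low: "x = 0" if "x \<in> E" "x \<in> lower" for x using E(3,4) that by blast
  have anti: "brac D x y = - brac D y x" for x y
    using alternating_antisym[OF bil_D_brac] D_brac_same by blast
  have E_lower: "x \<in> lower" if x: "x \<in> E" for x
  proof -
    have com: "brac D y x = 0" if "y \<in> lower" for y
    proof (rule E_low)
      show "brac D y x \<in> E" by (rule submodule_act[OF E(1) x])
      have "brac D x y \<in> lower" by (rule submodule_act[OF submodule_lower that])
      then show "brac D y x \<in> lower" using anti[of y x] subspace_neg[OF sub_lower] by simp
    qed
    have central: "br (pr x) W = 0" for W
    proof (rule ccontr)
      assume "br (pr x) W \<noteq> 0"
      then obtain Z :: "'l dual" where Z: "dual_apply Z (br (pr x) W) = 1" by (rule dual_nonzero_witness)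
      have "brac D (Z, 0, 0) x = 0" by (rule com) (simp add: lower_def)
      then have "dual_apply (fst (brac D (Z, 0, 0) x)) W = 0" by (simp add: dual_expand)
      then show False using Z by (simp add: D_brac_proj expand)
    qed
    have all: "brac D y x = 0" for y
    proof (rule E_low)
      show "brac D y x \<in> E" by (rule submodule_act[OF E(1) x])
      show "brac D y x \<in> lower"
        using central[of "pr y"] br_antisym[of "pr x" "pr y"] by (simp add: lower_def D_brac_proj)
    qed
    have rho0: "\<rho> (pr x) A = 0" for A
      using arg_cong[OF all[of "(0, A, 0)"], of qr] by (simp add: D_brac_proj expand)
    have a: "\<alpha> X (pr x) = \<rho> X (- qr x)" for X
      using arg_cong[OF all[of "(0, 0, X)"], of qr] by (simp add: D_brac_proj expand eq_neg_iff_add_eq_0)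
    have g: "\<gamma> X (pr x) Y = - sp (- qr x) (\<alpha> X Y) + dual_apply (fst x) (br X Y)" for X Y
      using arg_cong[OF all[of "(0, 0, X)"], of "\<lambda>u. dual_apply (fst u) Y"] by (simp add: D_brac_proj expand)
    have "pr x \<in> center L" by (simp add: center_def central)
    then have "pr x = 0" using A0 rho0 a g unfolding cond_A0_def split_conv by blast
    then show ?thesis by (simp add: lower_def)
  qed
  have "ssum (?S \<inter> lower) E \<subseteq> lower" using E_lower by (intro ssum_least[OF sub_lower]) auto
  then show ?thesis using E(5) by simp
qed

text \<open>A socle element outside the dual space can be taken central. With components \<open>Z + B\<close> this means that
  \<open>B\<close> is invariant and \<open>\<langle>B, \<alpha>(X, Y)\<rangle> = - Z [X, Y]\<close>; a functional \<open>Z\<close> of this kind exists exactly if \<open>B\<close> is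
  orthogonal to the values of \<open>\<alpha>\<close> on the kernel of the bracket.\<close>

lemma bk_0:
  assumes A0: "cond_A0 L M (\<alpha>, \<gamma>)"
  shows "bk 0 = invariants M \<inter> perp sp (image_of_kernel UNIV br (inv_component M \<alpha>))"
proof
  let ?S = "SD (Suc 0)"
  let ?T = "image_of_kernel UNIV br (inv_component M \<alpha>)"
  have S_low: "?S \<subseteq> lower" by (rule SD_1_lower[OF A0])
  have m: "submodule (brac D) (?S \<inter> dual_part)" by (rule submodule_SD_dual_part)
  have z: "{0} \<subseteq> ?S \<inter> dual_part" using subspace_0[OF submodule_subspace[OF m]] by blast
  obtain E where E: "submodule (brac D) E" "{0} \<subseteq> E" "E \<subseteq> ?S" "?S \<inter> dual_part \<inter> E = {0}" "ssum (?S \<inter> dual_part) E = ?S"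
    by (rule complement_submodule[OF SD_semisimple[of 0, unfolded SD_0] m z Int_lower1])
  have E0: "x = 0" if "x \<in> E" "x \<in> dual_part" for x using E(3,4) that by blast
  have anti: "brac D x y = - brac D y x" for x y
    using alternating_antisym[OF bil_D_brac] D_brac_same by blast
  show "bk 0 \<subseteq> invariants M \<inter> perp sp ?T"
  proof
    fix B assume "B \<in> bk 0"
    then obtain u where u: "u \<in> ?S" "B = qr u" unfolding bk_def by blast
    then have "u \<in> ssum (?S \<inter> dual_part) E" using E(5) by simp
    then obtain v x where vx: "u = v + x" "v \<in> ?S \<inter> dual_part" "x \<in> E" by (rule ssumE)
    have B: "B = qr x" using vx u(2) by (simp add: dual_part_def)
    have x_low: "pr x = 0" using S_low E(3) vx(3) by (auto simp: lower_def)
    have com: "brac D y x = 0" if "y \<in> lower" for y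
    proof (rule E0)
      show "brac D y x \<in> E" by (rule submodule_act[OF E(1) vx(3)])
      show "brac D y x \<in> dual_part"
        using that x_low by (simp add: dual_part_def prod_eq_iff D_brac_proj lower_def expand)
    qed
    have inv: "\<rho> X B = 0" for X
    proof (rule sp_eqI)
      fix A
      have "dual_apply (fst (brac D (0, A, 0) x)) X = 0"
        using com[of "(0, A, 0)"] by (simp add: lower_def dual_expand)
      then have "sp (\<rho> X A) B = 0" by (simp add: D_brac_proj x_low B expand)
      then show "sp (\<rho> X B) A = sp 0 A" using sp_inv[of X B A] sp_sym[of B "\<rho> X A"] by (simp add: expand)
    qed
    have all: "brac D y x = 0" for y
    proof (rule E0)
      show "brac D y x \<in> E" by (rule submodule_act[OF E(1) vx(3)])
      show "brac D y x \<in> dual_part"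
        using x_low inv by (simp add: dual_part_def prod_eq_iff D_brac_proj B expand)
    qed
    have aZ: "sp B (\<alpha> X W) = - dual_apply (fst x) (br X W)" for X W
      using arg_cong[OF all[of "(0, 0, X)"], of "\<lambda>u. dual_apply (fst u) W"]
      by (simp add: D_brac_proj x_low B expand)
    have Binv: "B \<in> invariants M" using inv by (simp add: invariants_def)
    have "sp C B = 0" if "C \<in> ?T" for C
    proof -
      from that obtain ps where ps: "C = (\<Sum>(X, Y)\<leftarrow>ps. inv_component M \<alpha> X Y)" "(\<Sum>(X, Y)\<leftarrow>ps. br X Y) = 0"
        by (auto simp: image_of_kernel_def)
      have "(\<Sum>(X, Y)\<leftarrow>ps. - dual_apply (fst x) (br X Y)) = - dual_apply (fst x) (\<Sum>(X, Y)\<leftarrow>ps. br X Y)" for ps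
        by (induction ps) (auto simp: expand)
      then have "sp B C = 0" using ps by (simp add: sp_sum_inv_component[OF Binv] aZ expand)
      then show ?thesis by (simp add: sp_sym)
    qed
    then show "B \<in> invariants M \<inter> perp sp ?T" using Binv by (simp add: perp_def)
  qed
  show "invariants M \<inter> perp sp ?T \<subseteq> bk 0"
  proof
    fix B assume B: "B \<in> invariants M \<inter> perp sp ?T"
    \<comment> \<open>The graph of the functional \<open>[X, Y] \<mapsto> - \<langle>B, \<alpha>(X, Y)\<rangle>\<close> on the derived algebra.\<close>
    let ?G = "{(\<Sum>(X, Y)\<leftarrow>ps. br X Y, \<Sum>(X, Y)\<leftarrow>ps. - sp B (\<alpha> X Y)) | ps. True}"
    have scale: "(\<Sum>(X, Y)\<leftarrow>map (\<lambda>(X, Y). (c *\<^sub>R X, Y)) ps. br X Y) = c *\<^sub>R (\<Sum>(X, Y)\<leftarrow>ps. br X Y)"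
      "(\<Sum>(X, Y)\<leftarrow>map (\<lambda>(X, Y). (c *\<^sub>R X, Y)) ps. - sp B (\<alpha> X Y)) = c *\<^sub>R (\<Sum>(X, Y)\<leftarrow>ps. - sp B (\<alpha> X Y))" for c ps
      by (induction ps) (auto simp: expand algebra_simps)
    have GI: "(\<Sum>(X, Y)\<leftarrow>ps. br X Y, \<Sum>(X, Y)\<leftarrow>ps. - sp B (\<alpha> X Y)) \<in> ?G" for ps by blast
    have subG: "subspace ?G"
      unfolding subspace_def
    proof (intro conjI ballI allI)
      show "0 \<in> ?G" using GI[of "[]"] by (simp add: zero_prod_def)
      fix x y and c :: real assume "x \<in> ?G"
      then obtain ps where x: "x = (\<Sum>(X, Y)\<leftarrow>ps. br X Y, \<Sum>(X, Y)\<leftarrow>ps. - sp B (\<alpha> X Y))" by blast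
      show "c *\<^sub>R x \<in> ?G" using GI[of "map (\<lambda>(X, Y). (c *\<^sub>R X, Y)) ps"] unfolding scale x by simp
      assume "y \<in> ?G"
      then obtain qs where y: "y = (\<Sum>(X, Y)\<leftarrow>qs. br X Y, \<Sum>(X, Y)\<leftarrow>qs. - sp B (\<alpha> X Y))" by blast
      show "x + y \<in> ?G" using GI[of "ps @ qs"] by (simp add: x y)
    qed
    have r0: "r = 0" if r: "(0, r) \<in> ?G" for r
    proof -
      obtain ps where ps: "(\<Sum>(X, Y)\<leftarrow>ps. br X Y) = 0" "r = (\<Sum>(X, Y)\<leftarrow>ps. - sp B (\<alpha> X Y))" using r by auto
      have neg: "(\<Sum>(X, Y)\<leftarrow>ps. - sp B (\<alpha> X Y)) = - (\<Sum>(X, Y)\<leftarrow>ps. sp B (\<alpha> X Y))" for ps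
        by (induction ps) auto
      have "(\<Sum>(X, Y)\<leftarrow>ps. inv_component M \<alpha> X Y) \<in> ?T" using ps(1) by (auto simp: image_of_kernel_def)
      then have "sp B (\<Sum>(X, Y)\<leftarrow>ps. inv_component M \<alpha> X Y) = 0" using B by (auto simp: perp_def sp_sym[of B])
      then show ?thesis using B by (simp add: ps(2) neg sp_sum_inv_component)
    qed
    obtain f where f: "linear (f :: 'l \<Rightarrow> real)" "\<And>v r. (v, r) \<in> ?G \<Longrightarrow> f v = r"
      by (rule functional_from_graph[OF subG r0]) (assumption, rule that)
    have fZ: "f (br X Y) = - sp B (\<alpha> X Y)" for X Y using f(2)[OF GI[of "[(X, Y)]"]] by simp
    let ?x = "(Dual f, B, 0 :: 'l)"
    have inv: "\<rho> X B = 0" for X using B by (simp add: invariants_def)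
    have zero: "brac D y ?x = 0" for y
    proof (rule D_eqI)
      fix W
      have "sp (\<rho> W A) B = 0" for A by (simp add: sp_inv inv sp_expand)
      then show "dual_apply (fst (brac D y ?x)) W = dual_apply (fst 0) W"
        by (simp add: D_brac_proj dual_apply_Dual[OF f(1)] fZ expand)
    qed (simp_all add: D_brac_proj inv expand)
    have "span {?x} \<subseteq> SD (Suc 0)"
    proof (rule SD_maximal)
      have z: "brac D y v = 0" if "v \<in> span {?x}" for y v
      proof -
        from that obtain c where "v = c *\<^sub>R ?x" by (auto simp: span_singleton)
        then show ?thesis by (simp only: bilinear_rmul[OF bil_D_brac] zero scaleR_zero_right)
      qed
      show "submodule (brac D) (span {?x})" by (auto simp: submodule_def z span_0)
      show "semisimple_quotient (brac D) (span {?x}) {0}"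
        by (rule semisimple_quotient_trivial) (auto simp: z span_0)
      show "{0} \<subseteq> span {?x}" by (simp add: span_0)
      show "{0} \<subseteq> SD 0" by (simp only: SD_0)
    qed
    then have "?x \<in> SD (Suc 0) \<inter> lower" by (auto simp: lower_def intro: span_base)
    then show "B \<in> bk 0" unfolding bk_def by force
  qed
qed

lemma bk_0_nondegenerate:
  assumes A0: "cond_A0 L M (\<alpha>, \<gamma>)" and B0: "cond_B0 L M (\<alpha>, \<gamma>)"
  shows "nondegenerate_on sp (bk 0)"
proof -
  let ?T = "image_of_kernel UNIV br (inv_component M \<alpha>)"
  have ndT: "nondegenerate_on sp ?T" using B0 by (simp add: cond_B0_def)
  have subT: "subspace ?T"
  proof -
    have TI: "(\<Sum>(X, Y)\<leftarrow>ps. inv_component M \<alpha> X Y) \<in> ?T" if "(\<Sum>(X, Y)\<leftarrow>ps. br X Y) = 0" for ps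
      using that by (auto simp: image_of_kernel_def)
    have ic_scale: "inv_component M \<alpha> (c *\<^sub>R X) Y = c *\<^sub>R inv_component M \<alpha> X Y" for c X Y
    proof (rule sp_eqI)
      fix B
      have "B \<in> ssum (invariants M) (action_image M)" by (simp add: invariants_action_image)
      then obtain C E where CE: "B = C + E" "C \<in> invariants M" "E \<in> action_image M" by (rule ssumE)
      have 1: "sp (inv_component M \<alpha> X Y) E = 0" for X Y
        by (rule invariants_perp_action_image[OF inv_component(1) CE(3)])
      have 2: "sp (inv_component M \<alpha> X Y) C = sp C (\<alpha> X Y)" for X Y
        using sp_inv_component[OF CE(2), of \<alpha> X Y] by (simp add: sp_sym)
      show "sp (inv_component M \<alpha> (c *\<^sub>R X) Y) B = sp (c *\<^sub>R inv_component M \<alpha> X Y) B"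
        by (simp add: CE(1) sp_expand 1 2 alpha_expand)
    qed
    have scale: "(\<Sum>(X, Y)\<leftarrow>map (\<lambda>(X, Y). (c *\<^sub>R X, Y)) ps. br X Y) = c *\<^sub>R (\<Sum>(X, Y)\<leftarrow>ps. br X Y)"
      "(\<Sum>(X, Y)\<leftarrow>map (\<lambda>(X, Y). (c *\<^sub>R X, Y)) ps. inv_component M \<alpha> X Y) = c *\<^sub>R (\<Sum>(X, Y)\<leftarrow>ps. inv_component M \<alpha> X Y)" for c ps
      by (induction ps) (auto simp: br_expand ic_scale scaleR_right_distrib)
    show ?thesis
      unfolding subspace_def
    proof (intro conjI ballI allI)
      show "0 \<in> ?T" using TI[of "[]"] by simp
      fix x y and c :: real assume "x \<in> ?T"
      then obtain ps where x: "x = (\<Sum>(X, Y)\<leftarrow>ps. inv_component M \<alpha> X Y)" "(\<Sum>(X, Y)\<leftarrow>ps. br X Y) = 0"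
        by (auto simp: image_of_kernel_def)
      show "c *\<^sub>R x \<in> ?T" using TI[of "map (\<lambda>(X, Y). (c *\<^sub>R X, Y)) ps"] unfolding scale x by simp
      assume "y \<in> ?T"
      then obtain qs where y: "y = (\<Sum>(X, Y)\<leftarrow>qs. inv_component M \<alpha> X Y)" "(\<Sum>(X, Y)\<leftarrow>qs. br X Y) = 0"
        by (auto simp: image_of_kernel_def)
      show "x + y \<in> ?T" using TI[of "ps @ qs"] by (simp add: x y)
    qed
  qed
  have Tinv: "?T \<subseteq> invariants M"
  proof
    fix x assume "x \<in> ?T"
    then obtain ps where x: "x = (\<Sum>(X, Y)\<leftarrow>ps. inv_component M \<alpha> X Y)" by (auto simp: image_of_kernel_def)
    have "(\<Sum>(X, Y)\<leftarrow>ps. inv_component M \<alpha> X Y) \<in> invariants M" for ps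
      using inv_component(1) submodule_subspace[OF submodule_invariants]
      by (induction ps) (auto intro: subspace_add subspace_0)
    then show "x \<in> invariants M" by (simp add: x)
  qed
  show ?thesis
    unfolding bk_0[OF A0] nondegenerate_on_def
  proof (intro ballI impI)
    fix x assume x: "x \<in> invariants M \<inter> perp sp ?T"
      and orth: "\<forall>y\<in>invariants M \<inter> perp sp ?T. sp x y = 0"
    show "x = 0"
    proof (rule sp_eqI)
      fix B
      have "B \<in> ssum (invariants M) (action_image M)" by (simp add: invariants_action_image)
      then obtain C E where CE: "B = C + E" "C \<in> invariants M" "E \<in> action_image M" by (rule ssumE)
      have "C \<in> ssum ?T (perp sp ?T)"
        using nondegenerate_complement[OF sp subT ndT] by simp
      then obtain t y where ty: "C = t + y" "t \<in> ?T" "y \<in> perp sp ?T" by (rule ssumE)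
      have "C - t \<in> invariants M"
        using CE(2) ty(2) Tinv submodule_subspace[OF submodule_invariants] by (blast intro: subspace_diff)
      then have "y \<in> invariants M" using ty(1) by simp
      then have "sp x y = 0" using orth ty(3) by blast
      moreover have "sp x t = 0" using x ty(2) by (auto simp: perp_def sp_sym[of x])
      moreover have "sp x E = 0" using invariants_perp_action_image[OF _ CE(3)] x by blast
      ultimately show "sp x B = sp 0 B" by (simp add: CE(1) ty(1) sp_expand)
    qed
  qed
qed

subsection \<open>The conditions of positive degree\<close>

text \<open>Lift \<open>bk k\<close> equivariantly to \<open>SD (Suc k) \<inter> lower\<close> modulo \<open>SD k \<inter> L*\<close>, using semi-simplicity. The dual
  component of the lift is a map from \<open>bk k\<close> to \<open>R L k\<close>-functionals, i.e. the adjoint of a map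
  \<open>\<Phi>\<close>, and equivariance is the required equation.\<close>

lemma bk_lift:
  "\<exists>\<Phi>. linear \<Phi> \<and> (\<forall>X. \<forall>Y\<in>R L k. \<forall>B\<in>bk k. sp (\<alpha> X Y) B = sp (\<rho> X (\<Phi> Y) - \<Phi> (br X Y)) B)"
proof -
  let ?E0 = "SD (Suc k) \<inter> lower" and ?W = "SD k \<inter> dual_part"
  have E0: "submodule (brac D) ?E0" by (rule submodule_Int[OF submodule_SD submodule_lower])
  have W: "?W \<subseteq> ?E0 \<inter> dual_part" using SD_mono[of k] dual_part_lower by blast
  obtain E where E: "submodule (brac D) E" "?W \<subseteq> E" "E \<subseteq> ?E0" "?E0 \<inter> dual_part \<inter> E = ?W" "ssum (?E0 \<inter> dual_part) E = ?E0"
    by (rule complement_submodule[OF SD_lower_semisimple submodule_Int[OF E0 submodule_dual_part] W Int_lower1])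
  have subE: "subspace E" using E(1) by (rule submodule_subspace)
  have qE: "bk k \<subseteq> qr ` E"
  proof
    fix B assume "B \<in> bk k"
    then obtain u where u: "u \<in> ?E0" "B = qr u" unfolding bk_def by blast
    then have "u \<in> ssum (?E0 \<inter> dual_part) E" using E(5) by simp
    then obtain v x where "u = v + x" "v \<in> ?E0 \<inter> dual_part" "x \<in> E" by (rule ssumE)
    then show "B \<in> qr ` E" using u(2) by (auto simp: dual_part_def)
  qed
  obtain s where s: "linear s" "\<And>y. y \<in> qr ` E \<Longrightarrow> s y \<in> E \<and> qr (s y) = y"
    by (rule linear_section[OF lin_qr subE]) (rule that)
  have sB: "s B \<in> E" "qr (s B) = B" "pr (s B) = 0" if "B \<in> bk k" for B
    using s(2)[of B] qE that E(3) by (auto simp: lower_def)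
  have "\<exists>y. \<forall>A. sp y A = dual_apply (fst (s A)) Y" for Y
    by (rule form_represents[OF bil_sp sp_nondeg])
      (intro linearI; simp add: linear_add[OF s(1)] linear_cmul[OF s(1)] expand)
  then obtain \<Phi> where \<Phi>: "\<And>Y A. sp (\<Phi> Y) A = dual_apply (fst (s A)) Y" by metis
  have "linear \<Phi>"
  proof (rule linearI)
    show "\<Phi> (X + Y) = \<Phi> X + \<Phi> Y" for X Y by (rule sp_eqI) (simp add: \<Phi> expand)
    show "\<Phi> (c *\<^sub>R X) = c *\<^sub>R \<Phi> X" for c X by (rule sp_eqI) (simp add: \<Phi> expand)
  qed
  moreover have "sp (\<alpha> X Y) B = sp (\<rho> X (\<Phi> Y) - \<Phi> (br X Y)) B" if Y: "Y \<in> R L k" and B: "B \<in> bk k" for X Y B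
  proof -
    have XB: "\<rho> X B \<in> bk k" by (rule submodule_act[OF submodule_bk B])
    let ?v = "s (\<rho> X B) - brac D (0, 0, X) (s B)"
    have "?v \<in> E" by (rule subspace_diff[OF subE sB(1)[OF XB] submodule_act[OF E(1) sB(1)[OF B]]])
    moreover have "snd ?v = 0"
      using sB[OF XB] sB[OF B] by (simp add: prod_eq_iff D_brac_proj expand)
    ultimately have "?v \<in> ?W" using E(3,4) by (auto simp: dual_part_def)
    then have "dual_apply (fst ?v) Y = 0" using SD_dual_part Y by blast
    then have "dual_apply (fst (s (\<rho> X B))) Y + sp B (\<alpha> X Y) + dual_apply (fst (s B)) (br X Y) = 0"
      using sB[OF B] by (simp add: D_brac_proj expand)
    then show ?thesis by (simp add: sp_expand sp_inv \<Phi> sp_sym[of "\<alpha> X Y"])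
  qed
  ultimately show ?thesis by blast
qed

text \<open>Conversely, \<open>\<Phi>\<close> defines the lift \<open>?E\<close> of \<open>b\<close>. It is a submodule because the
  elements of the radical act trivially on \<open>M\<close>, and its quotient by the part in the dual space is \<open>b\<close>,
  which is semi-simple; so it lies in the socle series.\<close>

lemma bk_greatest:
  assumes b: "submodule \<rho> b" and lin: "linear \<Phi>"
    and eq: "\<And>X Y B. Y \<in> R L (Suc k) \<Longrightarrow> B \<in> b \<Longrightarrow> sp (\<alpha> X Y) B = sp (\<rho> X (\<Phi> Y) - \<Phi> (br X Y)) B"
  shows "b \<subseteq> bk (Suc k)"
proof -
  let ?E = "{u. pr u = 0 \<and> qr u \<in> b \<and> (\<forall>Y\<in>R L (Suc k). dual_apply (fst u) Y = sp (\<Phi> Y) (qr u))}"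
  let ?W = "SD (Suc k) \<inter> dual_part"
  have subb: "subspace b" using b by (rule submodule_subspace)
  have RL: "br X Y \<in> R L (Suc k)" if "Y \<in> R L (Suc k)" for X Y by (rule submodule_act[OF submodule_R[OF lin_L] that])
  have R1: "\<rho> Y A = 0" if "Y \<in> R L (Suc k)" for Y A
    using rho_radical R_antimono[OF lin_L, of "Suc 0" "Suc k"] that by auto
  have E: "submodule (brac D) ?E"
    unfolding submodule_def
  proof (intro conjI allI ballI)
    show "subspace ?E" using subb by (auto simp: subspace_def expand)
    fix x u assume u: "u \<in> ?E"
    have "dual_apply (fst (brac D x u)) Y = sp (\<Phi> Y) (qr (brac D x u))" if Y: "Y \<in> R L (Suc k)" for Y
    proof -
      have "sp (\<alpha> (pr x) Y) (qr u) = - sp (\<Phi> Y) (\<rho> (pr x) (qr u)) - sp (\<Phi> (br (pr x) Y)) (qr u)"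
        using eq[OF Y, of "qr u" "pr x"] u by (simp add: sp_expand sp_inv)
      then show ?thesis
        using u RL[OF Y, of "pr x"] by (simp add: D_brac_proj expand R1[OF Y] sp_sym[of "qr u"])
    qed
    moreover have "qr (brac D x u) \<in> b" using u submodule_act[OF b] by (simp add: D_brac_proj expand)
    moreover have "pr (brac D x u) = 0" using u by (simp add: D_brac_proj expand)
    ultimately show "brac D x u \<in> ?E" by blast
  qed
  have WE: "?W \<subseteq> ?E"
  proof
    fix u assume "u \<in> ?W"
    then have "snd u = 0" "\<forall>Y\<in>R L (Suc k). dual_apply (fst u) Y = 0" using SD_dual_part by blast+
    then show "u \<in> ?E" using subspace_0[OF subb] by (simp add: sp_expand)
  qed
  have lift: "(Dual (\<lambda>Y. sp (\<Phi> Y) B), B, 0) \<in> ?E" if "B \<in> b" for B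
  proof -
    have "linear (\<lambda>Y. sp (\<Phi> Y) B)" by (rule linearI) (simp_all add: linear_add[OF lin] linear_cmul[OF lin] sp_expand)
    then show ?thesis using that by (simp add: dual_apply_Dual)
  qed
  have qE: "qr ` ?E = b"
  proof
    show "b \<subseteq> qr ` ?E"
    proof
      fix B assume "B \<in> b"
      from imageI[OF lift[OF this], of qr] show "B \<in> qr ` ?E" by simp
    qed
  qed auto
  have qW: "qr ` ?W = {0}"
    by (rule dual_part_images(1)[OF Int_lower2 subspace_0[OF submodule_subspace[OF submodule_SD_dual_part]]])
  have "semisimple_quotient \<rho> (qr ` ?E) (qr ` ?W) \<longleftrightarrow> semisimple_quotient (brac D) ?E ?W"
  proof (rule semisimple_quotient_image[where \<phi> = pr])
    show "v \<in> ?W" if "v \<in> ?E" "qr v = 0" for v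
      using that unfolding SD_dual_part by (auto simp: prod_eq_iff sp_expand)
    show "qr (brac D X v) = \<rho> (pr X) (qr v)" if "v \<in> ?E" for X v
      using that by (simp add: D_brac_proj expand)
  qed (rule lin_qr E submodule_SD_dual_part WE surj_pr)+
  moreover have "semisimple_quotient \<rho> b {0}"
    by (rule semisimple_quotient_sub[OF ss[unfolded semisimple_def] b]) (use subspace_0[OF subb] in auto)
  ultimately have "semisimple_quotient (brac D) ?E ?W" by (simp only: qE qW)
  then have "?E \<subseteq> SD (Suc (Suc k))" by (rule SD_maximal[OF E _ WE Int_lower1])
  moreover have "?E \<subseteq> lower" by (auto simp: lower_def)
  ultimately have "qr ` ?E \<subseteq> bk (Suc k)" unfolding bk_def by (intro image_mono) blast
  then show ?thesis by (simp only: qE)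
qed

lemma bk_Suc_nondegenerate:
  assumes "cond_B (Suc k) L M (\<alpha>, \<gamma>)"
  shows "nondegenerate_on sp (bk (Suc k))"
proof -
  let ?P = "\<lambda>b. submodule \<rho> b \<and> (\<exists>\<Phi>. linear \<Phi> \<and>
     (\<forall>X. \<forall>Y\<in>R L (Suc k). \<forall>B\<in>b. sp (\<alpha> X Y) B = sp (\<rho> X (\<Phi> Y) - \<Phi> (br X Y)) B))"
  have "(GREATEST b. ?P b) = bk (Suc k)"
  proof (rule Greatest_equality)
    show "?P (bk (Suc k))" using submodule_bk bk_lift by blast
    show "c \<subseteq> bk (Suc k)" if "?P c" for c using that bk_greatest[of c] by blast
  qed
  then show ?thesis using assms by (simp add: cond_B_def)
qed

text \<open>Beyond the length of the radical series no condition is imposed; there \<open>bk k\<close> is the whole module.\<close>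

lemma bk_nondegenerate_of_R_zero:
  assumes "R L k = {0}" shows "nondegenerate_on sp (bk k)"
proof -
  have "dual_part \<subseteq> SD k \<inter> dual_part"
    unfolding subset_iff SD_dual_part by (auto simp: dual_part_def assms expand)
  then have "lower \<subseteq> SD (Suc k)"
    by (intro SD_maximal[OF submodule_lower lower_over_dual_part dual_part_lower]) auto
  then have "bk k = qr ` lower" unfolding bk_def by (simp add: Int_absorb1)
  moreover have "A \<in> qr ` lower" for A by (rule image_eqI[of _ _ "(0, A, 0)"]) (auto simp: lower_def)
  ultimately have "bk k = UNIV" by blast
  then show ?thesis using sp_nondeg by simp
qed

text \<open>Let \<open>N\<close> be the left side of the claim. It is semi-simple over \<open>SD (Suc k)\<close> and over the sum of \<open>RD (Suc (Suc k))\<close>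
  with the dual space, hence over the intersection of these. The induction hypothesis and
  nondegeneracy of \<open>bk k\<close> show that this intersection lies in the dual space. So \<open>N \<inter> lower\<close> has a complement \<open>E\<close>
  modulo the dual space, and \<open>E\<close> projects to a semi-simple ideal \<open>K\<close> inside \<open>R L (Suc k)\<close>. The components of
  the section \<open>K \<rightarrow> E\<close> in \<open>M\<close> and in the dual space are the maps \<open>\<Phi>1\<close> and \<open>\<Phi>2\<close> that \<open>cond_A\<close>
  excludes unless \<open>K = 0\<close>.\<close>

lemma SD_step:
  assumes prev: "SD (Suc k) \<inter> ssum (RD k) lower \<subseteq> lower" and nd: "nondegenerate_on sp (bk k)"
    and A: "cond_A (Suc k) L M (\<alpha>, \<gamma>)"
  shows "SD (Suc (Suc k)) \<inter> ssum (RD (Suc k)) lower \<subseteq> lower"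
proof -
  let ?k = "Suc k"
  let ?N = "SD (Suc ?k) \<inter> ssum (RD ?k) lower"
  let ?T = "ssum (RD (Suc ?k)) dual_part"
  let ?W0 = "SD ?k \<inter> dual_part"
  have mRl: "submodule (brac D) (ssum (RD ?k) lower)"
    by (rule submodule_ssum[OF lin_D_brac submodule_RD submodule_lower])
  have N: "submodule (brac D) ?N" by (rule submodule_Int[OF submodule_SD mRl])
  have subN: "subspace ?N" by (rule submodule_subspace[OF N])
  have T: "submodule (brac D) ?T" by (rule submodule_ssum[OF lin_D_brac submodule_RD submodule_dual_part])
  have RS: "RD (Suc ?k) \<subseteq> RD ?k" "RD ?k \<subseteq> RD k" by (rule R_Suc_subset[OF lin_D_brac])+
  have TRl: "?T \<subseteq> ssum (RD ?k) lower" by (rule ssum_mono[OF RS(1) dual_part_lower])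
  have ssT: "semisimple_quotient (brac D) (ssum (RD ?k) lower) ?T"
  proof -
    let ?X = "ssum (RD ?k) dual_part" and ?Y = "ssum (RD (Suc ?k)) lower"
    have X: "submodule (brac D) ?X" by (rule submodule_ssum[OF lin_D_brac submodule_RD submodule_dual_part])
    have Y: "submodule (brac D) ?Y" by (rule submodule_ssum[OF lin_D_brac submodule_RD submodule_lower])
    have 1: "semisimple_quotient (brac D) ?X ?T"
      by (rule semisimple_quotient_add[OF lin_D_brac submodule_RD submodule_RD RS(1) submodule_dual_part
            R_Suc_semisimple[OF lin_D_brac]])
    have 2: "semisimple_quotient (brac D) ?Y ?T"
      using semisimple_quotient_add[OF lin_D_brac submodule_lower submodule_dual_part dual_part_lower
          submodule_RD lower_over_dual_part, of "Suc ?k"] by (simp add: ssum_commute)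
    have TX: "?T \<subseteq> ?X" by (rule ssum_mono[OF RS(1) order_refl])
    have TY: "?T \<subseteq> ?Y" by (rule ssum_mono[OF order_refl dual_part_lower])
    have "ssum ?X ?Y = ssum (RD ?k) lower"
    proof
      show "ssum ?X ?Y \<subseteq> ssum (RD ?k) lower"
        by (rule ssum_least[OF submodule_subspace[OF mRl] ssum_mono[OF order_refl dual_part_lower]
              ssum_mono[OF RS(1) order_refl]])
      show "ssum (RD ?k) lower \<subseteq> ssum ?X ?Y"
        by (rule ssum_mono[OF ssum_upper1[OF sub_dual_part] ssum_upper2[OF sub_RD]])
    qed
    then show ?thesis using semisimple_quotient_ssum[OF lin_D_brac X Y TX TY 1 2] by simp
  qed
  have W_dual: "?N \<inter> SD ?k \<inter> (?N \<inter> ?T) \<subseteq> dual_part"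
  proof
    fix x assume x: "x \<in> ?N \<inter> SD ?k \<inter> (?N \<inter> ?T)"
    have "?T \<subseteq> ssum (RD k) lower" by (rule ssum_mono[OF order_trans[OF RS] dual_part_lower])
    then have low: "x \<in> lower" using prev x by blast
    obtain r z where rz: "x = r + z" "r \<in> RD (Suc ?k)" "z \<in> dual_part" using x by (blast elim: ssumE)
    have r: "r \<in> RD ?k" using rz(2) RS(1) by (rule subsetD[rotated])
    show "x \<in> dual_part"
    proof (rule bk_perp_zero[OF nd _ low])
      show "x \<in> SD ?k" using x by blast
      fix y assume y: "y \<in> SD ?k" "y \<in> lower"
      have "form D r y = 0" using y(1) r by (simp add: perp_def)
      moreover have "form D z y = 0" using y(2) rz(3) by (simp add: D_form_proj dual_part_def lower_def expand)
      ultimately show "form D x y = 0" by (simp add: rz(1) bilinear_ladd[OF bil_D_form])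
    qed
  qed
  have 1: "semisimple_quotient (brac D) ?N (?N \<inter> SD ?k)"
    by (rule semisimple_quotient_restrict[OF lin_D_brac submodule_SD submodule_SD SD_mono N Int_lower1 SD_semisimple])
  have 2: "semisimple_quotient (brac D) ?N (?N \<inter> ?T)"
    by (rule semisimple_quotient_restrict[OF lin_D_brac mRl T TRl N Int_lower2 ssT])
  have W: "semisimple_quotient (brac D) ?N (?N \<inter> SD ?k \<inter> (?N \<inter> ?T))"
    by (rule semisimple_quotient_Int[OF lin_D_brac N submodule_Int[OF N submodule_SD] Int_lower1
          submodule_Int[OF N T] Int_lower1 1 2])
  have W0N: "?W0 \<subseteq> ?N \<inter> lower"
    using SD_mono[of ?k] dual_part_lower ssum_upper2[OF sub_RD, of lower ?k] by blast
  have WW0: "?N \<inter> SD ?k \<inter> (?N \<inter> ?T) \<subseteq> ?W0" using W_dual by blast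
  have W0N': "?W0 \<subseteq> ?N" using W0N by (rule order_trans) (rule Int_lower1)
  have N_W0: "semisimple_quotient (brac D) ?N ?W0"
    by (rule semisimple_quotient_quot[OF lin_D_brac W submodule_SD_dual_part WW0 W0N' subN])
  obtain E where E: "submodule (brac D) E" "?W0 \<subseteq> E" "E \<subseteq> ?N" "?N \<inter> lower \<inter> E = ?W0" "ssum (?N \<inter> lower) E = ?N"
    by (rule complement_submodule[OF N_W0 submodule_Int[OF N submodule_lower] W0N Int_lower1])
  have subE: "subspace E" by (rule submodule_subspace[OF E(1)])
  have E_W0: "v \<in> ?W0" if "v \<in> E" "pr v = 0" for v using that E(3,4) by (auto simp: lower_def)
  let ?K = "pr ` E"
  have K: "submodule br ?K" by (rule pr_image_submodule[OF E(1)])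
  have K_R: "?K \<subseteq> R L ?k" using E(3) RD_lower[of ?k] by auto
  have "semisimple br ?K"
  proof -
    have "semisimple_quotient br (pr ` E) (pr ` ?W0) \<longleftrightarrow> semisimple_quotient (brac D) E ?W0"
    proof (rule semisimple_quotient_image[where \<phi> = pr])
      show "pr (brac D X v) = br (pr X) (pr v)" for X v by (simp add: D_brac_proj)
    qed (rule lin_pr E(1,2) submodule_SD_dual_part E_W0 surj_pr | assumption)+
    moreover have "semisimple_quotient (brac D) E ?W0" by (rule semisimple_quotient_sub[OF N_W0 E(1,2,3)])
    moreover have "pr ` ?W0 = {0}"
      by (rule dual_part_images(2)[OF Int_lower2 subspace_0[OF submodule_subspace[OF submodule_SD_dual_part]]])
    ultimately show ?thesis by (simp add: semisimple_def)
  qed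
  then have K_S1: "?K \<subseteq> S1 L" by (rule semisimple_subset_S1[OF lin_L K])
  obtain s where s: "linear s" "\<And>y. y \<in> ?K \<Longrightarrow> s y \<in> E \<and> pr (s y) = y"
    by (rule linear_section[OF lin_pr subE]) (rule that)
  let ?\<Phi>1 = "\<lambda>Y. - qr (s Y)" and ?\<Phi>2 = "\<lambda>Y W. dual_apply (fst (s Y)) W"
  have \<Phi>1: "linear ?\<Phi>1" by (rule linearI) (simp_all add: linear_add[OF s(1)] linear_cmul[OF s(1)])
  have \<Phi>2: "bilinear ?\<Phi>2"
    unfolding bilinear_def
    by (intro conjI allI linearI) (simp_all add: linear_add[OF s(1)] linear_cmul[OF s(1)] expand)
  have key: "qr v = 0 \<and> (\<forall>W\<in>R L ?k. dual_apply (fst v) W = 0)"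
    if "v = brac D (0, 0, X) (s Y) - s (br X Y)" "Y \<in> ?K" for X Y v
  proof -
    have XY: "br X Y \<in> ?K" by (rule submodule_act[OF K that(2)])
    have "brac D (0, 0, X) (s Y) \<in> E" using submodule_act[OF E(1)] s(2)[OF that(2)] by blast
    moreover have "s (br X Y) \<in> E" using s(2)[OF XY] by blast
    ultimately have "v \<in> E" unfolding that(1) by (rule subspace_diff[OF subE])
    moreover have "pr v = 0" using s(2)[OF XY] s(2)[OF that(2)] by (simp add: that(1) D_brac_proj)
    ultimately have "v \<in> ?W0" by (rule E_W0)
    then have "snd v = 0 \<and> (\<forall>W\<in>R L ?k. dual_apply (fst v) W = 0)" by (rule iffD1[OF SD_dual_part])
    then show ?thesis by simp
  qed
  have e1: "\<alpha> X Y = \<rho> X (?\<Phi>1 Y) - ?\<Phi>1 (br X Y)" if Y: "Y \<in> ?K" for X Y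
  proof -
    have "qr (brac D (0, 0, X) (s Y) - s (br X Y)) = 0" using key[OF refl Y, of X] by simp
    then have "\<alpha> X Y + \<rho> X (qr (s Y)) = qr (s (br X Y))" using s(2)[OF Y] by (simp add: D_brac_proj expand)
    then show ?thesis by (simp add: rho_expand eq_diff_eq add.commute)
  qed
  have e2: "\<gamma> X Y W = - sp (?\<Phi>1 Y) (\<alpha> X W) + ?\<Phi>2 Y (br X W) + ?\<Phi>2 (br X Y) W"
    if Y: "Y \<in> ?K" and W: "W \<in> R L ?k" for X Y W
  proof -
    have "dual_apply (fst (brac D (0, 0, X) (s Y) - s (br X Y))) W = 0" using key[OF refl Y, of X] W by blast
    then show ?thesis using s(2)[OF Y] by (simp add: D_brac_proj expand)
  qed
  have "?K = {0}"
  proof -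
    have "\<exists>\<Phi>1 \<Phi>2. linear \<Phi>1 \<and> bilinear \<Phi>2 \<and>
          (\<forall>X. \<forall>Y\<in>?K. \<alpha> X Y = \<rho> X (\<Phi>1 Y) - \<Phi>1 (br X Y)) \<and>
          (\<forall>X. \<forall>Y\<in>?K. \<forall>W\<in>R L ?k. \<gamma> X Y W = - sp (\<Phi>1 Y) (\<alpha> X W) + \<Phi>2 Y (br X W) + \<Phi>2 (br X Y) W)"
      using \<Phi>1 \<Phi>2 e1 e2 by (intro exI[of _ ?\<Phi>1] exI[of _ ?\<Phi>2] conjI allI ballI)
    then show ?thesis using A K K_R K_S1 unfolding cond_A_def split_conv by (metis Int_subset_iff)
  qed
  then have "E \<subseteq> lower" by (auto simp: lower_def)
  then have "ssum (?N \<inter> lower) E \<subseteq> lower" by (intro ssum_least[OF sub_lower]) auto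
  then show ?thesis using E(5) by simp
qed

text \<open>By induction on \<open>k\<close> (fact \<open>H\<close> below), \<open>SD (Suc k) \<inter> (RD k + lower) \<subseteq> lower\<close>. Walking down the radical
  series, an element of the canonical ideal lies in \<open>RD k + lower\<close> for all \<open>k\<close>, hence in \<open>lower\<close>
  when the radicals of \<open>L\<close> vanish. Conversely \<open>H\<close> and the nondegeneracy of \<open>bk k\<close> put \<open>SD k \<inter> RD k\<close> into the dual
  space, and the orthogonal complement of this inclusion is \<open>lower \<subseteq> RD k + SD k\<close>.\<close>

theorem canonical_coisotropic_lower:
  assumes adm: "admissible_cocycle L M (\<alpha>, \<gamma>)"
  shows "canonical_coisotropic D = lower"
proof -
  have A0: "cond_A0 L M (\<alpha>, \<gamma>)" and B0: "cond_B0 L M (\<alpha>, \<gamma>)"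
    using adm by (auto simp: admissible_cocycle_def)
  obtain m where m: "R L (Suc m) = {0}" "\<And>k. k \<in> {1..m} \<Longrightarrow> cond_A k L M (\<alpha>, \<gamma>) \<and> cond_B k L M (\<alpha>, \<gamma>)"
    using adm by (auto simp: admissible_cocycle_def)
  have R_big: "R L k = {0}" if "m < k" for k
  proof -
    have "R L k \<subseteq> R L (Suc m)" by (rule R_antimono[OF lin_L]) (use that in simp)
    then show ?thesis using m(1) subspace_0[OF submodule_subspace[OF submodule_R[OF lin_L, of k]]] by blast
  qed
  have nd: "nondegenerate_on sp (bk k)" for k
  proof (cases "m < k")
    case True then show ?thesis by (intro bk_nondegenerate_of_R_zero R_big)
  next
    case False
    show ?thesis
    proof (cases k)
      case 0 then show ?thesis using bk_0_nondegenerate[OF A0 B0] by simp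
    next
      case (Suc l) then show ?thesis using m(2)[of k] False bk_Suc_nondegenerate[of l] by simp
    qed
  qed
  have H: "SD (Suc k) \<inter> ssum (RD k) lower \<subseteq> lower" for k
  proof (induction k)
    case 0 then show ?case using SD_1_lower[OF A0] by blast
  next
    case (Suc k)
    show ?case
    proof (cases "m < Suc k")
      case True
      then have "R L (Suc k) = {0}" by (rule R_big)
      then have "ssum (RD (Suc k)) lower = pr -` {0}" by (simp only: RD_lower)
      then have "ssum (RD (Suc k)) lower \<subseteq> lower" unfolding lower_def by blast
      then show ?thesis by blast
    next
      case False
      then have "cond_A (Suc k) L M (\<alpha>, \<gamma>)" using m(2)[of "Suc k"] by simp
      then show ?thesis by (rule SD_step[OF Suc nd])
    qed
  qed
  show ?thesis
  proof
    show "canonical_coisotropic D \<subseteq> lower"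
    proof
      fix x assume x: "x \<in> canonical_coisotropic D"
      have "pr x \<in> R L k" for k
      proof (induction k)
        case (Suc k)
        have "x \<in> ssum (RD (Suc k)) (SD (Suc k))" using x by (auto simp: canonical_coisotropic_def)
        then obtain r s where rs: "x = r + s" "r \<in> RD (Suc k)" "s \<in> SD (Suc k)" by (rule ssumE)
        have sub: "subspace (ssum (RD k) lower)" by (rule subspace_ssum[OF sub_RD sub_lower])
        have "x \<in> ssum (RD k) lower" using Suc by (simp add: RD_lower)
        moreover have "r \<in> ssum (RD k) lower"
          using rs(2) R_Suc_subset[OF lin_D_brac, of k] ssum_upper1[OF sub_lower, of "RD k"] by blast
        ultimately have "x - r \<in> ssum (RD k) lower" by (rule subspace_diff[OF sub])
        then have "s \<in> lower" using H[of k] rs by auto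
        then have "x \<in> ssum (RD (Suc k)) lower" unfolding rs(1) by (rule ssumI[OF rs(2)])
        then show ?case by (simp add: RD_lower)
      qed simp
      from this[of "Suc m"] show "x \<in> lower" by (simp add: m(1) lower_def)
    qed
    have int: "SD k \<inter> RD k \<subseteq> dual_part" for k
    proof (cases k)
      case 0
      then have "SD k = {0}" by (simp only: SD_0)
      then have "SD k \<inter> RD k \<subseteq> {0}" by (simp only: Int_lower1)
      also have "\<dots> \<subseteq> dual_part" using subspace_0[OF sub_dual_part] by simp
      finally show ?thesis .
    next
      case (Suc l)
      show ?thesis
      proof
        fix x assume x: "x \<in> SD k \<inter> RD k"
        have "x \<in> ssum (RD l) lower"
          using x R_Suc_subset[OF lin_D_brac, of l] ssum_upper1[OF sub_lower, of "RD l"] Suc by blast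
        then have low: "x \<in> lower" using H[of l] x Suc by blast
        show "x \<in> dual_part"
        proof (rule bk_perp_zero[OF nd _ low])
          show "x \<in> SD (Suc l)" using x Suc by simp
          show "form D x y = 0" if "y \<in> SD (Suc l)" for y using x that Suc by (simp add: perp_def)
        qed
      qed
    qed
    have "lower \<subseteq> ssum (RD k) (SD k)" for k
    proof -
      have "perp (form D) dual_part \<subseteq> perp (form D) (SD k \<inter> RD k)" by (rule perp_antimono[OF int])
      also have "\<dots> = ssum (RD k) (SD k)"
        using perp_Int[OF sp_D_form sub_SD sub_RD, of k k] perp_perp[OF sp_D_form sub_RD, of k] by simp
      finally show ?thesis by (simp add: perp_dual_part)
    qed
    then show "lower \<subseteq> canonical_coisotropic D" by (auto simp: canonical_coisotropic_def)
  qed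
qed

end

section \<open>The classification\<close>

text \<open>Only some representative of the class is required to be admissible. It is joined to the given
  one by a filtered isomorphism, which transfers \<open>canonical_coisotropic_lower\<close> and the
  symmetric-triple property.\<close>

lemma sharp_representative:
  assumes lie: "lie_algebra_with_involution L" and om: "orthogonal_module L M" and ss: "semisimple (rho M) UNIV"
    and c: "(\<alpha>, \<gamma>) \<in> ZQ2_plus L M" and sharp: "quad_class L M (\<alpha>, \<gamma>) \<in> HQ2_sharp L M"
  obtains \<alpha>' \<gamma>' F where "semisimple_cocycle L M \<alpha>' \<gamma>'" "admissible_cocycle L M (\<alpha>', \<gamma>')"
    "metric_lie_iso (standard_model L M (\<alpha>', \<gamma>')) (standard_model L M (\<alpha>, \<gamma>)) F" "filtered_identity F"
proof -
  have coc: "semisimple_cocycle L M a g" if "(a, g) \<in> ZQ2_plus L M" for a g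
    using that lie om ss by unfold_locales (auto simp: ZQ2_plus_def)
  interpret c: semisimple_cocycle L M \<alpha> \<gamma> by (rule coc[OF c])
  obtain p where p: "quad_class L M (\<alpha>, \<gamma>) = quad_class L M p" "p \<in> ZQ2_plus L M" "admissible_cocycle L M p"
    using sharp unfolding HQ2_sharp_def by (elim CollectE exE conjE) (rule that)
  obtain \<alpha>' \<gamma>' where "p = (\<alpha>', \<gamma>')" by (cases p)
  then have c': "(\<alpha>', \<gamma>') \<in> ZQ2_plus L M" "admissible_cocycle L M (\<alpha>', \<gamma>')"
    and eq: "quad_class L M (\<alpha>, \<gamma>) = quad_class L M (\<alpha>', \<gamma>')" using p by simp_all
  interpret c': semisimple_cocycle L M \<alpha>' \<gamma>' by (rule coc[OF c'(1)])
  have "(\<alpha>, \<gamma>) \<in> quad_class L M (\<alpha>', \<gamma>')"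
    using quad_class_refl[OF c.quad_cochain_axioms] eq by simp
  then obtain F where F: "metric_lie_iso c'.D c.D F" "filtered_identity F"
    by (rule exE[OF c'.quad_class_member(2)]) (erule conjE, rule that)
  show ?thesis by (rule that[OF c'.semisimple_cocycle_axioms c'(2) F])
qed

lemma filtered_identity_lower:
  assumes "filtered_identity F" "bij F" shows "F ` lower = lower"
proof -
  have "F x \<in> lower \<longleftrightarrow> x \<in> lower" for x using assms(1) by (simp add: filtered_identity_def lower_def)
  then have "F -` lower = lower" by blast
  then show ?thesis using surj_image_vimage_eq[OF bij_is_surj[OF assms(2)], of lower] by simp
qed

lemma sharp_canonical_coisotropic:
  assumes "lie_algebra_with_involution L" "orthogonal_module L M" "semisimple (rho M) UNIV"
    "(\<alpha>, \<gamma>) \<in> ZQ2_plus L M" "quad_class L M (\<alpha>, \<gamma>) \<in> HQ2_sharp L M"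
  shows "canonical_coisotropic (standard_model L M (\<alpha>, \<gamma>)) = lower"
proof -
  interpret c: quad_cochain L M \<alpha> \<gamma>
    using assms(1,2,4) by unfold_locales (auto simp: ZQ2_plus_def)
  obtain \<alpha>' \<gamma>' F where c': "semisimple_cocycle L M \<alpha>' \<gamma>'" "admissible_cocycle L M (\<alpha>', \<gamma>')"
    and F: "metric_lie_iso (standard_model L M (\<alpha>', \<gamma>')) c.D F" "filtered_identity F"
    by (rule sharp_representative[OF assms])
  interpret c': semisimple_cocycle L M \<alpha>' \<gamma>' by (rule c'(1))
  have "bij F" using F(1) by (simp add: metric_lie_iso_def)
  then have "F ` lower = lower" by (rule filtered_identity_lower[OF F(2)])
  moreover have "F ` canonical_coisotropic c'.D = canonical_coisotropic c.D"
    by (rule metric_lie_iso_canonical[OF F(1) c'.lin_D_brac c.lin_D_brac])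
  ultimately show ?thesis by (simp add: c'.canonical_coisotropic_lower[OF c'(2)])
qed

lemma sharp_symmetric_triple:
  assumes "lie_algebra_with_involution L" "orthogonal_module L M" "semisimple (rho M) UNIV"
    "(\<alpha>, \<gamma>) \<in> ZQ2_plus L M" "quad_class L M (\<alpha>, \<gamma>) \<in> HQ2_sharp L M" and T1: "T1 L"
  shows "symmetric_triple (standard_model L M (\<alpha>, \<gamma>))"
proof -
  interpret c: quad_cocycle L M \<alpha> \<gamma>
    using assms(1,2,4) by unfold_locales (auto simp: ZQ2_plus_def)
  obtain \<alpha>' \<gamma>' F where c': "semisimple_cocycle L M \<alpha>' \<gamma>'" "admissible_cocycle L M (\<alpha>', \<gamma>')"
    and F: "metric_lie_iso (standard_model L M (\<alpha>', \<gamma>')) c.D F" "filtered_identity F"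
    by (rule sharp_representative[OF assms(1-5)])
  interpret c': semisimple_cocycle L M \<alpha>' \<gamma>' by (rule c'(1))
  have "symmetric_triple c'.D"
    using c'(2) by (intro c'.standard_model_symmetric_triple[OF T1]) (auto simp: admissible_cocycle_def)
  then show ?thesis by (rule symmetric_triple_iso_transfer[OF F(1) _ c.D_lie c.sp_D_form])
qed

theorem proposition6p1:
  fixes L1 :: "'l1::findim_real_vector inv_lie"
    and L2 :: "'l2::findim_real_vector inv_lie"
    and M1 :: "('l1, 'a1::findim_real_vector) orth_mod"
    and M2 :: "('l2, 'a2::findim_real_vector) orth_mod"
    and \<alpha>1 :: "'l1 \<Rightarrow> 'l1 \<Rightarrow> 'a1" and \<gamma>1 :: "'l1 \<Rightarrow> 'l1 \<Rightarrow> 'l1 \<Rightarrow> real"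
    and \<alpha>2 :: "'l2 \<Rightarrow> 'l2 \<Rightarrow> 'a2" and \<gamma>2 :: "'l2 \<Rightarrow> 'l2 \<Rightarrow> 'l2 \<Rightarrow> real"
  assumes "lie_algebra_with_involution L1" and "lie_algebra_with_involution L2"
    and "admissible TYPE('b1::findim_real_vector) L1"
    and "admissible TYPE('b2::findim_real_vector) L2"
    and "orthogonal_module L1 M1" and "orthogonal_module L2 M2"
    and "semisimple (rho M1) UNIV" and "semisimple (rho M2) UNIV"
    and "(\<alpha>1, \<gamma>1) \<in> ZQ2_plus L1 M1" and "(\<alpha>2, \<gamma>2) \<in> ZQ2_plus L2 M2"
    and "quad_class L1 M1 (\<alpha>1, \<gamma>1) \<in> HQ2_sharp L1 M1"
    and "quad_class L2 M2 (\<alpha>2, \<gamma>2) \<in> HQ2_sharp L2 M2"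
  shows "symmetric_triple_isomorphic (standard_model L1 M1 (\<alpha>1, \<gamma>1)) (standard_model L2 M2 (\<alpha>2, \<gamma>2))
    \<longleftrightarrow> (\<exists>S U. triple_isomorphism L1 M1 L2 M2 S U \<and>
           quad_class L1 M1 (quad_pullback S U (\<alpha>2, \<gamma>2)) = quad_class L1 M1 (\<alpha>1, \<gamma>1) \<and>
           quad_class L1 M1 (\<alpha>1, \<gamma>1) \<in> HQ2_sharp L1 M1)"
proof -
  interpret c1: quad_cocycle L1 M1 \<alpha>1 \<gamma>1
    using assms(1,5,9) by unfold_locales (auto simp: ZQ2_plus_def)
  interpret c2: quad_cocycle L2 M2 \<alpha>2 \<gamma>2
    using assms(2,6,10) by unfold_locales (auto simp: ZQ2_plus_def)
  note low1 = sharp_canonical_coisotropic[OF assms(1,5,7,9,11)]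
    and low2 = sharp_canonical_coisotropic[OF assms(2,6,8,10,12)]
  have st: "symmetric_triple c1.D" "symmetric_triple c2.D"
    using sharp_symmetric_triple[OF assms(1,5,7,9,11)] sharp_symmetric_triple[OF assms(2,6,8,10,12)] assms(3,4)
    by (simp_all add: admissible_def)
  have iso_iff: "symmetric_triple_isomorphic c1.D c2.D \<longleftrightarrow> (\<exists>F. metric_lie_iso c1.D c2.D F)"
    using st by (simp add: symmetric_triple_isomorphic_def metric_lie_iso_def)
  show ?thesis
    unfolding iso_iff
  proof
    assume "\<exists>F. metric_lie_iso c1.D c2.D F"
    then obtain F where F: "metric_lie_iso c1.D c2.D F" by blast
    have "F ` lower = lower"
      using metric_lie_iso_canonical[OF F c1.lin_D_brac c2.lin_D_brac] by (simp add: low1 low2)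
    then obtain S U where SU: "triple_isomorphism L1 M1 L2 M2 S U"
      "quad_pullback S U (\<alpha>2, \<gamma>2) \<in> quad_class L1 M1 (\<alpha>1, \<gamma>1)"
      using filtered_isomorphism_descends[OF c1.quad_cochain_axioms c2.quad_cochain_axioms F] by blast
    have "quad_class L1 M1 (quad_pullback S U (\<alpha>2, \<gamma>2)) = quad_class L1 M1 (\<alpha>1, \<gamma>1)"
      using quad_class_eqI[OF c1.quad_cochain_axioms] SU(2) by (metis surj_pair)
    then show "\<exists>S U. triple_isomorphism L1 M1 L2 M2 S U \<and>
           quad_class L1 M1 (quad_pullback S U (\<alpha>2, \<gamma>2)) = quad_class L1 M1 (\<alpha>1, \<gamma>1) \<and>
           quad_class L1 M1 (\<alpha>1, \<gamma>1) \<in> HQ2_sharp L1 M1"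
      using SU(1) assms(11) by blast
  next
    assume "\<exists>S U. triple_isomorphism L1 M1 L2 M2 S U \<and>
           quad_class L1 M1 (quad_pullback S U (\<alpha>2, \<gamma>2)) = quad_class L1 M1 (\<alpha>1, \<gamma>1) \<and>
           quad_class L1 M1 (\<alpha>1, \<gamma>1) \<in> HQ2_sharp L1 M1"
    then obtain S U where SU: "triple_isomorphism L1 M1 L2 M2 S U"
      and eq: "quad_class L1 M1 (quad_pullback S U (\<alpha>2, \<gamma>2)) = quad_class L1 M1 (\<alpha>1, \<gamma>1)" by blast
    interpret t: triple_iso_cochain L1 M1 L2 M2 \<alpha>2 \<gamma>2 S U by unfold_locales (rule SU)
    interpret p: quad_cochain L1 M1 t.\<alpha>p t.\<gamma>p by (rule t.pullback_cochain)
    have "(\<alpha>1, \<gamma>1) \<in> quad_class L1 M1 (t.\<alpha>p, t.\<gamma>p)"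
      using quad_class_refl[OF c1.quad_cochain_axioms] eq by (simp add: quad_pullback_def)
    from p.quad_class_member(2)[OF this] obtain F where "metric_lie_iso p.D c1.D F" by blast
    from metric_lie_iso_comp[OF metric_lie_iso_inv[OF this] t.triple_map_iso]
    show "\<exists>F. metric_lie_iso c1.D c2.D F" by blast
  qed
qed

end
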